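(* Let $p$ be a prime, let $K$ be a local field of characteristic $p$ with perfect residue field $k$, fix a prime element $\pi_K$ of $K$ (so $K$ is identified with $k((\pi_K))$), and let $K_s$ be a separable closure of $K$. Let $b \in \frac{1}{p-1}\cdot(\mathbb{N}\smallsetminus p\mathbb{N})$ and write $b = \frac{(m-1)p+\lambda}{p-1}$ with $m,\lambda$ integers and $1\le\lambda\le p-1$. Let $R=\{\omega_i : i\in I\}$ be a set of coset representatives for $k^{\times}/(k^{\times})^{(p-1)b}$. For each $\omega_i\in R$ let $\pi_i\in K_s$ be a root of the polynomial $X^p-\omega_i\pi_K^m X^{\lambda}-\pi_K$. Then the map which carries $\omega_i$ onto the $k$-isomorphism class of $K(\pi_i)/K$ gives a bijection from $R$ to $\mathcal{S}_b$. Furthermore, $K(\pi_i)/K$ is Galois if and only if $b\in\mathbb{N}\smallsetminus p\mathbb{N}$ and $\lambda\omega_i\in(k^{\times})^{p-1}$.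
   Context: A local field is a field complete with respect to a discrete valuation. $\mathbb{N}$ is the set of positive integers. Since $k$ is perfect and $\mathrm{char}(K)=p$, $K$ is identified with $k((\pi_K))$. Ramification break: let $L/K$ be a separable totally ramified extension of degree $p$ inside $K_s$, let $\nu_L$ be the valuation of $K_s$ normalized so that $\nu_L(L^\times)=\mathbb{Z}$, and let $\pi_L$ be a prime element of $L$. For a $K$-embedding $\sigma: L\to K_s$ with $\sigma\ne\mathrm{id}_L$, the ramification number of $\sigma$ is $\nu_L(\sigma(\pi_L)-\pi_L)-1$ (independent of the choice of $\pi_L$). For such a degree-$p$ extension all these numbers coincide, and the common value is the (lower) ramification break of $L/K$. $k$-isomorphism: finite extensions $L_1/K$ and $L_2/K$ are $k$-isomorphic if there is a field isomorphism $\sigma: L_1\to L_2$ such that $\sigma(K)=K$ and $\sigma$ induces the identity map on $k$. $\mathcal{E}_b$ denotes the set of all totally ramified subextensions $L/K$ of $K_s/K$ of degree $p$ with ramification break $b$, and $\mathcal{S}_b$ denotes the set of $k$-isomorphism classes of elements of $\mathcal{E}_b$. *)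

theory Defs
  imports "HOL-Algebra.Algebraic_Closure_Type" "HOL-Algebra.Generated_Fields" "HOL-Library.Extended_Real"
begin

text \<open>
  The separable closure \<open>K\<^sub>s\<close> is a type \<open>'s :: field\<close>. The field \<open>K\<close> and its extensions are
  subsets of \<open>'s\<close>, handled with the subfield, dimension and homomorphism notions of HOL-Algebra
  over the record of all of \<open>'s\<close>; \<open>\<F> L\<close> is the same record with carrier restricted to \<open>L\<close>.
\<close>

abbreviation Ks :: "'s::field ring" where
  "Ks \<equiv> ring_of_type_algebra"

abbreviation restr_field :: "'s::field set \<Rightarrow> 's ring" (\<open>\<F>\<close>) where
  "\<F> L \<equiv> Ks\<lparr>carrier := L\<rparr>"

definition field_adjoin :: "'s::field set \<Rightarrow> 's \<Rightarrow> 's set" where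
  "field_adjoin K x = generate_field Ks (insert x K)"


subsection \<open>Separable closures\<close>

definition separable_poly :: "'s::field poly \<Rightarrow> bool" where
  "separable_poly f \<longleftrightarrow> coprime f (pderiv f)"

definition separable_over :: "'s::field set \<Rightarrow> 's \<Rightarrow> bool" where
  "separable_over K x \<longleftrightarrow> (\<exists>f. (\<forall>i. poly.coeff f i \<in> K) \<and> separable_poly f \<and> poly f x = 0)"

definition is_separable_closure :: "'s::field set \<Rightarrow> bool" where
  "is_separable_closure K \<longleftrightarrow>
     subfield K (Ks :: 's ring) \<and>
     (\<forall>x::'s. separable_over K x) \<and>
     (\<forall>f::'s poly. separable_poly f \<and> Polynomial.degree f > 0 \<longrightarrow> (\<exists>x. poly f x = 0))"


subsection \<open>Local fields\<close>

definition field_valuation :: "('s::field \<Rightarrow> ereal) \<Rightarrow> bool" where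
  "field_valuation v \<longleftrightarrow>
     (\<forall>x. v x \<noteq> -\<infinity>) \<and> (\<forall>x. v x = \<infinity> \<longleftrightarrow> x = 0) \<and>
     (\<forall>x y. v (x * y) = v x + v y) \<and>
     (\<forall>x y. min (v x) (v y) \<le> v (x + y))"

definition complete_wrt :: "('s::field \<Rightarrow> ereal) \<Rightarrow> 's set \<Rightarrow> bool" where
  "complete_wrt v K \<longleftrightarrow>
     (\<forall>f :: nat \<Rightarrow> 's.
        (\<forall>n. f n \<in> K) \<and> (\<forall>C::real. \<exists>N. \<forall>m\<ge>N. \<forall>n\<ge>N. ereal C < v (f m - f n)) \<longrightarrow>
        (\<exists>x\<in>K. \<forall>C::real. \<exists>N. \<forall>n\<ge>N. ereal C < v (f n - x)))"

text \<open>
  Here \<open>v\<close> is a valuation of all of \<open>K\<^sub>s\<close>, namely the (unique) extension of the valuation of \<open>K\<close>;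
  it is scaled so that \<open>v(K\<^sup>\<times>) = \<int>\<close>.
\<close>

definition local_field :: "('s::field \<Rightarrow> ereal) \<Rightarrow> 's set \<Rightarrow> bool" where
  "local_field v K \<longleftrightarrow>
     subfield K Ks \<and> field_valuation v \<and>
     v ` (K - {0}) = range (\<lambda>i::int. ereal (of_int i)) \<and> complete_wrt v K"

text \<open>
  The residue field, realised inside \<open>K\<close> as in the identification of \<open>K\<close> with \<open>k((\<pi>\<^sub>K))\<close>: a subfield
  of the valuation ring \<open>O\<^sub>K\<close> that maps bijectively onto \<open>O\<^sub>K\<close> modulo its maximal ideal (injectivity
  is automatic). If the residue field is perfect of characteristic \<open>p = char K\<close>, there is exactly one
  such subfield.
\<close>

definition residue_subfield :: "('s::field \<Rightarrow> ereal) \<Rightarrow> 's set \<Rightarrow> 's set \<Rightarrow> bool" where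
  "residue_subfield v K k \<longleftrightarrow>
     subfield k Ks \<and> k \<subseteq> K \<and> (\<forall>a\<in>k. 0 \<le> v a) \<and>
     (\<forall>x\<in>K. 0 \<le> v x \<longrightarrow> (\<exists>a\<in>k. 0 < v (x - a)))"

definition perfect_char :: "nat \<Rightarrow> 's::field set \<Rightarrow> bool" where
  "perfect_char p k \<longleftrightarrow> (\<forall>a\<in>k. \<exists>c\<in>k. c ^ p = a)"


subsection \<open>Ramification\<close>

text \<open>\<open>\<nu>\<^sub>L\<close>: the multiple of \<open>v\<close> (hence a valuation of all of \<open>K\<^sub>s\<close>) with \<open>\<nu>\<^sub>L(L\<^sup>\<times>) = \<int>\<close>.\<close>

definition normalized_val :: "('s::field \<Rightarrow> ereal) \<Rightarrow> 's set \<Rightarrow> 's \<Rightarrow> ereal" where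
  "normalized_val v L =
     (THE w. (\<exists>c::real. c > 0 \<and> w = (\<lambda>x. ereal c * v x)) \<and>
             w ` (L - {0}) = range (\<lambda>i::int. ereal (of_int i)))"

definition prime_element :: "('s::field \<Rightarrow> ereal) \<Rightarrow> 's set \<Rightarrow> 's \<Rightarrow> bool" where
  "prime_element v L x \<longleftrightarrow> x \<in> L \<and> normalized_val v L x = 1"

text \<open>
  The ramification index, i.e. the index of \<open>\<nu>\<^sub>L(K\<^sup>\<times>)\<close> in \<open>\<nu>\<^sub>L(L\<^sup>\<times>) = \<int>\<close>, is \<open>e\<close> iff
  \<open>\<nu>\<^sub>L(K\<^sup>\<times>) = e\<int>\<close>.
\<close>

definition has_ramification_index ::
    "('s::field \<Rightarrow> ereal) \<Rightarrow> 's set \<Rightarrow> 's set \<Rightarrow> nat \<Rightarrow> bool" where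
  "has_ramification_index v K L e \<longleftrightarrow>
     e > 0 \<and> normalized_val v L ` (K - {0}) = range (\<lambda>i::int. ereal (real e * of_int i))"

definition totally_ramified_of_degree ::
    "('s::field \<Rightarrow> ereal) \<Rightarrow> 's set \<Rightarrow> 's set \<Rightarrow> nat \<Rightarrow> bool" where
  "totally_ramified_of_degree v K L n \<longleftrightarrow>
     subfield L Ks \<and> K \<subseteq> L \<and> ring.dimension Ks n K L \<and> has_ramification_index v K L n"

definition embeddings :: "'s::field set \<Rightarrow> 's set \<Rightarrow> ('s \<Rightarrow> 's) set" where
  "embeddings K L = {\<sigma> \<in> ring_hom (\<F> L) Ks. \<forall>x\<in>K. \<sigma> x = x}"

definition ramification_numbers :: "('s::field \<Rightarrow> ereal) \<Rightarrow> 's set \<Rightarrow> 's set \<Rightarrow> ereal set" where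
  "ramification_numbers v K L =
     {normalized_val v L (\<sigma> \<pi> - \<pi>) - 1 | \<sigma> \<pi>.
        \<sigma> \<in> embeddings K L \<and> (\<exists>x\<in>L. \<sigma> x \<noteq> x) \<and> prime_element v L \<pi>}"

definition has_ramification_break ::
    "('s::field \<Rightarrow> ereal) \<Rightarrow> 's set \<Rightarrow> 's set \<Rightarrow> real \<Rightarrow> bool" where
  "has_ramification_break v K L b \<longleftrightarrow> ramification_numbers v K L = {ereal b}"

definition ramified_exts ::
    "('s::field \<Rightarrow> ereal) \<Rightarrow> 's set \<Rightarrow> nat \<Rightarrow> real \<Rightarrow> 's set set" (\<open>\<E>\<close>) where
  "\<E> v K p b = {L. totally_ramified_of_degree v K L p \<and> has_ramification_break v K L b}"


subsection \<open>Isomorphism classes\<close>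

text \<open>
  The last condition says that \<open>\<sigma>\<close> maps \<open>O\<^sub>K\<close> to itself and induces the identity on the residue field.
\<close>

definition k_isomorphic ::
    "('s::field \<Rightarrow> ereal) \<Rightarrow> 's set \<Rightarrow> 's set \<Rightarrow> 's set \<Rightarrow> bool" where
  "k_isomorphic v K L1 L2 \<longleftrightarrow>
     (\<exists>\<sigma> \<in> ring_iso (\<F> L1) (\<F> L2).
        \<sigma> ` K = K \<and> (\<forall>x\<in>K. 0 \<le> v x \<longrightarrow> 0 < v (\<sigma> x - x)))"

definition k_iso_rel ::
    "('s::field \<Rightarrow> ereal) \<Rightarrow> 's set \<Rightarrow> nat \<Rightarrow> real \<Rightarrow> ('s set \<times> 's set) set" where
  "k_iso_rel v K p b = {(L1, L2). L1 \<in> \<E> v K p b \<and> L2 \<in> \<E> v K p b \<and> k_isomorphic v K L1 L2}"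

definition k_iso_classes ::
    "('s::field \<Rightarrow> ereal) \<Rightarrow> 's set \<Rightarrow> nat \<Rightarrow> real \<Rightarrow> 's set set set" (\<open>\<S>\<close>) where
  "\<S> v K p b = \<E> v K p b // k_iso_rel v K p b"


subsection \<open>Galois extensions, power cosets and the defining polynomials\<close>

text \<open>
  For a finite extension \<open>L/K\<close>: \<open>L/K\<close> is Galois iff the fixed field of its automorphism group is \<open>K\<close>.
\<close>

definition galois_extension :: "'s::field set \<Rightarrow> 's set \<Rightarrow> bool" where
  "galois_extension K L \<longleftrightarrow>
     subfield L Ks \<and> K \<subseteq> L \<and> (\<exists>n. ring.dimension Ks n K L) \<and>
     {x \<in> L. \<forall>\<sigma> \<in> ring_iso (\<F> L) (\<F> L). (\<forall>y\<in>K. \<sigma> y = y) \<longrightarrow> \<sigma> x = x} = K"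

definition unit_powers :: "'s::field set \<Rightarrow> nat \<Rightarrow> 's set" where
  "unit_powers k n = (\<lambda>c. c ^ n) ` (k - {0})"

definition coset_representatives :: "'s::field set \<Rightarrow> 's set \<Rightarrow> 's set \<Rightarrow> bool" where
  "coset_representatives G H R \<longleftrightarrow> R \<subseteq> G \<and> (\<forall>x\<in>G. \<exists>!r. r \<in> R \<and> (\<exists>h\<in>H. x = r * h))"

definition amano_poly :: "nat \<Rightarrow> int \<Rightarrow> nat \<Rightarrow> 's::field \<Rightarrow> 's \<Rightarrow> 's poly" where
  "amano_poly p m l \<pi> \<omega> =
     Polynomial.monom 1 p - Polynomial.monom (\<omega> * \<pi> powi m) l - [:\<pi>:]"

end

theory Submission
  imports Defs
begin

text \<open>
  Let \<open>V = p v\<close>. A totally ramified extension \<open>L/K\<close> of degree \<open>p\<close> has the \<open>K\<close>-basis \<open>1, x, \<dots>, x\<^bsup>p-1\<^esup>\<close> for any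
  prime element \<open>x\<close>, and the values of \<open>c\<^sub>i x\<^sup>i\<close> with \<open>c\<^sub>i \<in> K\<close> are distinct modulo \<open>p\<close>; so all questions about
  sums are decided termwise. If \<open>L\<close> has break \<open>n/(p-1)\<close>, the derivative of the minimal polynomial of \<open>x\<close>
  shows \<open>x\<^sup>p \<equiv> t + \<omega> t\<^sup>m x\<^sup>l\<close> up to order \<open>n + p\<close> for some prime element \<open>t\<close> of \<open>K\<close>, and scaling \<open>x\<close> by
  \<open>c \<in> k\<close> divides \<open>\<omega>\<close> by \<open>c\<^sup>n\<close>. Successive approximation in \<open>(t, x)\<close> makes the relation
  exact; the automorphism of \<open>K\<close> moving \<open>t\<close> to \<open>\<pi>\<^sub>K\<close> then extends to a \<open>k\<close>-isomorphism of \<open>L\<close> onto the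
  extension given by the Amano polynomial. Conversely the relation determines \<open>\<omega>\<close> modulo \<open>n\<close>-th powers.
  A conjugate \<open>x + z\<close> of a root \<open>x\<close> of the Amano polynomial satisfies
  \<open>z\<^bsup>p-1\<^esup> \<approx> l \<omega> t\<^sup>m x\<^bsup>l-1\<^esup>\<close>, which gives the break and, by comparison of leading terms, the Galois
  criterion.
\<close>

section \<open>Linear algebra over a subfield\<close>

text \<open>Characteristic \<open>p\<close> shapes the argument twice. The derivative of the minimal
  polynomial loses \<open>X^p\<close> together with the constant term, so the break constrains only
  the coefficients with \<open>0 < i < p\<close>, and \<open>t\<close> remains a free prime element
  of \<open>K\<close>; isomorphisms that move \<open>K\<close> absorb this freedom. Moreover
  Frobenius is additive: changing \<open>x\<close> by \<open>h\<close> changes \<open>x^p\<close> by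
  exactly \<open>h^p\<close>, and up to high order such a \<open>p\<close>-th power lies in
  \<open>K\<close>, where \<open>t\<close> can compensate it. What remains is the first-order change
  of the middle term.

  The number \<open>n + p\<close> is the value of \<open>x f'(x)\<close>: \<open>p - 1\<close>
  differences of conjugates, each of value \<open>1 + n/(p-1)\<close>, plus 1 for \<open>x\<close>.
  Modulo \<open>p\<close> it is \<open>l\<close>, not 0. Hence it is carried by exactly one term
  \<open>a_l x^l\<close> and by no element of \<open>K\<close>, which is what makes \<omega>
  readable from the extension.

  Under scaling by \<open>c\<close>, both \<open>x^p\<close> and \<open>t\<close> pick up
  \<open>c^p\<close>, but \<open>t^m x^l\<close> picks up \<open>c^(m p + l) = c^(n + p)\<close>;
  the quotient \<open>c^n\<close> is the origin of the \<open>n\<close>-th powers.\<close>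

lemma field_Ks: "field (Ks :: 's::field ring)"
  by (rule field_from_type_algebra)

lemma Ks_simps [simp]:
  "carrier (Ks :: 's::field ring) = UNIV"
  "\<one>\<^bsub>(Ks :: 's::field ring)\<^esub> = 1" "\<zero>\<^bsub>(Ks :: 's::field ring)\<^esub> = 0"
  "x \<otimes>\<^bsub>Ks\<^esub> y = (x * y :: 's::field)" "x \<oplus>\<^bsub>Ks\<^esub> y = x + y"
  by (simp_all add: ring_of_type_algebra_def)

lemma Ks_a_inv [simp]: "\<ominus>\<^bsub>Ks\<^esub> x = (- x :: 's::field)"
proof -
  interpret field "Ks :: 's ring" by (rule field_Ks)
  have "\<ominus>\<^bsub>Ks\<^esub> x \<oplus>\<^bsub>Ks\<^esub> x = \<zero>\<^bsub>Ks\<^esub>" by (rule l_neg) simp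
  thus ?thesis by (simp add: eq_neg_iff_add_eq_0)
qed

lemma Ks_m_inv [simp]: "x \<noteq> 0 \<Longrightarrow> inv\<^bsub>Ks\<^esub> x = (inverse x :: 's::field)"
proof -
  interpret field "Ks :: 's ring" by (rule field_Ks)
  assume "x \<noteq> 0"
  hence "x \<in> Units (Ks :: 's ring)" by (simp add: field_Units)
  hence "inv\<^bsub>Ks\<^esub> x \<otimes>\<^bsub>Ks\<^esub> x = \<one>\<^bsub>Ks\<^esub>" by (rule Units_l_inv)
  thus ?thesis using \<open>x \<noteq> 0\<close> by (simp add: field_simps)
qed

text \<open>An elementwise version of \<open>subfield\<close> in terms of the type-class operations.
  \<open>inverse_mem\<close> can be stated for all elements because
  \<open>inverse 0 = 0\<close>.\<close>

locale subfield_set =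
  fixes F :: "'s::field set"
  assumes one_mem [simp]: "1 \<in> F"
    and add_mem: "x \<in> F \<Longrightarrow> y \<in> F \<Longrightarrow> x + y \<in> F"
    and uminus_mem: "x \<in> F \<Longrightarrow> - x \<in> F"
    and mult_mem: "x \<in> F \<Longrightarrow> y \<in> F \<Longrightarrow> x * y \<in> F"
    and inverse_mem: "x \<in> F \<Longrightarrow> inverse x \<in> F"
begin

lemma zero_mem [simp]: "0 \<in> F"
  using add_mem[OF one_mem uminus_mem[OF one_mem]] by simp

lemma diff_mem: "x \<in> F \<Longrightarrow> y \<in> F \<Longrightarrow> x - y \<in> F"
  using add_mem[of x "- y"] uminus_mem by simp

lemma divide_mem: "x \<in> F \<Longrightarrow> y \<in> F \<Longrightarrow> x / y \<in> F"
  using mult_mem[of x "inverse y"] inverse_mem by (simp add: divide_inverse)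

lemma power_mem: "x \<in> F \<Longrightarrow> x ^ i \<in> F"
  by (induction i) (auto intro: mult_mem)

lemma power_int_mem: "x \<in> F \<Longrightarrow> x powi i \<in> F"
  by (auto simp: power_int_def intro: power_mem inverse_mem)

lemma of_nat_mem: "of_nat i \<in> F"
  by (induction i) (auto intro: add_mem)

lemma sum_mem: "(\<And>i. i \<in> I \<Longrightarrow> g i \<in> F) \<Longrightarrow> sum g I \<in> F"
  by (induction I rule: infinite_finite_induct) (auto intro: add_mem)

lemmas mems = add_mem uminus_mem mult_mem inverse_mem diff_mem divide_mem power_mem
  power_int_mem of_nat_mem sum_mem

end

lemma subfield_Ks_iff: "subfield F (Ks :: 's::field ring) \<longleftrightarrow> subfield_set F"
proof -
  interpret field "Ks :: 's ring" by (rule field_Ks)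
  show ?thesis
  proof
    assume F: "subfield F (Ks :: 's ring)"
    note S = subfieldE(1)[OF F]
    have inv: "inverse x \<in> F" if "x \<in> F" for x
    proof (cases "x = 0")
      case True thus ?thesis using that by simp
    next
      case False
      thus ?thesis using subfield_m_inv(1)[OF F, of x] that by simp
    qed
    show "subfield_set F"
      using subringE[OF S] inv by unfold_locales auto
  next
    assume "subfield_set F"
    then interpret F: subfield_set F .
    show "subfield F (Ks :: 's ring)"
    proof (rule subfieldI')
      show "subring F (Ks :: 's ring)"
        by (rule subringI) (auto intro: F.mems)
    qed (auto intro: F.mems)
  qed
qed

lemma field_adjoin_least:
  assumes "subfield_set (F :: 's::field set)" "K \<subseteq> F" "x \<in> F"
  shows "field_adjoin K x \<subseteq> F"
proof -
  interpret field "Ks :: 's ring" by (rule field_Ks)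
  show ?thesis unfolding field_adjoin_def
    by (rule generate_field_min_subfield1) (use assms in \<open>auto simp: subfield_Ks_iff\<close>)
qed

lemma subfield_field_adjoin: "subfield_set (field_adjoin K (x :: 's::field))"
proof -
  interpret field "Ks :: 's ring" by (rule field_Ks)
  show ?thesis
    unfolding field_adjoin_def subfield_Ks_iff[symmetric]
    by (rule generate_field_is_subfield) simp
qed

lemma field_adjoin_incl: "c \<in> K \<Longrightarrow> c \<in> field_adjoin K (x :: 's::field)" "x \<in> field_adjoin K x"
  by (auto simp: field_adjoin_def intro: generate_field.incl)

definition span_pow :: "'s::field set \<Rightarrow> nat \<Rightarrow> (nat \<Rightarrow> 's) \<Rightarrow> 's set" where
  "span_pow K N a = {\<Sum>i<N. c i * a i | c. \<forall>i<N. c i \<in> K}"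

text \<open>Indexed families rather than sets: a repeated entry counts as a dependence, as it must
  for the powers of an arbitrary element.\<close>

definition lin_indep :: "'s::field set \<Rightarrow> nat \<Rightarrow> (nat \<Rightarrow> 's) \<Rightarrow> bool" where
  "lin_indep K N a \<longleftrightarrow> (\<forall>c. (\<forall>i<N. c i \<in> K) \<and> (\<Sum>i<N. c i * a i) = 0 \<longrightarrow> (\<forall>i<N. c i = 0))"

lemma combine_Ks:
  "length Cs = length Us \<Longrightarrow> ring.combine Ks Cs Us = (\<Sum>i<length Us. Cs ! i * (Us ! i :: 's::field))"
proof -
  interpret field "Ks :: 's ring" by (rule field_Ks)
  show "length Cs = length Us \<Longrightarrow> combine Cs Us = (\<Sum>i<length Us. Cs ! i * Us ! i)"
    by (induction Cs Us rule: list_induct2) (simp_all add: sum.lessThan_Suc_shift del: sum.lessThan_Suc)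
qed

lemma Span_Ks:
  fixes a :: "nat \<Rightarrow> 's::field"
  assumes "subfield_set K"
  shows "ring.Span Ks K (map a [0..<N]) = span_pow K N a"
proof -
  interpret field "Ks :: 's ring" by (rule field_Ks)
  have K: "subfield K (Ks :: 's ring)" using assms by (simp add: subfield_Ks_iff)
  have "x \<in> Span K (map a [0..<N]) \<longleftrightarrow> x \<in> span_pow K N a" for x
  proof -
    have "x \<in> Span K (map a [0..<N]) \<longleftrightarrow>
       (\<exists>Cs. set Cs \<subseteq> K \<and> length Cs = N \<and> x = combine Cs (map a [0..<N]))"
      using Span_mem_iff_length_version[OF K, of "map a [0..<N]" x] by simp
    also have "\<dots> \<longleftrightarrow> (\<exists>Cs. set Cs \<subseteq> K \<and> length Cs = N \<and> x = (\<Sum>i<N. Cs ! i * a i))"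
      by (intro iff_exI conj_cong refl) (simp add: combine_Ks)
    also have "\<dots> \<longleftrightarrow> x \<in> span_pow K N a"
    proof
      assume "\<exists>Cs. set Cs \<subseteq> K \<and> length Cs = N \<and> x = (\<Sum>i<N. Cs ! i * a i)"
      thus "x \<in> span_pow K N a"
        unfolding span_pow_def by (force simp: subset_iff)
    next
      assume "x \<in> span_pow K N a"
      then obtain c where "\<forall>i<N. c i \<in> K" "x = (\<Sum>i<N. c i * a i)"
        unfolding span_pow_def by auto
      thus "\<exists>Cs. set Cs \<subseteq> K \<and> length Cs = N \<and> x = (\<Sum>i<N. Cs ! i * a i)"
        by (intro exI[of _ "map c [0..<N]"]) auto
    qed
    finally show ?thesis .
  qed
  thus ?thesis by blast
qed

lemma independent_Ks:
  fixes a :: "nat \<Rightarrow> 's::field"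
  assumes "subfield_set K"
  shows "ring.independent Ks K (map a [0..<N]) \<longleftrightarrow> lin_indep K N a"
proof -
  interpret field "Ks :: 's ring" by (rule field_Ks)
  have K: "subfield K (Ks :: 's ring)" using assms by (simp add: subfield_Ks_iff)
  let ?Us = "map a [0..<N]"
  show ?thesis
  proof
    assume ind: "independent K ?Us"
    show "lin_indep K N a" unfolding lin_indep_def
    proof (intro allI impI, elim conjE)
      fix c i assume c: "\<forall>i<N. c i \<in> K" "(\<Sum>i<N. c i * a i) = 0" "i < N"
      have "set (take (length ?Us) (map c [0..<N])) \<subseteq> {\<zero>\<^bsub>Ks\<^esub>}"
        by (rule independent_imp_trivial_combine[OF K ind]) (use c in \<open>auto simp: combine_Ks\<close>)
      thus "c i = 0" using c(3) by (auto simp: image_subset_iff)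
    qed
  next
    assume ind: "lin_indep K N a"
    show "independent K ?Us"
    proof (rule ccontr)
      assume "\<not> ?thesis"
      from dependent_imp_non_trivial_combine[OF K _ this] obtain Cs where
        Cs: "length Cs = N" "combine Cs ?Us = 0" "set Cs \<subseteq> K" "set Cs \<noteq> {0}" by auto
      hence "(\<Sum>i<N. Cs ! i * a i) = 0" by (simp add: combine_Ks)
      hence "\<forall>i<N. Cs ! i = 0"
        using ind Cs unfolding lin_indep_def by (auto simp: subset_iff)
      hence "set Cs \<subseteq> {0}" using Cs(1) by (auto simp: in_set_conv_nth)
      moreover have "N > 0"
      proof (rule ccontr)
        assume "\<not> 0 < N"
        hence "?Us = []" by simp
        thus False using \<open>\<not> independent K ?Us\<close> by auto
      qed
      ultimately show False using Cs(1,4) by (cases Cs) auto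
    qed
  qed
qed

lemma dimension_span_pow:
  fixes a :: "nat \<Rightarrow> 's::field"
  assumes "subfield_set K" "lin_indep K N a"
  shows "ring.dimension Ks N K (span_pow K N a)"
proof -
  interpret field "Ks :: 's ring" by (rule field_Ks)
  have K: "subfield K (Ks :: 's ring)" using assms by (simp add: subfield_Ks_iff)
  show ?thesis
    using dimensionI[OF K _ Span_Ks[OF assms(1), of a N]] assms by (simp add: independent_Ks)
qed

lemma dimension_eq_span_pow:
  fixes a :: "nat \<Rightarrow> 's::field"
  assumes "subfield_set K" "ring.dimension Ks N K E" "lin_indep K N a" "\<And>i. i < N \<Longrightarrow> a i \<in> E"
  shows "E = span_pow K N a"
proof -
  interpret field "Ks :: 's ring" by (rule field_Ks)
  have K: "subfield K (Ks :: 's ring)" using assms by (simp add: subfield_Ks_iff)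
  have "length (map a [0..<N]) = N \<longleftrightarrow> Span K (map a [0..<N]) = E"
    by (rule independent_length_eq_dimension[OF K assms(2)])
      (use assms in \<open>auto simp: independent_Ks\<close>)
  thus ?thesis by (simp add: Span_Ks[OF assms(1)] del: Span.simps)
qed

lemma dimension_not_lin_indep:
  fixes a :: "nat \<Rightarrow> 's::field"
  assumes "subfield_set K" "ring.dimension Ks N K E" "\<And>i. i < M \<Longrightarrow> a i \<in> E" "N < M"
  shows "\<not> lin_indep K M a"
proof
  interpret field "Ks :: 's ring" by (rule field_Ks)
  have K: "subfield K (Ks :: 's ring)" using assms by (simp add: subfield_Ks_iff)
  assume "lin_indep K M a"
  hence "length (map a [0..<M]) \<le> N"
    by (intro independent_length_le_dimension[OF K assms(2)]) (use assms in \<open>auto simp: independent_Ks\<close>)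
  thus False using assms(4) by simp
qed

section \<open>Real-valued non-archimedean valuations\<close>

locale nonarch =
  fixes V :: "'s::field \<Rightarrow> real"
  assumes V_mult: "x \<noteq> 0 \<Longrightarrow> y \<noteq> 0 \<Longrightarrow> V (x * y) = V x + V y"
    and V_add: "x \<noteq> 0 \<Longrightarrow> y \<noteq> 0 \<Longrightarrow> x + y \<noteq> 0 \<Longrightarrow> min (V x) (V y) \<le> V (x + y)"
begin

text \<open>
  \<open>V 0\<close> is arbitrary: \<open>M r\<close> and \<open>Ms r\<close> express \<open>V x \<ge> r\<close> and \<open>V x > r\<close> under the convention
  that \<open>V 0\<close> is infinite.
\<close>

definition M :: "real \<Rightarrow> 's set" where "M r = {x. x = 0 \<or> r \<le> V x}"
definition Ms :: "real \<Rightarrow> 's set" where "Ms r = {x. x = 0 \<or> r < V x}"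

lemma V_one [simp]: "V 1 = 0"
  using V_mult[of 1 1] by simp

lemma V_minus_one: "V (- 1) = 0"
  using V_mult[of "-1" "-1"] by simp

lemma V_minus [simp]: "V (- x) = V x"
proof (cases "x = 0")
  case False
  thus ?thesis using V_mult[of "-1" x] V_minus_one by simp
qed auto

lemma V_minus_commute: "V (x - y) = V (y - x)"
  using V_minus[of "x - y"] by simp

lemma V_inverse: "x \<noteq> 0 \<Longrightarrow> V (inverse x) = - V x"
  using V_mult[of x "inverse x"] by simp

lemma V_divide: "x \<noteq> 0 \<Longrightarrow> y \<noteq> 0 \<Longrightarrow> V (x / y) = V x - V y"
  using V_mult[of x "inverse y"] V_inverse[of y] by (simp add: divide_inverse)

lemma V_power: "x \<noteq> 0 \<Longrightarrow> V (x ^ i) = real i * V x"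
  by (induction i) (auto simp: V_mult algebra_simps)

lemma V_power_int: "x \<noteq> 0 \<Longrightarrow> V (x powi i) = of_int i * V x"
  by (auto simp: power_int_def V_power V_inverse)

lemma M_iff: "x \<noteq> 0 \<Longrightarrow> x \<in> M r \<longleftrightarrow> r \<le> V x"
  by (simp add: M_def)

lemma Ms_iff: "x \<noteq> 0 \<Longrightarrow> x \<in> Ms r \<longleftrightarrow> r < V x"
  by (simp add: Ms_def)

lemma zero_M [simp]: "0 \<in> M r" by (simp add: M_def)
lemma zero_Ms [simp]: "0 \<in> Ms r" by (simp add: Ms_def)

lemma M_self: "x \<in> M (V x)" by (simp add: M_def)

lemma M_mono: "x \<in> M r \<Longrightarrow> s \<le> r \<Longrightarrow> x \<in> M s" by (auto simp: M_def)
lemma M_Ms: "x \<in> M r \<Longrightarrow> s < r \<Longrightarrow> x \<in> Ms s" by (auto simp: M_def Ms_def)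
lemma Ms_M: "x \<in> Ms r \<Longrightarrow> s \<le> r \<Longrightarrow> x \<in> M s" by (auto simp: M_def Ms_def)

lemma M_add: "x \<in> M r \<Longrightarrow> y \<in> M r \<Longrightarrow> x + y \<in> M r"
  using V_add[of x y] by (cases "x = 0 \<or> y = 0 \<or> x + y = 0") (auto simp: M_def min_le_iff_disj)

lemma Ms_add: "x \<in> Ms r \<Longrightarrow> y \<in> Ms r \<Longrightarrow> x + y \<in> Ms r"
  using V_add[of x y] by (cases "x = 0 \<or> y = 0 \<or> x + y = 0") (auto simp: Ms_def min_le_iff_disj)

lemma M_minus: "x \<in> M r \<Longrightarrow> - x \<in> M r" by (simp add: M_def)
lemma Ms_minus: "x \<in> Ms r \<Longrightarrow> - x \<in> Ms r" by (simp add: Ms_def)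

lemma M_diff: "x \<in> M r \<Longrightarrow> y \<in> M r \<Longrightarrow> x - y \<in> M r"
  using M_add[of x r "-y"] M_minus by simp

lemma Ms_diff: "x \<in> Ms r \<Longrightarrow> y \<in> Ms r \<Longrightarrow> x - y \<in> Ms r"
  using Ms_add[of x r "-y"] Ms_minus by simp

lemma M_diff_commute: "x - y \<in> M r \<longleftrightarrow> y - x \<in> M r"
  using M_minus[of "x - y"] M_minus[of "y - x"] by auto

lemma M_trans: "x - y \<in> M r \<Longrightarrow> y - z \<in> M r \<Longrightarrow> x - z \<in> M r"
  using M_add[of "x - y" r "y - z"] by simp

lemma M_sum: "(\<And>i. i \<in> I \<Longrightarrow> g i \<in> M r) \<Longrightarrow> sum g I \<in> M r"
  by (induction I rule: infinite_finite_induct) (auto intro: M_add)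

lemma Ms_sum: "(\<And>i. i \<in> I \<Longrightarrow> g i \<in> Ms r) \<Longrightarrow> sum g I \<in> Ms r"
  by (induction I rule: infinite_finite_induct) (auto intro: Ms_add)

lemma M_mult: "x \<in> M r \<Longrightarrow> y \<in> M s \<Longrightarrow> x * y \<in> M (r + s)"
  by (cases "x = 0 \<or> y = 0") (auto simp: M_def V_mult)

lemma M_Ms_mult: "x \<in> M r \<Longrightarrow> y \<in> Ms s \<Longrightarrow> x * y \<in> Ms (r + s)"
  by (cases "x = 0 \<or> y = 0") (auto simp: M_def Ms_def V_mult)

lemma M_power: "x \<in> M r \<Longrightarrow> x ^ i \<in> M (real i * r)"
  by (cases "x = 0") (auto simp: M_def V_power mult_left_mono power_0_left)

lemma M_mult_iff: "c \<noteq> 0 \<Longrightarrow> c * x \<in> M r \<longleftrightarrow> x \<in> M (r - V c)"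
  by (cases "x = 0") (auto simp: M_def V_mult)

lemma M_divide_iff: "c \<noteq> 0 \<Longrightarrow> x / c \<in> M r \<longleftrightarrow> x \<in> M (r + V c)"
  by (cases "x = 0") (auto simp: M_def V_divide)

lemma Ms_divide_iff: "c \<noteq> 0 \<Longrightarrow> x / c \<in> Ms r \<longleftrightarrow> x \<in> Ms (r + V c)"
  by (cases "x = 0") (auto simp: Ms_def V_divide)

lemma V_add_dominant:
  assumes "x \<noteq> 0" "y \<in> Ms (V x)"
  shows "x + y \<noteq> 0" "V (x + y) = V x"
proof -
  show nz: "x + y \<noteq> 0"
  proof
    assume "x + y = 0"
    hence "y = - x" by (metis minus_unique)
    thus False using assms by (auto simp: Ms_def)
  qed
  show "V (x + y) = V x"
  proof (cases "y = 0")
    case False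
    have "V x < V y" using assms False by (auto simp: Ms_def)
    moreover have "min (V x) (V y) \<le> V (x + y)" by (rule V_add) (use assms False nz in auto)
    moreover have "min (V (x + y)) (V y) \<le> V x"
      using V_add[of "x + y" "- y"] nz False assms(1) by simp
    ultimately show ?thesis by linarith
  qed auto
qed

lemma V_diff_neq:
  assumes "x \<noteq> 0" "y \<noteq> 0" "V x \<noteq> V y"
  shows "x + y \<noteq> 0" "V (x + y) = min (V x) (V y)"
  using V_add_dominant[of x y] V_add_dominant[of y x] assms
  by (auto simp: Ms_def add.commute linorder_neq_iff)

text \<open>Terms of different value cannot cancel, so the term of least value decides. Zero terms
  are exempted since \<open>V 0\<close> is arbitrary.\<close>

lemma sum_distinct_V:
  assumes "finite I" "\<And>i j. i \<in> I \<Longrightarrow> j \<in> I \<Longrightarrow> i \<noteq> j \<Longrightarrow> a i \<noteq> 0 \<Longrightarrow> a j \<noteq> 0 \<Longrightarrow> V (a i) \<noteq> V (a j)"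
  shows "(\<forall>i\<in>I. a i = 0) \<or>
    (\<exists>i\<in>I. a i \<noteq> 0 \<and> sum a I \<noteq> 0 \<and> V (sum a I) = V (a i) \<and> (\<forall>j\<in>I. a j \<in> M (V (a i))))"
  using assms
proof (induction I rule: finite_induct)
  case (insert j F)
  have IH: "(\<forall>i\<in>F. a i = 0) \<or>
    (\<exists>i\<in>F. a i \<noteq> 0 \<and> sum a F \<noteq> 0 \<and> V (sum a F) = V (a i) \<and> (\<forall>j\<in>F. a j \<in> M (V (a i))))"
    by (rule insert.IH) (use insert.prems in auto)
  have s: "sum a (insert j F) = a j + sum a F" using insert by simp
  show ?case
  proof (cases "a j = 0")
    case True
    thus ?thesis using IH s by auto
  next
    case nz: False
    show ?thesis
    proof (cases "\<forall>i\<in>F. a i = 0")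
      case True
      hence "sum a F = 0" by simp
      thus ?thesis using nz s True by (auto intro!: bexI[of _ j] simp: M_self)
    next
      case False
      then obtain i where i: "i \<in> F" "a i \<noteq> 0" "sum a F \<noteq> 0" "V (sum a F) = V (a i)"
          "\<forall>j\<in>F. a j \<in> M (V (a i))" using IH by auto
      have neq: "V (a j) \<noteq> V (a i)" using insert i nz by (metis insertCI)
      note d = V_diff_neq[of "a j" "sum a F", unfolded i(4), OF nz i(3) neq]
      show ?thesis
      proof (cases "V (a j) < V (a i)")
        case True
        hence "\<forall>i\<in>F. a i \<in> M (V (a j))" using i(5) by (auto intro: M_mono)
        thus ?thesis using d s nz True by (auto intro!: bexI[of _ j] simp: M_self)
      next
        case False
        hence "a j \<in> M (V (a i))" by (simp add: M_def)
        thus ?thesis using d s i False neq by (auto intro!: bexI[of _ i])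
      qed
    qed
  qed
qed auto

lemma sum_distinct_V_M:
  assumes "finite I" "\<And>i j. i \<in> I \<Longrightarrow> j \<in> I \<Longrightarrow> i \<noteq> j \<Longrightarrow> a i \<noteq> 0 \<Longrightarrow> a j \<noteq> 0 \<Longrightarrow> V (a i) \<noteq> V (a j)"
    and "sum a I \<in> M r" "i \<in> I"
  shows "a i \<in> M r"
proof -
  have "(\<forall>i\<in>I. a i = 0) \<or>
    (\<exists>i\<in>I. a i \<noteq> 0 \<and> sum a I \<noteq> 0 \<and> V (sum a I) = V (a i) \<and> (\<forall>j\<in>I. a j \<in> M (V (a i))))"
    by (rule sum_distinct_V) (use assms in auto)
  thus ?thesis using assms(3,4) by (force simp: M_def)
qed

lemma sum_distinct_V_zero:
  assumes "finite I" "\<And>i j. i \<in> I \<Longrightarrow> j \<in> I \<Longrightarrow> i \<noteq> j \<Longrightarrow> a i \<noteq> 0 \<Longrightarrow> a j \<noteq> 0 \<Longrightarrow> V (a i) \<noteq> V (a j)"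
    and "sum a I = 0" "i \<in> I"
  shows "a i = 0"
proof -
  have "(\<forall>i\<in>I. a i = 0) \<or>
    (\<exists>i\<in>I. a i \<noteq> 0 \<and> sum a I \<noteq> 0 \<and> V (sum a I) = V (a i) \<and> (\<forall>j\<in>I. a j \<in> M (V (a i))))"
    by (rule sum_distinct_V) (use assms in auto)
  thus ?thesis using assms(3,4) by auto
qed

text \<open>Equality of leading terms: the quotient is a one-unit. This form is compatible with
  products and quotients; \<open>eqv_iff\<close> is the additive form.\<close>

definition eqv :: "'s \<Rightarrow> 's \<Rightarrow> bool" (infix \<open>\<approx>\<close> 50) where
  "x \<approx> y \<longleftrightarrow> x \<noteq> 0 \<and> y \<noteq> 0 \<and> x / y - 1 \<in> Ms 0"

lemma eqv_iff: "x \<approx> y \<longleftrightarrow> x \<noteq> 0 \<and> y \<noteq> 0 \<and> x - y \<in> Ms (V y)"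
proof -
  have "x / y - 1 \<in> Ms 0 \<longleftrightarrow> x - y \<in> Ms (V y)" if "y \<noteq> 0"
    using Ms_divide_iff[of y "x - y" 0] that by (simp add: diff_divide_distrib)
  thus ?thesis by (auto simp: eqv_def)
qed

lemma eqvI: "y \<noteq> 0 \<Longrightarrow> x - y \<in> Ms (V y) \<Longrightarrow> x \<approx> y"
  using V_add_dominant(1)[of y "x - y"] by (simp add: eqv_iff)

lemma eqv_V: "x \<approx> y \<Longrightarrow> V x = V y"
  using V_add_dominant(2)[of y "x - y"] by (simp add: eqv_iff)

lemma eqv_nz: "x \<approx> y \<Longrightarrow> x \<noteq> 0" "x \<approx> y \<Longrightarrow> y \<noteq> 0"
  by (simp_all add: eqv_iff)

lemma eqv_refl: "x \<noteq> 0 \<Longrightarrow> x \<approx> x"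
  by (simp add: eqv_iff)

lemma eqv_sym: "x \<approx> y \<Longrightarrow> y \<approx> x"
  using eqv_V[of x y] Ms_minus[of "x - y"] by (auto simp: eqv_iff)

lemma eqv_trans: "x \<approx> y \<Longrightarrow> y \<approx> z \<Longrightarrow> x \<approx> z"
  using eqv_V[of y z] Ms_add[of "x - y" "V z" "y - z"] by (auto simp: eqv_iff)

lemma eqv_mult: assumes "x \<approx> y" "x' \<approx> y'" shows "x * x' \<approx> y * y'"
proof -
  have nz: "x \<noteq> 0" "y \<noteq> 0" "x' \<noteq> 0" "y' \<noteq> 0" using assms by (auto simp: eqv_iff)
  have V: "V x = V y" "V x' = V y'" using assms by (auto intro: eqv_V)
  have "x * x' - y * y' = x * (x' - y') + y' * (x - y)" by (simp add: algebra_simps)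
  also have "\<dots> \<in> Ms (V y + V y')"
    using M_Ms_mult[OF M_self[of x], of "x' - y'" "V y'"] M_Ms_mult[OF M_self[of y'], of "x - y" "V y"] assms V
    by (intro Ms_add) (auto simp: eqv_iff add.commute)
  finally show ?thesis using nz by (simp add: eqv_iff V_mult)
qed

lemma eqv_inverse: assumes "x \<approx> y" shows "inverse x \<approx> inverse y"
proof -
  have nz: "x \<noteq> 0" "y \<noteq> 0" using assms by (auto simp: eqv_iff)
  have "inverse x / inverse y - 1 \<in> Ms 0"
    using eqv_sym[OF assms] nz by (simp add: eqv_def divide_inverse mult.commute)
  thus ?thesis using nz by (simp add: eqv_def)
qed

lemma eqv_divide: "x \<approx> y \<Longrightarrow> x' \<approx> y' \<Longrightarrow> x / x' \<approx> y / y'"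
  unfolding divide_inverse by (intro eqv_mult eqv_inverse)

lemma eqv_power: "x \<approx> y \<Longrightarrow> x ^ i \<approx> y ^ i"
  by (induction i) (auto intro: eqv_mult eqv_refl)

lemma eqv_add: "x \<approx> y \<Longrightarrow> z \<in> Ms (V y) \<Longrightarrow> x + z \<approx> y"
  using Ms_add[of "x - y" "V y" z] by (intro eqvI) (simp_all add: eqv_iff add.commute add_diff_eq)

text \<open>The divided difference of \<open>X^i\<close> at \<open>x\<close> and \<open>y\<close>,
  that is, the cofactor of \<open>y - x\<close> in \<open>y^i - x^i\<close>.\<close>

definition geo :: "'s \<Rightarrow> 's \<Rightarrow> nat \<Rightarrow> 's" where
  "geo y x i = (\<Sum>j<i. x ^ (i - Suc j) * y ^ j)"

lemma power_diff_geo: "y ^ i - x ^ i = (y - x) * geo y x i"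
  unfolding geo_def by (rule power_diff_sumr2)

text \<open>Each of the \<open>i\<close> summands has leading term \<open>x^(i-1)\<close>; these add
  up without cancellation because \<open>i\<close> is a unit. For \<open>y\<close> close to
  \<open>x\<close> the divided difference is thus the derivative to leading order.\<close>

lemma geo_eqv:
  assumes "y \<approx> x" "of_nat i \<noteq> (0 :: 's)" "V (of_nat i) = 0"
  shows "geo y x i \<approx> of_nat i * x ^ (i - 1)"
proof (rule eqvI)
  have x: "x \<noteq> 0" using assms eqv_nz by auto
  show "of_nat i * x ^ (i - 1) \<noteq> 0" using x assms by simp
  have "geo y x i - of_nat i * x ^ (i - 1) = (\<Sum>j<i. x ^ (i - Suc j) * y ^ j - x ^ (i - 1))"
    by (simp add: geo_def sum_subtractf)
  also have "\<dots> \<in> Ms (V (x ^ (i - 1)))"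
  proof (rule Ms_sum)
    fix j assume "j \<in> {..<i}"
    hence "i - 1 = (i - Suc j) + j" by auto
    hence "x ^ (i - 1) = x ^ (i - Suc j) * x ^ j" by (metis power_add)
    moreover have "x ^ (i - Suc j) * y ^ j \<approx> x ^ (i - Suc j) * x ^ j"
      using x assms by (intro eqv_mult eqv_power eqv_refl) auto
    ultimately show "x ^ (i - Suc j) * y ^ j - x ^ (i - 1) \<in> Ms (V (x ^ (i - 1)))"
      by (simp add: eqv_iff)
  qed
  finally show "geo y x i - of_nat i * x ^ (i - 1) \<in> Ms (V (of_nat i * x ^ (i - 1)))"
    using assms x by (simp add: V_mult)
qed

lemma geo_M:
  assumes "x \<in> M r" "y \<in> M r"
  shows "geo y x i \<in> M (real (i - 1) * r)"
  unfolding geo_def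
proof (rule M_sum)
  fix j assume j: "j \<in> {..<i}"
  have "x ^ (i - Suc j) * y ^ j \<in> M (real (i - Suc j) * r + real j * r)"
    by (intro M_mult M_power assms)
  moreover have "real (i - Suc j) * r + real j * r = real (i - 1) * r"
    using j by (simp flip: distrib_right of_nat_add)
  ultimately show "x ^ (i - Suc j) * y ^ j \<in> M (real (i - 1) * r)" by simp
qed

lemma power_diff_M:
  assumes "x \<in> M 0" "y \<in> M 0" "y - x \<in> M r"
  shows "y ^ i - x ^ i \<in> M r"
  using M_mult[OF assms(3) geo_M[OF assms(1,2), of i]] by (simp add: power_diff_geo)

lemma mult_diff_M:
  assumes "x - y \<in> M r" "x' - y' \<in> M r" "y \<in> M 0" "x' \<in> M 0"
  shows "x * x' - y * y' \<in> M r"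
proof -
  have "x' * (x - y) + y * (x' - y') \<in> M (0 + r)" using assms by (intro M_add M_mult)
  thus ?thesis by (simp add: algebra_simps)
qed

text \<open>The way in which approximation to every order becomes an exact equation.\<close>

lemma M_all_zero: "(\<And>i. x \<in> M (real i)) \<Longrightarrow> x = 0"
proof (rule ccontr)
  assume x: "\<And>i. x \<in> M (real i)" "x \<noteq> 0"
  obtain i :: nat where "V x < real i" using reals_Archimedean2 by blast
  thus False using x(1)[of i] x(2) by (simp add: M_def)
qed

lemma V_prod: "(\<And>i. i \<in> I \<Longrightarrow> g i \<noteq> 0) \<Longrightarrow> V (prod g I) = (\<Sum>i\<in>I. V (g i))"
  by (induction I rule: infinite_finite_induct) (auto simp: V_mult prod_zero_iff)

lemma M_telescope:
  assumes "\<And>i. f (Suc i) - f i \<in> M (real i)"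
  shows "f (i + q) - f i \<in> M (real i)"
proof (induction q)
  case (Suc q)
  have "f (Suc (i + q)) - f (i + q) \<in> M (real i)" using assms[of "i + q"] by (rule M_mono) simp
  from M_trans[OF this Suc.IH] show ?case by simp
qed auto

end

section \<open>Totally ramified extensions of degree \<open>p\<close>\<close>

text \<open>
  \<open>V\<close> is normalised on the extensions of degree \<open>p\<close>, so \<open>V\<close> maps \<open>K\<^sup>\<times>\<close> onto \<open>p\<int>\<close>; a prime element
  of such an extension is an \<open>x\<close> with \<open>V x = 1\<close>.
\<close>

locale equichar_local_field = nonarch V for V :: "'s::field \<Rightarrow> real" +
  fixes p :: nat and K k :: "'s set"
  assumes prime_p: "prime p" and CHAR_p: "CHAR('s) = p"
    and K_subfield: "subfield_set K" and k_subfield: "subfield_set k"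
    and V_image_K: "V ` (K - {0}) = range (\<lambda>i::int. real p * of_int i)"
    and complete_K: "(\<And>i. f i \<in> K) \<Longrightarrow> (\<And>i. f (Suc i) - f i \<in> M (real i)) \<Longrightarrow>
      \<exists>x\<in>K. \<forall>i. f i - x \<in> M (real i)"
    and k_K: "k \<subseteq> K" and V_k: "a \<in> k \<Longrightarrow> a \<noteq> 0 \<Longrightarrow> V a = 0"
    and residue_K: "x \<in> K \<Longrightarrow> x \<in> M 0 \<Longrightarrow> \<exists>a\<in>k. x - a \<in> Ms 0"
    and perfect_k: "a \<in> k \<Longrightarrow> \<exists>c\<in>k. c ^ p = a"
    and separable: "separable_over K (x :: 's)"
    and sep_closed: "separable_poly (g :: 's poly) \<Longrightarrow> Polynomial.degree g > 0 \<Longrightarrow> \<exists>x. poly g x = 0"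
begin

sublocale K: subfield_set K by (rule K_subfield)
sublocale k: subfield_set k by (rule k_subfield)

text \<open>Stated with the fixed \<open>V\<close> instead of the definite description
  \<open>normalized_val\<close>. The equivalence with \<open>totally_ramified_of_degree\<close> is
  \<open>tot_imp_totally_ramified\<close> and \<open>totally_ramified_imp_tot\<close>.\<close>

definition tot_ram :: "'s set \<Rightarrow> bool" where
  "tot_ram L \<longleftrightarrow> subfield_set L \<and> K \<subseteq> L \<and> ring.dimension Ks p K L \<and> V ` (L - {0}) = range of_int"

lemma p_ge_2: "p \<ge> 2" using prime_p by (rule prime_ge_2_nat)
lemma p_pos: "p > 0" using p_ge_2 by simp

lemma frob_add: "(x + y :: 's) ^ p = x ^ p + y ^ p"
  by (rule freshmans_dream) (use prime_p CHAR_p in auto)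

lemma frob_sum: "(sum g I :: 's) ^ p = (\<Sum>i\<in>I. g i ^ p)"
  by (rule freshmans_dream_sum) (use prime_p CHAR_p in auto)

lemma frob_minus: "(- x :: 's) ^ p = - (x ^ p)"
proof -
  have "(- x + x) ^ p = 0" using p_pos by simp
  hence "(- x) ^ p + x ^ p = 0" by (simp only: frob_add)
  thus ?thesis by (simp add: eq_neg_iff_add_eq_0)
qed

lemma frob_diff: "(x - y :: 's) ^ p = x ^ p - y ^ p"
  using frob_add[of x "- y"] by (simp add: frob_minus)

lemma V_K: "c \<in> K \<Longrightarrow> c \<noteq> 0 \<Longrightarrow> \<exists>i::int. V c = real p * of_int i"
  using V_image_K by (auto simp: image_def set_eq_iff)

lemma of_nat_k: "(of_nat i :: 's) \<in> k" by (rule k.of_nat_mem)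

lemma of_nat_nz: "0 < i \<Longrightarrow> i < p \<Longrightarrow> (of_nat i :: 's) \<noteq> 0"
  by (simp add: of_nat_eq_0_iff_char_dvd CHAR_p nat_dvd_not_less)

lemma V_of_nat: "0 < i \<Longrightarrow> i < p \<Longrightarrow> V (of_nat i) = 0"
  by (rule V_k) (auto simp: of_nat_k of_nat_nz)

lemma k_M0: "a \<in> k \<Longrightarrow> a \<in> M 0"
  by (cases "a = 0") (auto simp: M_def V_k)

lemma k_Ms0: "a \<in> k \<Longrightarrow> a \<in> Ms 0 \<Longrightarrow> a = 0"
  by (auto simp: Ms_def dest: V_k)

lemma V_term_neq:
  assumes "V x = 1" "x \<noteq> 0" "c \<in> K" "d \<in> K" "c \<noteq> 0" "d \<noteq> 0" "i < p" "j < p" "i \<noteq> j"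
  shows "V c + real i \<noteq> V d + real j"
proof
  assume eq: "V c + real i = V d + real j"
  obtain a b :: int where ab: "V c = real p * of_int a" "V d = real p * of_int b"
    using V_K assms by metis
  hence "real_of_int (int p * a + int i) = real_of_int (int p * b + int j)" using eq by simp
  hence eq': "int p * a + int i = int p * b + int j" by (simp only: of_int_eq_iff)
  have "int i = (int p * a + int i) mod int p" using assms by simp
  also have "\<dots> = int j" unfolding eq' using assms by simp
  finally show False using assms by simp
qed

lemma V_monom_neq:
  assumes "V x = 1" "x \<noteq> 0" "\<And>i. i < p \<Longrightarrow> c i \<in> K" "i < p" "j < p" "i \<noteq> j" "c i * x ^ i \<noteq> 0" "c j * x ^ j \<noteq> 0"
  shows "V (c i * x ^ i) \<noteq> V (c j * x ^ j)"
  using V_term_neq[of x "c i" "c j" i j] assms by (auto simp: V_mult V_power)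

lemma coeff_M:
  assumes "V x = 1" "x \<noteq> 0" "\<And>i. i < p \<Longrightarrow> c i \<in> K" "(\<Sum>i<p. c i * x ^ i) \<in> M r" "i < p"
  shows "c i * x ^ i \<in> M r"
  by (rule sum_distinct_V_M[of "{..<p}" "\<lambda>i. c i * x ^ i"]) (use assms V_monom_neq[of x c] in auto)

lemma lin_indep_powers:
  assumes "V x = 1" "x \<noteq> 0"
  shows "lin_indep K p (\<lambda>i. x ^ i)"
  unfolding lin_indep_def
proof (intro allI impI, elim conjE)
  fix c i assume "\<forall>i<p. c i \<in> K" "(\<Sum>i<p. c i * x ^ i) = 0" "i < p"
  hence "c i * x ^ i = 0"
    by (intro sum_distinct_V_zero[of "{..<p}" "\<lambda>i. c i * x ^ i"]) (use assms V_monom_neq[of x c] in auto)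
  thus "c i = 0" using assms by simp
qed

lemma span_pow_V_int:
  assumes "V x = 1" "x \<noteq> 0" "y \<in> span_pow K p (\<lambda>i. x ^ i)" "y \<noteq> 0"
  shows "\<exists>j::int. V y = of_int j"
proof -
  obtain c where c: "\<forall>i<p. c i \<in> K" "y = (\<Sum>i<p. c i * x ^ i)" using assms by (auto simp: span_pow_def)
  have "(\<forall>i\<in>{..<p}. c i * x ^ i = 0) \<or>
    (\<exists>i\<in>{..<p}. c i * x ^ i \<noteq> 0 \<and> y \<noteq> 0 \<and> V y = V (c i * x ^ i) \<and> (\<forall>j\<in>{..<p}. c j * x ^ j \<in> M (V (c i * x ^ i))))"
    unfolding c(2) by (rule sum_distinct_V) (use assms c V_monom_neq[of x c] in auto)
  moreover have "\<not> (\<forall>i\<in>{..<p}. c i * x ^ i = 0)"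
    using assms(4) sum.neutral[of "{..<p}" "\<lambda>i. c i * x ^ i"] unfolding c(2) by blast
  ultimately obtain i where i: "i < p" "c i * x ^ i \<noteq> 0" "V y = V (c i * x ^ i)"
    by blast
  obtain j :: int where "V (c i) = real p * of_int j" using V_K c i by auto
  hence "V y = of_int (int p * j + int i)" using i assms by (simp add: V_mult V_power)
  thus ?thesis by blast
qed

lemma tot_subfield: "tot_ram L \<Longrightarrow> subfield_set L" and tot_K: "tot_ram L \<Longrightarrow> K \<subseteq> L"
  by (simp_all add: tot_ram_def)

lemma tot_span:
  assumes "tot_ram L" "x \<in> L" "V x = 1" "x \<noteq> 0"
  shows "L = span_pow K p (\<lambda>i. x ^ i)"
proof -
  interpret L: subfield_set L using assms tot_subfield by auto
  show ?thesis
    by (rule dimension_eq_span_pow) (use assms K_subfield lin_indep_powers L.mems in \<open>auto simp: tot_ram_def\<close>)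
qed

lemma tot_V_int: "tot_ram L \<Longrightarrow> y \<in> L \<Longrightarrow> y \<noteq> 0 \<Longrightarrow> \<exists>j::int. V y = of_int j"
  by (auto simp: tot_ram_def image_def set_eq_iff)

text \<open>Integrality of \<open>V\<close> on \<open>L\<close>: removing the leading term of an
  error gains a full unit of value.\<close>

lemma tot_Ms_M: "tot_ram L \<Longrightarrow> y \<in> L \<Longrightarrow> y \<in> Ms (of_int r) \<Longrightarrow> y \<in> M (of_int r + 1)"
  using tot_V_int[of L y] by (cases "y = 0") (auto simp: M_def Ms_def)

lemma tot_prime_exists:
  assumes "tot_ram L" obtains x where "x \<in> L" "V x = 1" "x \<noteq> 0"
proof -
  have "1 \<in> V ` (L - {0})" using assms unfolding tot_ram_def by (auto intro: range_eqI[of _ _ 1])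
  then obtain x where "x \<in> L - {0}" "V x = 1" by (metis imageE)
  thus ?thesis using that[of x] by simp
qed

lemma K_pos_M: "c \<in> K \<Longrightarrow> c \<in> Ms 0 \<Longrightarrow> c \<in> M (real p)"
proof (cases "c = 0")
  case False
  assume "c \<in> K" "c \<in> Ms 0"
  moreover then obtain i :: int where "V c = real p * of_int i" using V_K False by auto
  ultimately have "i \<ge> 1" "V c = real p * of_int i" using p_pos False by (auto simp: Ms_def zero_less_mult_iff)
  hence "real p * 1 \<le> real p * real_of_int i" by (intro mult_left_mono) auto
  thus ?thesis using \<open>V c = _\<close> by (simp only: M_def) simp
qed auto

lemma K_M_pos: "c \<in> K \<Longrightarrow> c * x ^ i \<in> M r \<Longrightarrow> V x = 1 \<Longrightarrow> x \<noteq> 0 \<Longrightarrow> real i < r \<Longrightarrow> c \<in> M (real p)"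
  by (rule K_pos_M, assumption, cases "c = 0") (auto simp: M_def Ms_def V_mult V_power)

text \<open>In an expansion \<open>\<Sum> c_i x^i\<close> a nonzero term with \<open>i > 0\<close>
  has a value that is not a multiple of \<open>p\<close>, hence a positive one as soon as it is
  nonnegative. Only \<open>c_0\<close> contributes a residue, so \<open>L\<close> has the same
  residue field as \<open>K\<close>.\<close>

lemma tot_residue:
  assumes "tot_ram L" "y \<in> L" "y \<in> M 0"
  shows "\<exists>a\<in>k. y - a \<in> Ms 0"
proof -
  obtain x where x: "x \<in> L" "V x = 1" "x \<noteq> 0" using tot_prime_exists assms by blast
  obtain c where c: "\<forall>i<p. c i \<in> K" "y = (\<Sum>i<p. c i * x ^ i)"
    using tot_span[OF assms(1) x] assms(2) by (auto simp: span_pow_def)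
  have cM: "c i * x ^ i \<in> M 0" if "i < p" for i
    by (rule coeff_M[of x c]) (use c x that assms in auto)
  have c0: "c 0 \<in> K" "c 0 \<in> M 0" using cM[of 0] c p_pos by auto
  obtain a where a: "a \<in> k" "c 0 - a \<in> Ms 0" using residue_K c0 by blast
  have "y = c 0 + (\<Sum>i\<in>{1..<p}. c i * x ^ i)"
    using c(2) p_pos by (simp add: lessThan_atLeast0 sum.atLeast_Suc_lessThan)
  hence "y - a = (c 0 - a) + (\<Sum>i\<in>{1..<p}. c i * x ^ i)" by simp
  also have "\<dots> \<in> Ms 0"
  proof (intro Ms_add a Ms_sum)
    fix i assume i: "i \<in> {1..<p}"
    show "c i * x ^ i \<in> Ms 0"
    proof (cases "c i = 0")
      case False
      then obtain j :: int where j: "V (c i) = real p * of_int j" using V_K c i by auto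
      have V: "V (c i * x ^ i) = of_int (int p * j + int i)" using x False j by (simp add: V_mult V_power)
      have "V (c i * x ^ i) \<noteq> 0"
      proof
        assume "V (c i * x ^ i) = 0"
        hence "int p * j + int i = 0" using V by linarith
        hence "int p dvd int i" by (metis dvd_add_right_iff dvd_triv_left dvd_0_right)
        thus False using i by (auto simp: nat_dvd_not_less)
      qed
      thus ?thesis using cM[of i] i by (auto simp: M_def Ms_def)
    qed auto
  qed
  finally show ?thesis using a(1) by blast
qed

lemma tot_lead:
  assumes "tot_ram L" "y \<in> L" "y \<noteq> 0" "x \<in> L" "V x = 1" "x \<noteq> 0" "V y = of_int N"
  shows "\<exists>a\<in>k. a \<noteq> 0 \<and> y \<approx> a * x powi N"
proof -
  interpret L: subfield_set L using assms tot_subfield by auto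
  have V: "V (x powi N) = of_int N" using assms by (simp add: V_power_int)
  hence "y / x powi N \<in> M 0" using assms by (simp add: M_def V_divide)
  then obtain a where a: "a \<in> k" "y / x powi N - a \<in> Ms 0"
    using tot_residue[OF assms(1), of "y / x powi N"] L.mems assms by auto
  have "a \<noteq> 0"
  proof
    assume "a = 0"
    hence "y / x powi N \<in> Ms 0" using a by simp
    thus False using assms V by (simp add: Ms_def V_divide)
  qed
  hence "y / x powi N \<approx> a" using a V_k[of a] by (intro eqvI) auto
  hence "y / x powi N * x powi N \<approx> a * x powi N" using assms by (intro eqv_mult eqv_refl) auto
  thus ?thesis using a \<open>a \<noteq> 0\<close> assms by auto
qed

lemma tot_lead_nat:
  assumes "tot_ram L" "y \<in> L" "y \<in> M (real N)" "x \<in> L" "V x = 1" "x \<noteq> 0"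
  shows "\<exists>a\<in>k. y - a * x ^ N \<in> M (real N + 1)"
proof (cases "y \<in> Ms (real N)")
  case True
  thus ?thesis using tot_Ms_M[OF assms(1,2), of "int N"] by (intro bexI[of _ 0]) auto
next
  case False
  interpret L: subfield_set L using assms tot_subfield by auto
  have "y \<noteq> 0" "V y = of_int (int N)" using False assms by (auto simp: M_def Ms_def)
  from tot_lead[OF assms(1,2) this(1) assms(4-6) this(2)] obtain a where a: "a \<in> k" "a \<noteq> 0" "y \<approx> a * x ^ N"
    by auto
  hence "y - a * x ^ N \<in> Ms (real N)" using assms by (simp add: eqv_iff V_mult V_power V_k)
  hence "y - a * x ^ N \<in> M (real N + 1)" using tot_Ms_M[OF assms(1), of "y - a * x ^ N" "int N"] a assms
    tot_K k_K L.mems by (auto simp: subset_iff)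
  thus ?thesis using a by blast
qed

text \<open>The coefficients stand on the right of \<open>X^p = \<Sum> a_i X^i\<close>. As
  \<open>V\<close> is \<open>p\<close> times the valuation of \<open>K\<close>,
  \<open>M (real p)\<close> cuts out the maximal ideal of the valuation ring of
  \<open>K\<close>.\<close>

definition eisenstein :: "(nat \<Rightarrow> 's) \<Rightarrow> bool" where
  "eisenstein a \<longleftrightarrow> (\<forall>i<p. a i \<in> K \<and> a i \<in> M (real p)) \<and> a 0 \<noteq> 0 \<and> V (a 0) = real p"

text \<open>All \<open>a_i x^i\<close> have value at least that of \<open>x^p\<close>, namely
  \<open>p\<close>; since \<open>i < p\<close> this forces \<open>a_i\<close> into the maximal
  ideal. The terms with \<open>i > 0\<close> then exceed \<open>p\<close>, so \<open>a_0\<close>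
  must carry the value \<open>p\<close>.\<close>

lemma tot_min_poly:
  assumes "tot_ram L" "x \<in> L" "V x = 1" "x \<noteq> 0"
  obtains a where "eisenstein a" "x ^ p = (\<Sum>i<p. a i * x ^ i)"
proof -
  interpret L: subfield_set L using assms tot_subfield by auto
  have "x ^ p \<in> span_pow K p (\<lambda>i. x ^ i)" using tot_span[OF assms] L.mems assms by auto
  then obtain a where a: "\<forall>i<p. a i \<in> K" "x ^ p = (\<Sum>i<p. a i * x ^ i)" by (auto simp: span_pow_def)
  have V: "V (x ^ p) = real p" using assms by (simp add: V_power)
  have aM: "a i * x ^ i \<in> M (real p)" if "i < p" for i
    by (rule coeff_M[of x a]) (use a assms V M_self[of "x ^ p"] that in auto)
  have aM': "a i \<in> M (real p)" if "i < p" for i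
    by (rule K_M_pos[of _ x i "real p"]) (use a that assms aM[of i] in auto)
  have s: "x ^ p = a 0 + (\<Sum>i\<in>{1..<p}. a i * x ^ i)"
    using a(2) p_pos by (simp add: lessThan_atLeast0 sum.atLeast_Suc_lessThan)
  have "(\<Sum>i\<in>{1..<p}. a i * x ^ i) \<in> M (real p + 1)"
  proof (rule M_sum)
    fix i assume i: "i \<in> {1..<p}"
    have "a i * x ^ i \<in> M (real p + real i * 1)"
      using i assms by (intro M_mult aM' M_power) (auto simp: M_def)
    thus "a i * x ^ i \<in> M (real p + 1)" by (rule M_mono) (use i in auto)
  qed
  hence "- (\<Sum>i\<in>{1..<p}. a i * x ^ i) \<in> Ms (V (x ^ p))"
    unfolding V by (intro Ms_minus M_Ms[where r = "real p + 1"]) auto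
  from V_add_dominant[OF _ this] have "x ^ p + - (\<Sum>i\<in>{1..<p}. a i * x ^ i) \<noteq> 0"
    "V (x ^ p + - (\<Sum>i\<in>{1..<p}. a i * x ^ i)) = real p" using assms V by auto
  moreover have "x ^ p + - (\<Sum>i\<in>{1..<p}. a i * x ^ i) = a 0" using s by simp
  ultimately have "a 0 \<noteq> 0" "V (a 0) = real p" by auto
  hence "eisenstein a" using a(1) aM' by (simp add: eisenstein_def)
  thus ?thesis using that a(2) by blast
qed

text \<open>If \<open>V x\<close> were at most 0, every \<open>a_i x^i\<close> would have larger
  value than \<open>x^p\<close>. Once \<open>V x > 0\<close>, the terms with \<open>i > 0\<close>
  exceed \<open>V (a_0) = p\<close>, so \<open>V (x^p) = p\<close>. Every root, wherever it lies, is
  therefore a prime element.\<close>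

lemma eisenstein_root:
  assumes "eisenstein a" "x ^ p = (\<Sum>i<p. a i * x ^ i)"
  shows "x \<noteq> 0" "V x = 1"
proof -
  note a = assms(1)[unfolded eisenstein_def]
  have s: "x ^ p = a 0 + (\<Sum>i\<in>{1..<p}. a i * x ^ i)"
    using assms(2) p_pos by (simp add: lessThan_atLeast0 sum.atLeast_Suc_lessThan)
  show nz: "x \<noteq> 0"
  proof
    assume "x = 0"
    hence "(\<Sum>i\<in>{1..<p}. a i * x ^ i) = 0" by (intro sum.neutral) auto
    thus False using s a \<open>x = 0\<close> p_pos by (simp add: power_0_left)
  qed
  have pos: "V x > 0"
  proof (rule ccontr)
    assume neg: "\<not> V x > 0"
    have "x ^ p \<in> Ms (real p * V x)"
      unfolding assms(2)
    proof (rule Ms_sum)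
      fix i assume i: "i \<in> {..<p}"
      have "a i * x ^ i \<in> M (real p + real i * V x)"
        using i a by (intro M_mult M_power M_self) auto
      moreover have "real p * V x \<le> real i * V x" using neg i by (intro mult_right_mono_neg) auto
      ultimately show "a i * x ^ i \<in> Ms (real p * V x)" by (elim M_Ms) (use p_pos in auto)
    qed
    thus False using nz by (simp add: Ms_def V_power)
  qed
  have "(\<Sum>i\<in>{1..<p}. a i * x ^ i) \<in> Ms (real p)"
  proof (rule Ms_sum)
    fix i assume i: "i \<in> {1..<p}"
    have "a i * x ^ i \<in> M (real p + real i * V x)"
      using i a by (intro M_mult M_power M_self) auto
    thus "a i * x ^ i \<in> Ms (real p)" by (rule M_Ms) (use i pos in auto)
  qed
  hence "V (x ^ p) = real p" unfolding s using V_add_dominant(2)[of "a 0"] a by auto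
  thus "V x = 1" using nz p_pos by (simp add: V_power)
qed

lemma span_pow_mult_x:
  assumes "x ^ p = (\<Sum>i<p. a i * x ^ i)" "\<And>i. i < p \<Longrightarrow> a i \<in> K" "y \<in> span_pow K p (\<lambda>i. x ^ i)"
  shows "x * y \<in> span_pow K p (\<lambda>i. x ^ i)"
proof -
  obtain c where c: "\<forall>i<p. c i \<in> K" "y = (\<Sum>i<p. c i * x ^ i)" using assms by (auto simp: span_pow_def)
  obtain q where q: "p = Suc q" using p_pos by (cases p) auto
  have "x * y = (\<Sum>i<p. c i * x ^ Suc i)" using c(2) by (simp add: sum_distrib_left algebra_simps)
  also have "\<dots> = (\<Sum>i<q. c i * x ^ Suc i) + c q * x ^ p" using q by simp
  also have "(\<Sum>i<q. c i * x ^ Suc i) = (\<Sum>i<p. (if i = 0 then 0 else c (i - 1)) * x ^ i)"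
    unfolding q by (simp add: sum.lessThan_Suc_shift del: sum.lessThan_Suc)
  also have "\<dots> + c q * x ^ p = (\<Sum>i<p. ((if i = 0 then 0 else c (i - 1)) + c q * a i) * x ^ i)"
    unfolding assms(1) by (simp add: sum_distrib_left algebra_simps sum.distrib)
  also have "\<dots> \<in> span_pow K p (\<lambda>i. x ^ i)"
    unfolding span_pow_def using c assms(2) q
    by (intro CollectI exI[of _ "\<lambda>i. (if i = 0 then 0 else c (i - 1)) + c q * a i"]) (auto intro!: K.mems)
  finally show ?thesis .
qed

lemma span_pow_add:
  "y \<in> span_pow K N b \<Longrightarrow> z \<in> span_pow K N b \<Longrightarrow> y + z \<in> span_pow K N b"
  unfolding span_pow_def
proof (elim CollectE exE conjE, intro CollectI)
  fix c d assume "y = (\<Sum>i<N. c i * b i)" "\<forall>i<N. c i \<in> K" "z = (\<Sum>i<N. d i * b i)" "\<forall>i<N. d i \<in> K"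
  thus "\<exists>c. y + z = (\<Sum>i<N. c i * b i) \<and> (\<forall>i<N. c i \<in> K)"
    by (intro exI[of _ "\<lambda>i. c i + d i"]) (auto simp: algebra_simps sum.distrib intro: K.mems)
qed

lemma span_pow_smult:
  "e \<in> K \<Longrightarrow> z \<in> span_pow K N b \<Longrightarrow> e * z \<in> span_pow K N b"
  unfolding span_pow_def
proof (elim CollectE exE conjE, intro CollectI)
  fix d assume "e \<in> K" "z = (\<Sum>i<N. d i * b i)" "\<forall>i<N. d i \<in> K"
  thus "\<exists>c. e * z = (\<Sum>i<N. c i * b i) \<and> (\<forall>i<N. c i \<in> K)"
    by (intro exI[of _ "\<lambda>i. e * d i"]) (auto simp: algebra_simps sum_distrib_left intro: K.mems)
qed

lemma span_pow_sum:
  "(\<And>i. i \<in> I \<Longrightarrow> g i \<in> span_pow K N b) \<Longrightarrow> sum g I \<in> span_pow K N b"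
proof -
  have "0 \<in> span_pow K N b" by (auto simp: span_pow_def intro!: exI[of _ "\<lambda>_. 0"])
  thus "(\<And>i. i \<in> I \<Longrightarrow> g i \<in> span_pow K N b) \<Longrightarrow> sum g I \<in> span_pow K N b"
    by (induction I rule: infinite_finite_induct) (auto intro: span_pow_add)
qed

lemma span_pow_mem: assumes "i < N" shows "b i \<in> span_pow K N b"
proof -
  have "b i = (\<Sum>j<N. (if j = i then 1 else 0) * b j)"
    using assms by (simp add: if_distrib[of "\<lambda>x. x * _"] cong: if_cong)
  thus ?thesis unfolding span_pow_def by (intro CollectI exI[of _ "\<lambda>j. if j = i then 1 else 0"]) auto
qed

text \<open>The span of \<open>1, ..., x^(p-1)\<close> is shown to be a field, hence it is the
  generated field; \<open>span_pow_V_int\<close> then gives its value group.\<close>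

lemma tot_adjoin:
  assumes a: "eisenstein a" and xp: "x ^ p = (\<Sum>i<p. a i * x ^ i)"
  shows "tot_ram (field_adjoin K x)"
proof -
  define S where "S = span_pow K p (\<lambda>i. x ^ i)"
  have x: "x \<noteq> 0" "V x = 1" using eisenstein_root[OF assms] by auto
  have aK: "\<And>i. i < p \<Longrightarrow> a i \<in> K" using a by (simp add: eisenstein_def)
  have dim: "ring.dimension Ks p K S"
    unfolding S_def by (rule dimension_span_pow) (use x lin_indep_powers K_subfield in auto)
  have xS: "x ^ i * y \<in> S" if "y \<in> S" for i y
    by (induction i) (use that span_pow_mult_x[OF xp aK] in \<open>auto simp: S_def mult.assoc\<close>)
  have S1: "1 \<in> S" using span_pow_mem[of 0 p "\<lambda>i. x ^ i"] p_pos by (simp add: S_def)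
  have Sm: "c * y \<in> S" if "c \<in> K" "y \<in> S" for c y using span_pow_smult that by (simp add: S_def)
  have mult: "z * y \<in> S" if zy: "z \<in> S" "y \<in> S" for y z
  proof -
    obtain c where c: "\<forall>i<p. c i \<in> K" "z = (\<Sum>i<p. c i * x ^ i)" using zy by (auto simp: span_pow_def S_def)
    have "z * y = (\<Sum>i<p. c i * (x ^ i * y))" using c by (simp add: sum_distrib_right mult.assoc)
    also have "\<dots> \<in> S" unfolding S_def
      by (rule span_pow_sum) (use Sm xS zy c in \<open>auto simp: S_def\<close>)
    finally show ?thesis .
  qed
  have inv: "inverse y \<in> S" if y: "y \<in> S" for y
  proof (cases "y = 0")
    case False
    \<comment> \<open>Multiplication by a nonzero \<open>y\<close> is injective on a space of
      dimension \<open>p\<close>, hence onto: 1 is a multiple of \<open>y\<close> within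
      \<open>S\<close>.\<close>
    have "lin_indep K p (\<lambda>i. y * x ^ i)"
    unfolding lin_indep_def
    proof (intro allI impI, elim conjE)
      fix c i assume c: "\<forall>i<p. c i \<in> K" "(\<Sum>i<p. c i * (y * x ^ i)) = 0" "i < p"
      have "(\<Sum>i<p. c i * (y * x ^ i)) = y * (\<Sum>i<p. c i * x ^ i)"
        by (simp add: sum_distrib_left algebra_simps)
      thus "c i = 0" using lin_indep_powers[OF x(2,1)] c False unfolding lin_indep_def by auto
    qed
    hence "S = span_pow K p (\<lambda>i. y * x ^ i)"
      by (intro dimension_eq_span_pow K_subfield dim)
         (use y mult span_pow_mem[of _ p "\<lambda>i. x ^ i"] in \<open>auto simp: S_def\<close>)
    then obtain d where d: "\<forall>i<p. d i \<in> K" "1 = (\<Sum>i<p. d i * (y * x ^ i))"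
      using S1 by (auto simp: span_pow_def)
    hence "1 = y * (\<Sum>i<p. d i * x ^ i)" by (simp add: sum_distrib_left algebra_simps)
    hence "inverse y = (\<Sum>i<p. d i * x ^ i)" using inverse_unique by metis
    thus ?thesis using d unfolding S_def span_pow_def by blast
  qed (use span_pow_sum[of "{}"] in \<open>auto simp: S_def\<close>)
  interpret S: subfield_set S
    by unfold_locales (use S1 mult inv span_pow_add Sm[OF K.uminus_mem[OF K.one_mem]] in \<open>auto simp: S_def\<close>)
  have KS: "K \<subseteq> S" using Sm[OF _ S1] by auto
  have xS': "x \<in> S" using xS[OF S1, of 1] by simp
  have "field_adjoin K x = S"
  proof
    show "field_adjoin K x \<subseteq> S" by (rule field_adjoin_least) (use KS xS' S.subfield_set_axioms in auto)
    interpret A: subfield_set "field_adjoin K x" by (rule subfield_field_adjoin)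
    show "S \<subseteq> field_adjoin K x"
      by (auto simp: S_def span_pow_def field_adjoin_incl intro!: A.sum_mem A.mult_mem A.power_mem)
  qed
  moreover have "V ` (S - {0}) = range of_int"
  proof (intro equalityI subsetI)
    fix r assume "r \<in> V ` (S - {0})"
    thus "r \<in> range of_int" using span_pow_V_int[OF x(2,1)] by (auto simp: S_def)
  next
    fix r :: real assume "r \<in> range of_int"
    then obtain j :: int where "r = of_int j" by auto
    hence "r = V (x powi j)" using x by (simp add: V_power_int)
    moreover have "x powi j \<in> S" using xS' by (rule S.power_int_mem)
    ultimately show "r \<in> V ` (S - {0})" using x by auto
  qed
  ultimately show ?thesis
    unfolding tot_ram_def using KS dim S.subfield_set_axioms by simp
qed

lemma tot_adjoin_eq: "tot_ram L \<Longrightarrow> x \<in> L \<Longrightarrow> V x = 1 \<Longrightarrow> x \<noteq> 0 \<Longrightarrow> field_adjoin K x = L"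
proof
  assume L: "tot_ram L" and x: "x \<in> L" "V x = 1" "x \<noteq> 0"
  show "field_adjoin K x \<subseteq> L" by (rule field_adjoin_least) (use L x tot_K tot_subfield in auto)
  interpret A: subfield_set "field_adjoin K x" by (rule subfield_field_adjoin)
  show "L \<subseteq> field_adjoin K x"
    unfolding tot_span[OF L x]
    by (auto simp: span_pow_def field_adjoin_incl intro!: A.sum_mem A.mult_mem A.power_mem)
qed

end

section \<open>Conjugates and extension of homomorphisms\<close>

lemma separable_poly_factor:
  assumes "separable_poly (f * g :: 's::field poly)"
  shows "separable_poly g"
  unfolding separable_poly_def
proof (rule coprimeI)
  fix d assume "d dvd g" "d dvd pderiv g"
  hence "d dvd f * g" "d dvd pderiv (f * g)" by (auto simp: pderiv_mult)
  thus "is_unit d" using assms coprime_common_divisor unfolding separable_poly_def by blast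
qed

lemma separable_poly_simple_root:
  assumes "separable_poly ([:- y, 1:] * g :: 's::field poly)"
  shows "poly g y \<noteq> 0"
proof
  assume "poly g y = 0"
  hence d: "[:- y, 1:] dvd g" by (simp add: poly_eq_0_iff_dvd)
  have "[:- y, 1:] dvd pderiv ([:- y, 1:] * g)" unfolding pderiv_mult by (rule dvd_add[OF dvd_triv_left dvd_mult2[OF d]])
  hence "is_unit [:- y, 1:]"
    by (intro coprime_common_divisor[OF assms[unfolded separable_poly_def] dvd_triv_left])
  thus False by (simp add: is_unit_iff_degree)
qed

definition hom_on :: "'s::field set \<Rightarrow> ('s \<Rightarrow> 's) \<Rightarrow> bool" where
  "hom_on L \<sigma> \<longleftrightarrow> \<sigma> 1 = 1 \<and> (\<forall>x\<in>L. \<forall>y\<in>L. \<sigma> (x + y) = \<sigma> x + \<sigma> y \<and> \<sigma> (x * y) = \<sigma> x * \<sigma> y)"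

context subfield_set
begin

context
  fixes \<sigma> assumes hom: "hom_on F \<sigma>"
begin

lemma hom_one: "\<sigma> 1 = 1" using hom by (simp add: hom_on_def)
lemma hom_add: "x \<in> F \<Longrightarrow> y \<in> F \<Longrightarrow> \<sigma> (x + y) = \<sigma> x + \<sigma> y" using hom by (simp add: hom_on_def)
lemma hom_mult: "x \<in> F \<Longrightarrow> y \<in> F \<Longrightarrow> \<sigma> (x * y) = \<sigma> x * \<sigma> y" using hom by (simp add: hom_on_def)
lemma hom_zero: "\<sigma> 0 = 0"
proof -
  have "\<sigma> (0 + 0) = \<sigma> 0 + \<sigma> 0" by (intro hom_add zero_mem)
  thus ?thesis by (simp only: add_0_right add_cancel_right_right)
qed

lemma hom_uminus: "x \<in> F \<Longrightarrow> \<sigma> (- x) = - \<sigma> x"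
  using hom_add[of x "- x"] minus_unique[of "\<sigma> x" "\<sigma> (- x)"] by (simp add: uminus_mem hom_zero)

lemma hom_diff: "x \<in> F \<Longrightarrow> y \<in> F \<Longrightarrow> \<sigma> (x - y) = \<sigma> x - \<sigma> y"
  using hom_add[of x "- y"] by (simp add: uminus_mem hom_uminus)

lemma hom_power: "x \<in> F \<Longrightarrow> \<sigma> (x ^ i) = \<sigma> x ^ i"
  by (induction i) (auto simp: hom_one hom_mult power_mem)

lemma hom_sum: "(\<And>i. i \<in> I \<Longrightarrow> g i \<in> F) \<Longrightarrow> \<sigma> (sum g I) = (\<Sum>i\<in>I. \<sigma> (g i))"
  by (induction I rule: infinite_finite_induct) (auto simp: hom_zero hom_add sum_mem)

lemma hom_lincomb:
  assumes "\<And>i. i < n \<Longrightarrow> c i \<in> F" "x \<in> F"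
  shows "\<sigma> (\<Sum>i<n. c i * x ^ i) = (\<Sum>i<n. \<sigma> (c i) * \<sigma> x ^ i)"
proof -
  have "\<sigma> (\<Sum>i<n. c i * x ^ i) = (\<Sum>i<n. \<sigma> (c i * x ^ i))"
    by (rule hom_sum) (use assms in \<open>auto intro: mult_mem power_mem\<close>)
  also have "\<dots> = (\<Sum>i<n. \<sigma> (c i) * \<sigma> x ^ i)"
    by (rule sum.cong) (use assms in \<open>auto simp: hom_mult hom_power power_mem\<close>)
  finally show ?thesis .
qed

lemma hom_nz: "x \<in> F \<Longrightarrow> x \<noteq> 0 \<Longrightarrow> \<sigma> x \<noteq> 0"
  using hom_mult[of x "inverse x"] by (auto simp: inverse_mem hom_one)

lemma hom_inverse: "x \<in> F \<Longrightarrow> \<sigma> (inverse x) = inverse (\<sigma> x)"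
proof (cases "x = 0")
  case False
  assume "x \<in> F"
  hence "\<sigma> x * \<sigma> (inverse x) = 1" using hom_mult[of x "inverse x"] False by (simp add: inverse_mem hom_one)
  thus ?thesis by (rule inverse_unique[symmetric])
qed (simp add: hom_zero)

lemma hom_inj: "inj_on \<sigma> F"
proof (rule inj_onI)
  fix x y assume "x \<in> F" "y \<in> F" "\<sigma> x = \<sigma> y"
  thus "x = y" using hom_nz[of "x - y"] by (auto simp: hom_diff diff_mem)
qed

end

definition polyF :: "'s poly \<Rightarrow> bool" where
  "polyF f \<longleftrightarrow> (\<forall>i. coeff f i \<in> F)"

lemma polyF_simps [simp]: "polyF 0" "polyF 1"
  by (auto simp: polyF_def one_pCons coeff_pCons split: nat.splits)

lemma polyF_add: "polyF f \<Longrightarrow> polyF g \<Longrightarrow> polyF (f + g)"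
  by (simp add: polyF_def add_mem)

lemma polyF_diff: "polyF f \<Longrightarrow> polyF g \<Longrightarrow> polyF (f - g)"
  by (simp add: polyF_def diff_mem)

lemma polyF_mult: "polyF f \<Longrightarrow> polyF g \<Longrightarrow> polyF (f * g)"
  by (simp add: polyF_def coeff_mult sum_mem mult_mem)

lemma polyF_monom: "c \<in> F \<Longrightarrow> polyF (Polynomial.monom c i)"
  by (simp add: polyF_def)

lemma polyF_sum: "(\<And>i. i \<in> I \<Longrightarrow> polyF (g i)) \<Longrightarrow> polyF (sum g I)"
  by (induction I rule: infinite_finite_induct) (auto intro: polyF_add)

lemma polyF_poly_mem: "polyF f \<Longrightarrow> x \<in> F \<Longrightarrow> poly f x \<in> F"
  by (simp add: poly_altdef polyF_def sum_mem mult_mem power_mem)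

text \<open>Long division by a monic polynomial divides no coefficients, so quotient and remainder
  stay over \<open>F\<close>.\<close>

lemma polyF_division:
  assumes "polyF f" "lead_coeff f = 1"
  shows "polyF g \<Longrightarrow> \<exists>q r. polyF q \<and> polyF r \<and> g = q * f + r \<and> (r = 0 \<or> Polynomial.degree r < Polynomial.degree f)"
proof (induction "Polynomial.degree g" arbitrary: g rule: less_induct)
  case less
  consider "g = 0 \<or> Polynomial.degree g < Polynomial.degree f" | "Polynomial.degree f = 0"
    | "0 < Polynomial.degree f" "Polynomial.degree f \<le> Polynomial.degree g" "g \<noteq> 0" by linarith
  thus ?case
  proof cases
    case 1
    thus ?thesis using less.prems by (intro exI[of _ 0] exI[of _ g]) auto
  next
    case 2
    then obtain c where "f = [:c:]" by (rule degree_eq_zeroE)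
    hence "f = 1" using assms(2) by (simp add: one_pCons)
    thus ?thesis using less.prems by (intro exI[of _ g] exI[of _ 0]) auto
  next
    case 3
    define n where "n = Polynomial.degree g"
    define s where "s = Polynomial.monom (lead_coeff g) (n - Polynomial.degree f)"
    have s: "polyF s" using less.prems by (auto simp: s_def polyF_def)
    have f0: "f \<noteq> 0" using 3 by auto
    have lg: "lead_coeff g \<noteq> 0" using 3 by simp
    have degs: "Polynomial.degree s = n - Polynomial.degree f" using lg by (simp add: s_def degree_monom_eq)
    have dsf: "Polynomial.degree (s * f) \<le> n"
      using degree_mult_le[of s f] 3 degs by (simp add: n_def)
    have "coeff (s * f) (Polynomial.degree s + Polynomial.degree f) = lead_coeff s * lead_coeff f"
      by (rule coeff_mult_degree_sum)
    hence csf: "coeff (s * f) n = coeff g n" using 3 degs assms(2) by (simp add: n_def s_def degree_monom_eq lg)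
    have "g - s * f = 0 \<or> Polynomial.degree (g - s * f) < n"
      by (rule eq_zero_or_degree_less) (use dsf csf in \<open>auto intro: degree_diff_le simp: n_def\<close>)
    moreover have "n > 0" using 3 by (simp add: n_def)
    ultimately have "Polynomial.degree (g - s * f) < Polynomial.degree g" by (auto simp: n_def)
    from less.hyps[OF this] obtain q r where qr: "polyF q" "polyF r" "g - s * f = q * f + r"
      "r = 0 \<or> Polynomial.degree r < Polynomial.degree f"
      using s assms less.prems by (auto intro: polyF_diff polyF_mult)
    have "g = (q + s) * f + r" using qr(3) by (simp add: algebra_simps)
    thus ?thesis using qr s polyF_add by blast
  qed
qed

lemma map_poly_mult_hom:
  assumes "hom_on F \<sigma>" "polyF f" "polyF g"
  shows "map_poly \<sigma> (f * g) = map_poly \<sigma> f * map_poly \<sigma> g"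
  using assms
  by (intro poly_eqI)
     (simp add: coeff_map_poly hom_zero[OF assms(1)] coeff_mult hom_sum[OF assms(1)] hom_mult[OF assms(1)] polyF_def mult_mem)

lemma map_poly_add_hom:
  assumes "hom_on F \<sigma>" "polyF f" "polyF g"
  shows "map_poly \<sigma> (f + g) = map_poly \<sigma> f + map_poly \<sigma> g"
  using assms by (intro poly_eqI) (simp add: coeff_map_poly hom_zero[OF assms(1)] hom_add[OF assms(1)] polyF_def)

lemma map_poly_diff_hom:
  assumes "hom_on F \<sigma>" "polyF f" "polyF g"
  shows "map_poly \<sigma> (f - g) = map_poly \<sigma> f - map_poly \<sigma> g"
  using assms by (intro poly_eqI) (simp add: coeff_map_poly hom_zero[OF assms(1)] hom_diff[OF assms(1)] polyF_def)

end

section \<open>Eisenstein polynomials as minimal polynomials\<close>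

context equichar_local_field
begin

definition minp :: "(nat \<Rightarrow> 's) \<Rightarrow> 's poly" where
  "minp a = Polynomial.monom 1 p - (\<Sum>i<p. Polynomial.monom (a i) i)"

lemma poly_minp: "poly (minp a) x = x ^ p - (\<Sum>i<p. a i * x ^ i)"
  by (simp add: minp_def poly_monom poly_sum)

lemma coeff_minp: "coeff (minp a) i = (if i = p then 1 else if i < p then - a i else 0)"
  by (auto simp: minp_def coeff_sum if_distrib[of "\<lambda>x. x = _"] cong: if_cong)

lemma degree_minp: "Polynomial.degree (minp a) = p"
  by (rule antisym, rule degree_le) (auto simp: coeff_minp intro: le_degree)

lemma minp_nz: "minp a \<noteq> 0"
  using degree_minp[of a] p_pos by auto

lemma polyK_minp: "eisenstein a \<Longrightarrow> K.polyF (minp a)"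
  by (auto simp: K.polyF_def coeff_minp eisenstein_def intro: K.uminus_mem)

lemma poly_lt_p:
  fixes r :: "'s poly"
  assumes "r = 0 \<or> Polynomial.degree r < p"
  shows "poly r x = (\<Sum>i<p. coeff r i * x ^ i)"
proof (cases "r = 0")
  case False
  hence "Polynomial.degree r < p" using assms by auto
  hence "(\<Sum>i\<le>Polynomial.degree r. coeff r i * x ^ i) = (\<Sum>i<p. coeff r i * x ^ i)"
    by (intro sum.mono_neutral_left) (auto simp: coeff_eq_0)
  thus ?thesis by (simp add: poly_altdef)
qed auto

text \<open>The remainder of \<open>g\<close> has degree below \<open>p\<close> and vanishes at
  \<open>x\<close>, whose powers are independent. So \<open>minp a\<close> is the minimal polynomial
  of each of its roots.\<close>

lemma minp_dvd:
  assumes "eisenstein a" "poly (minp a) x = 0" "K.polyF g" "poly g x = 0"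
  obtains q where "K.polyF q" "g = q * minp a"
proof -
  have x: "x \<noteq> 0" "V x = 1" using eisenstein_root[OF assms(1), of x] assms(2) by (auto simp: poly_minp)
  have "lead_coeff (minp a) = 1" by (simp add: degree_minp coeff_minp)
  from K.polyF_division[OF polyK_minp[OF assms(1)] this assms(3)] obtain q r where
    qr: "K.polyF q" "K.polyF r" "g = q * minp a + r" "r = 0 \<or> Polynomial.degree r < p"
    by (auto simp: degree_minp)
  have "poly r x = 0" using qr(3) assms by simp
  hence "\<forall>i<p. coeff r i = 0"
    using lin_indep_powers[OF x(2,1)] qr(2) poly_lt_p[OF qr(4), of x]
    unfolding lin_indep_def K.polyF_def by metis
  hence "r = 0" using qr(4) by (metis leading_coeff_0_iff)
  thus ?thesis using that qr by simp
qed

text \<open>\<open>x\<close> is a root of some separable polynomial over \<open>K\<close>, which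
  \<open>minp a\<close> divides.\<close>

lemma separable_minp:
  assumes "eisenstein a" "poly (minp a) x = 0"
  shows "separable_poly (minp a)"
proof -
  obtain g where g: "\<forall>i. coeff g i \<in> K" "separable_poly g" "poly g x = 0"
    using separable[of x] by (auto simp: separable_over_def)
  then obtain q where "g = q * minp a" using minp_dvd[OF assms, of g] by (auto simp: K.polyF_def)
  thus ?thesis using g separable_poly_factor by blast
qed

text \<open>The separable closure supplies roots of separable polynomials only, so the induction
  must pass separability on to the cofactor; separability also keeps the roots distinct.\<close>

lemma separable_poly_splits:
  fixes f :: "'s poly"
  assumes "separable_poly f" "f \<noteq> 0"
  shows "\<exists>Y. finite Y \<and> card Y = Polynomial.degree f \<and> f = smult (lead_coeff f) (\<Prod>y\<in>Y. [:- y, 1:])"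
  using assms
proof (induction "Polynomial.degree f" arbitrary: f)
  case 0
  thus ?case by (intro exI[of _ "{}"]) (auto elim: degree_eq_zeroE)
next
  case (Suc n)
  then obtain y where "poly f y = 0" using sep_closed[of f] by auto
  then obtain g where f: "f = [:- y, 1:] * g" by (auto simp: poly_eq_0_iff_dvd elim: dvdE)
  have g0: "g \<noteq> 0" using Suc f by auto
  have deg: "Polynomial.degree f = Suc (Polynomial.degree g)" unfolding f using g0 by (subst degree_mult_eq) auto
  have gy: "poly g y \<noteq> 0" using separable_poly_simple_root Suc.prems f by blast
  obtain Y where Y: "finite Y" "card Y = Polynomial.degree g" "g = smult (lead_coeff g) (\<Prod>y\<in>Y. [:- y, 1:])"
    using Suc.hyps(1)[of g] separable_poly_factor[OF Suc.prems(1)[unfolded f]] Suc.hyps(2) deg g0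
    by (metis Suc_inject)
  have "y \<notin> Y"
  proof
    assume "y \<in> Y"
    hence "poly (\<Prod>y\<in>Y. [:- y, 1:]) y = 0" using Y(1) by (auto simp: poly_prod)
    thus False using gy Y(3) by (metis poly_smult mult_zero_right)
  qed
  have lc: "lead_coeff f = lead_coeff g" unfolding f by (subst lead_coeff_mult) simp
  have "f = smult (lead_coeff f) (\<Prod>y\<in>insert y Y. [:- y, 1:])"
    unfolding lc prod.insert[OF Y(1) \<open>y \<notin> Y\<close>] mult_smult_right[symmetric] Y(3)[symmetric] by (rule f)
  thus ?case using Y \<open>y \<notin> Y\<close> deg by (intro exI[of _ "insert y Y"]) auto
qed

text \<open>Differentiating \<open>(X - x) g\<close> and evaluating at \<open>x\<close> leaves
  \<open>g(x)\<close>, the product over the remaining roots.\<close>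

lemma minp_conjugates:
  assumes "eisenstein a" "poly (minp a) x = 0"
  obtains Y where "finite Y" "card Y = p - 1" "x \<notin> Y" "\<forall>y\<in>Y. poly (minp a) y = 0"
    "poly (pderiv (minp a)) x = (\<Prod>y\<in>Y. x - y)"
proof -
  obtain Z where Z: "finite Z" "card Z = p" "minp a = (\<Prod>y\<in>Z. [:- y, 1:])"
    using separable_poly_splits[OF separable_minp[OF assms] minp_nz] by (auto simp: degree_minp coeff_minp)
  have root: "poly (minp a) y = (\<Prod>z\<in>Z. y - z)" for y unfolding Z(3) by (simp add: poly_prod)
  have xZ: "x \<in> Z" using assms(2) Z(1) root[of x] by auto
  define Y where "Y = Z - {x}"
  have Y: "Z = insert x Y" "x \<notin> Y" "finite Y" using xZ Z by (auto simp: Y_def)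
  have "minp a = [:- x, 1:] * (\<Prod>y\<in>Y. [:- y, 1:])" unfolding Z(3) Y(1) using Y by simp
  hence "pderiv (minp a) = [:- x, 1:] * pderiv (\<Prod>y\<in>Y. [:- y, 1:]) + (\<Prod>y\<in>Y. [:- y, 1:])"
    by (simp only: pderiv_mult) (simp add: pderiv_pCons algebra_simps)
  hence "poly (pderiv (minp a)) x = (\<Prod>y\<in>Y. x - y)" by (simp add: poly_prod)
  moreover have "card Y = p - 1" using Z xZ by (simp add: Y_def)
  moreover have "poly (minp a) y = 0" if "y \<in> Y" for y using that Y Z(1) root[of y] by auto
  ultimately show ?thesis using that Y by blast
qed

lemma poly_pderiv_minp: "poly (pderiv (minp a)) x = - (\<Sum>i<p. of_nat i * a i * x ^ (i - 1))"
proof -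
  have sum: "pderiv (\<Sum>i\<in>I. g i) = (\<Sum>i\<in>I. pderiv (g i))" for I and g :: "nat \<Rightarrow> 's poly"
    by (induction I rule: infinite_finite_induct) (auto simp: pderiv_add)
  have "(of_nat p :: 's) = 0" using of_nat_CHAR[where 'a = 's] by (simp add: CHAR_p)
  hence "pderiv (minp a) = - (\<Sum>i<p. Polynomial.monom (of_nat i * a i) (i - 1))"
    by (simp add: minp_def pderiv_diff sum pderiv_monom)
  thus ?thesis by (simp add: poly_sum poly_monom)
qed

text \<open>The image of an Eisenstein relation under \<sigma> is again one, so \<sigma> takes a
  prime element to a prime element. Values of sums are decided termwise on both sides, and the terms
  correspond.\<close>

lemma hom_V:
  assumes L: "tot_ram L" and hom: "hom_on L \<sigma>" and K: "\<And>c. c \<in> K \<Longrightarrow> \<sigma> c \<in> K"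
    and V: "\<And>c. c \<in> K \<Longrightarrow> c \<noteq> 0 \<Longrightarrow> V (\<sigma> c) = V c" and z: "z \<in> L" "z \<noteq> 0"
  shows "V (\<sigma> z) = V z"
proof -
  interpret L: subfield_set L using L tot_subfield by auto
  have KL: "c \<in> K \<Longrightarrow> c \<in> L" for c using tot_K[OF L] by auto
  obtain x where x: "x \<in> L" "V x = 1" "x \<noteq> 0" using tot_prime_exists[OF L] .
  obtain a where eis: "eisenstein a" and xp: "x ^ p = (\<Sum>i<p. a i * x ^ i)"
    using tot_min_poly[OF L x] .
  hence a: "\<And>i. i < p \<Longrightarrow> a i \<in> K" "\<And>i. i < p \<Longrightarrow> a i \<in> M (real p)" "a 0 \<noteq> 0" "V (a 0) = real p"
    "x ^ p = (\<Sum>i<p. a i * x ^ i)" by (auto simp: eisenstein_def)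
  have M: "\<sigma> c \<in> M r \<longleftrightarrow> c \<in> M r" if "c \<in> K" for c r
    using that V[of c] L.hom_nz[OF hom KL] by (cases "c = 0") (auto simp: M_def L.hom_zero[OF hom])
  have "eisenstein (\<lambda>i. \<sigma> (a i))"
    using a K M V[of "a 0"] p_pos L.hom_nz[OF hom, of "a 0"] KL by (auto simp: eisenstein_def)
  moreover have "\<sigma> x ^ p = (\<Sum>i<p. \<sigma> (a i) * \<sigma> x ^ i)"
    using L.hom_lincomb[OF hom, of p a x] a(1) x KL by (simp flip: a(5) add: L.hom_power[OF hom])
  ultimately have y: "\<sigma> x \<noteq> 0" "V (\<sigma> x) = 1" by (rule eisenstein_root)+
  obtain c where c: "\<forall>i<p. c i \<in> K" "z = (\<Sum>i<p. c i * x ^ i)"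
    using tot_span[OF L x] z by (auto simp: span_pow_def)
  have \<sigma>z: "\<sigma> z = (\<Sum>i<p. \<sigma> (c i) * \<sigma> x ^ i)"
    unfolding c(2) using c(1) x KL by (intro L.hom_lincomb[OF hom]) auto
  have term_iff: "\<sigma> (c i) * \<sigma> x ^ i \<in> M r \<longleftrightarrow> c i * x ^ i \<in> M r" if "i < p" for i r
    using M_mult_iff[of "x ^ i" "c i" r] M_mult_iff[of "\<sigma> x ^ i" "\<sigma> (c i)" r] M[of "c i"] that c x y
    by (simp add: V_power mult.commute)
  have "\<sigma> z \<in> M r \<longleftrightarrow> z \<in> M r" for r
  proof
    assume "\<sigma> z \<in> M r"
    hence "\<sigma> (c i) * \<sigma> x ^ i \<in> M r" if "i < p" for i
      using that coeff_M[of "\<sigma> x" "\<lambda>i. \<sigma> (c i)" r i] y c K unfolding \<sigma>z by auto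
    thus "z \<in> M r" unfolding c(2) using term_iff by (intro M_sum) auto
  next
    assume "z \<in> M r"
    hence "c i * x ^ i \<in> M r" if "i < p" for i
      using that coeff_M[of "x" c r i] x c unfolding c(2) by auto
    thus "\<sigma> z \<in> M r" unfolding \<sigma>z using term_iff by (intro M_sum) auto
  qed
  from this[of "V z"] this[of "V (\<sigma> z)"] show ?thesis
    using L.hom_nz[OF hom z] z by (simp add: M_def)
qed

text \<open>A polynomial over \<open>K\<close> evaluated at \<open>x\<close> is sent to its twist by
  \<tau> evaluated at \<open>y\<close>. This is well defined because the polynomials vanishing at
  \<open>x\<close> are multiples of \<open>minp a\<close>, whose twist vanishes at
  \<open>y\<close>.\<close>

lemma hom_extend:
  assumes hom: "hom_on K \<tau>" and K: "\<tau> ` K = K" and V: "\<And>c. c \<in> K \<Longrightarrow> c \<noteq> 0 \<Longrightarrow> V (\<tau> c) = V c"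
    and a: "eisenstein a" and x: "x ^ p = (\<Sum>i<p. a i * x ^ i)" and y: "y ^ p = (\<Sum>i<p. \<tau> (a i) * y ^ i)"
  obtains \<sigma> where "hom_on (field_adjoin K x) \<sigma>" "\<forall>c\<in>K. \<sigma> c = \<tau> c" "\<sigma> x = y"
    "\<sigma> ` field_adjoin K x = field_adjoin K y"
proof -
  have \<tau>K: "\<tau> c \<in> K" if "c \<in> K" for c using K that by blast
  have Mi: "\<tau> c \<in> M r \<longleftrightarrow> c \<in> M r" if "c \<in> K" for c r
    using that V[of c] K.hom_nz[OF hom] by (cases "c = 0") (auto simp: M_def K.hom_zero[OF hom])
  have eis': "eisenstein (\<lambda>i. \<tau> (a i))"
    using a Mi V[of "a 0"] \<tau>K p_pos K.hom_nz[OF hom, of "a 0"] by (auto simp: eisenstein_def)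
  have Lx: "tot_ram (field_adjoin K x)" using tot_adjoin[OF a x] .
  have Ly: "tot_ram (field_adjoin K y)" using tot_adjoin[OF eis' y] .
  have x': "V x = 1" "x \<noteq> 0" "V y = 1" "y \<noteq> 0"
    using eisenstein_root[OF a x] eisenstein_root[OF eis' y] by auto
  have spx: "field_adjoin K x = span_pow K p (\<lambda>i. x ^ i)"
    by (rule tot_span[OF Lx]) (use x' field_adjoin_incl in auto)
  have spy: "field_adjoin K y = span_pow K p (\<lambda>i. y ^ i)"
    by (rule tot_span[OF Ly]) (use x' field_adjoin_incl in auto)
  note mp = K.map_poly_mult_hom[OF hom] K.map_poly_add_hom[OF hom] K.map_poly_diff_hom[OF hom]
  have mpm: "map_poly \<tau> (minp a) = minp (\<lambda>i. \<tau> (a i))"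
    using a by (intro poly_eqI) (auto simp: coeff_map_poly coeff_minp eisenstein_def
       K.hom_zero[OF hom] K.hom_one[OF hom] K.hom_uminus[OF hom])
  have wd: "poly (map_poly \<tau> g) y = poly (map_poly \<tau> h) y"
    if gh: "K.polyF g" "K.polyF h" "poly g x = poly h x" for g h
  proof -
    have "K.polyF (g - h)" "poly (g - h) x = 0" using gh K.polyF_diff by auto
    then obtain q where q: "K.polyF q" "g - h = q * minp a"
      using minp_dvd[OF a, of x "g - h"] x by (auto simp: poly_minp)
    have "map_poly \<tau> (g - h) = map_poly \<tau> q * minp (\<lambda>i. \<tau> (a i))"
      unfolding q(2) using mp(1)[OF q(1) polyK_minp[OF a]] mpm by simp
    hence "poly (map_poly \<tau> (g - h)) y = 0" using y by (simp add: poly_minp)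
    thus ?thesis using mp(3) gh by simp
  qed
  \<comment> \<open>By \<open>wd\<close> the value does not depend on which representing polynomial
    is chosen.\<close>
  define \<sigma> where "\<sigma> z = poly (map_poly \<tau> (SOME g. K.polyF g \<and> poly g x = z)) y" for z
  have \<sigma>: "\<sigma> (poly g x) = poly (map_poly \<tau> g) y" if "K.polyF g" for g
    using someI[of "\<lambda>h. K.polyF h \<and> poly h x = poly g x" g] that wd unfolding \<sigma>_def by blast
  define P where "P c = (\<Sum>i<p. Polynomial.monom (c i :: 's) i)" for c
  have PK: "K.polyF (P c)" if "\<forall>i<p. c i \<in> K" for c
    using that by (auto simp: P_def intro!: K.polyF_sum K.polyF_monom)
  have Px: "poly (P c) z = (\<Sum>i<p. c i * z ^ i)" for c z by (simp add: P_def poly_sum poly_monom)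
  have mpP: "map_poly \<tau> (P c) = P (\<lambda>i. \<tau> (c i))" for c
    by (intro poly_eqI) (auto simp: coeff_map_poly P_def coeff_sum K.hom_zero[OF hom])
  have rep: "\<exists>g. K.polyF g \<and> poly g x = z" if "z \<in> field_adjoin K x" for z
  proof -
    have "z \<in> span_pow K p (\<lambda>i. x ^ i)" using that by (simp only: spx)
    then obtain c where "\<forall>i<p. c i \<in> K" "z = (\<Sum>i<p. c i * x ^ i)"
      by (auto simp: span_pow_def)
    thus ?thesis using PK Px by metis
  qed
  have "hom_on (field_adjoin K x) \<sigma>"
    unfolding hom_on_def
  proof (intro conjI ballI)
    show "\<sigma> 1 = 1" using \<sigma>[of 1] by (simp add: K.hom_one[OF hom] map_poly_1)
    fix z w assume "z \<in> field_adjoin K x" "w \<in> field_adjoin K x"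
    then obtain g h where gh: "K.polyF g" "poly g x = z" "K.polyF h" "poly h x = w" using rep by metis
    show "\<sigma> (z + w) = \<sigma> z + \<sigma> w"
      using \<sigma>[OF K.polyF_add, of g h] gh mp \<sigma> by auto
    show "\<sigma> (z * w) = \<sigma> z * \<sigma> w"
      using \<sigma>[OF K.polyF_mult, of g h] gh mp \<sigma> by auto
  qed
  moreover have "\<sigma> c = \<tau> c" if "c \<in> K" for c
    using \<sigma>[of "[:c:]"] that by (simp add: K.polyF_def coeff_pCons map_poly_pCons K.hom_zero[OF hom] split: nat.splits)
  moreover have "\<sigma> x = y"
    using \<sigma>[of "[:0, 1:]"]
    by (simp add: K.polyF_def coeff_pCons map_poly_pCons K.hom_zero[OF hom] K.hom_one[OF hom] split: nat.splits)
  moreover have "\<sigma> ` field_adjoin K x = field_adjoin K y"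
  proof (intro equalityI subsetI)
    fix w assume "w \<in> \<sigma> ` field_adjoin K x"
    hence "w \<in> \<sigma> ` span_pow K p (\<lambda>i. x ^ i)" by (simp only: spx)
    then obtain c where c: "\<forall>i<p. c i \<in> K" "w = \<sigma> (\<Sum>i<p. c i * x ^ i)"
      by (auto simp: span_pow_def)
    have "w = (\<Sum>i<p. \<tau> (c i) * y ^ i)" using c \<sigma>[OF PK[OF c(1)]] by (simp add: Px mpP)
    thus "w \<in> field_adjoin K y"
      unfolding spy span_pow_def using c \<tau>K by (intro CollectI exI[of _ "\<lambda>i. \<tau> (c i)"]) auto
  next
    fix w assume "w \<in> field_adjoin K y"
    hence "w \<in> span_pow K p (\<lambda>i. y ^ i)" by (simp only: spy)
    then obtain d where d: "\<forall>i<p. d i \<in> K" "w = (\<Sum>i<p. d i * y ^ i)"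
      by (auto simp: span_pow_def)
    define c where "c i = inv_into K \<tau> (d i)" for i
    have c: "\<forall>i<p. c i \<in> K" "\<And>i. i < p \<Longrightarrow> \<tau> (c i) = d i"
      using d(1) K by (auto simp: c_def inv_into_into f_inv_into_f)
    have "w = \<sigma> (\<Sum>i<p. c i * x ^ i)" using c d \<sigma>[OF PK[OF c(1)]] by (simp add: Px mpP)
    moreover have "(\<Sum>i<p. c i * x ^ i) \<in> field_adjoin K x"
      unfolding spx span_pow_def using c(1) by (intro CollectI exI[of _ c]) auto
    ultimately show "w \<in> \<sigma> ` field_adjoin K x" by blast
  qed
  ultimately show ?thesis using that by blast
qed

section \<open>Automorphisms of \<open>K\<close> moving the uniformizer\<close>

text \<open>
  The map \<open>g(t)/h(t) \<mapsto> g(t')/h(t')\<close> on \<open>k(t)\<close> is an isometry with dense domain, so the closure of its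
  graph is the graph of an automorphism of \<open>K\<close>.
\<close>

definition prime_K :: "'s \<Rightarrow> bool" where "prime_K t \<longleftrightarrow> t \<in> K \<and> t \<noteq> 0 \<and> V t = real p"

text \<open>The lowest nonzero coefficient decides, so \<open>N\<close> is the order of
  \<open>g\<close> at 0 and serves all prime elements \<open>t\<close> at once. Hence exchanging one
  prime element for another preserves values.\<close>

lemma poly_k_V:
  "k.polyF g \<Longrightarrow> g \<noteq> 0 \<Longrightarrow> \<exists>N::nat. \<forall>t. prime_K t \<longrightarrow> poly g t \<noteq> 0 \<and> V (poly g t) = real p * real N"
proof (induction g)
  case (pCons a g)
  have a: "a \<in> k" and g: "k.polyF g"
    using pCons.prems(1) unfolding k.polyF_def by (metis coeff_pCons_0, metis coeff_pCons_Suc)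
  show ?case
  proof (cases "a = 0")
    case False
    have "poly (pCons a g) t \<noteq> 0 \<and> V (poly (pCons a g) t) = real p * real 0" if t: "prime_K t" for t
    proof -
      have "t * poly g t \<in> Ms (V a)"
      proof (cases "g = 0")
        case False
        then obtain N :: nat where "poly g t \<noteq> 0" "V (poly g t) = real p * real N"
          using pCons.IH g t by blast
        thus ?thesis using t V_k[OF a \<open>a \<noteq> 0\<close>] p_pos by (simp add: Ms_def prime_K_def V_mult add_pos_nonneg)
      qed auto
      from V_add_dominant[OF False this] show ?thesis using V_k[OF a False] by simp
    qed
    thus ?thesis by blast
  next
    case True
    hence "g \<noteq> 0" using pCons.hyps by auto
    then obtain N :: nat where N: "\<And>t. prime_K t \<Longrightarrow> poly g t \<noteq> 0 \<and> V (poly g t) = real p * real N"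
      using pCons.IH g by blast
    have "poly (pCons a g) t \<noteq> 0 \<and> V (poly (pCons a g) t) = real p * real (Suc N)" if t: "prime_K t" for t
      using N[OF t] t True by (simp add: prime_K_def V_mult algebra_simps)
    thus ?thesis by blast
  qed
qed auto

lemma poly_k_mem_K: "k.polyF g \<Longrightarrow> t \<in> K \<Longrightarrow> poly g t \<in> K"
  using k_K by (intro K.polyF_poly_mem) (auto simp: k.polyF_def K.polyF_def)

lemma poly_k_nz: "k.polyF g \<Longrightarrow> prime_K t \<Longrightarrow> poly g t = 0 \<longleftrightarrow> g = 0"
  using poly_k_V[of g] by auto

lemma poly_k_M_iff:
  assumes "k.polyF g" "prime_K t" "prime_K t'" shows "poly g t \<in> M r \<longleftrightarrow> poly g t' \<in> M r"
  using poly_k_V[OF assms(1)] assms(2,3) by (cases "g = 0") (auto simp: M_def)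

definition ratpairs :: "'s \<Rightarrow> 's \<Rightarrow> ('s \<times> 's) set" where
  "ratpairs t t' = {(poly g t / poly h t, poly g t' / poly h t') | g h. k.polyF g \<and> k.polyF h \<and> h \<noteq> 0}"

definition ratlim :: "'s \<Rightarrow> 's \<Rightarrow> 's \<Rightarrow> 's \<Rightarrow> bool" where
  "ratlim t t' z w \<longleftrightarrow> z \<in> K \<and> w \<in> K \<and>
     (\<forall>N::nat. \<exists>q q'. (q, q') \<in> ratpairs t t' \<and> z - q \<in> M (real N) \<and> w - q' \<in> M (real N))"

context
  fixes t t' assumes t: "prime_K t" and t': "prime_K t'"
begin

lemma ratpairs_K: "(q, q') \<in> ratpairs t t' \<Longrightarrow> q \<in> K \<and> q' \<in> K"
  using t t' by (auto simp: ratpairs_def prime_K_def intro!: K.divide_mem poly_k_mem_K)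

lemma ratpairs_M: "(q, q') \<in> ratpairs t t' \<Longrightarrow> q \<in> M r \<longleftrightarrow> q' \<in> M r"
proof -
  assume "(q, q') \<in> ratpairs t t'"
  then obtain g h where gh: "k.polyF g" "k.polyF h" "h \<noteq> 0" "q = poly g t / poly h t" "q' = poly g t' / poly h t'"
    by (auto simp: ratpairs_def)
  obtain N :: nat where N: "\<And>t. prime_K t \<Longrightarrow> poly h t \<noteq> 0 \<and> V (poly h t) = real p * real N"
    using poly_k_V[OF gh(2,3)] by blast
  show ?thesis unfolding gh(4,5)
    using N[OF t] N[OF t'] by (simp add: M_divide_iff poly_k_M_iff[OF gh(1) t t'])
qed

lemma ratpairs_add:
  assumes "(q, q') \<in> ratpairs t t'" "(r, r') \<in> ratpairs t t'"
  shows "(q + r, q' + r') \<in> ratpairs t t'"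
proof -
  obtain g h where gh: "k.polyF g" "k.polyF h" "h \<noteq> 0" "q = poly g t / poly h t" "q' = poly g t' / poly h t'"
    using assms by (auto simp: ratpairs_def)
  obtain u w where uw: "k.polyF u" "k.polyF w" "w \<noteq> 0" "r = poly u t / poly w t" "r' = poly u t' / poly w t'"
    using assms by (auto simp: ratpairs_def)
  have "q + r = poly (g * w + u * h) t / poly (h * w) t" "q' + r' = poly (g * w + u * h) t' / poly (h * w) t'"
    using gh uw poly_k_nz t t' by (auto simp: add_frac_eq)
  moreover have "k.polyF (g * w + u * h)" "k.polyF (h * w)" "h * w \<noteq> 0"
    using gh uw by (auto intro!: k.polyF_add k.polyF_mult)
  ultimately show ?thesis unfolding ratpairs_def by blast
qed

lemma ratpairs_mult:
  assumes "(q, q') \<in> ratpairs t t'" "(r, r') \<in> ratpairs t t'"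
  shows "(q * r, q' * r') \<in> ratpairs t t'"
proof -
  obtain g h where gh: "k.polyF g" "k.polyF h" "h \<noteq> 0" "q = poly g t / poly h t" "q' = poly g t' / poly h t'"
    using assms by (auto simp: ratpairs_def)
  obtain u w where uw: "k.polyF u" "k.polyF w" "w \<noteq> 0" "r = poly u t / poly w t" "r' = poly u t' / poly w t'"
    using assms by (auto simp: ratpairs_def)
  have "q * r = poly (g * u) t / poly (h * w) t" "q' * r' = poly (g * u) t' / poly (h * w) t'"
    using gh uw by auto
  moreover have "k.polyF (g * u)" "k.polyF (h * w)" "h * w \<noteq> 0"
    using gh uw by (auto intro!: k.polyF_mult)
  ultimately show ?thesis unfolding ratpairs_def by blast
qed

lemma ratpairs_poly: "k.polyF g \<Longrightarrow> (poly g t, poly g t') \<in> ratpairs t t'"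
  unfolding ratpairs_def by (intro CollectI exI[of _ g] exI[of _ 1]) auto

lemma ratpairs_const: "a \<in> k \<Longrightarrow> (a, a) \<in> ratpairs t t'"
  using ratpairs_poly[of "[:a:]"] by (simp add: k.polyF_def coeff_pCons split: nat.splits)

lemma ratpairs_uniformizer: "(t, t') \<in> ratpairs t t'"
  using ratpairs_poly[of "[:0, 1:]"] by (simp add: k.polyF_def coeff_pCons split: nat.splits)

lemma ratpairs_diff:
  assumes "(q, q') \<in> ratpairs t t'" "(r, r') \<in> ratpairs t t'"
  shows "(q - r, q' - r') \<in> ratpairs t t'"
  using ratpairs_add[OF assms(1) ratpairs_mult[OF ratpairs_const[of "-1"] assms(2)]]
  by (simp add: k.uminus_mem)

text \<open>The \<open>t\<close>-adic expansion with digits in \<open>k\<close>; each step adds one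
  digit.\<close>

lemma k_poly_approx:
  assumes "z \<in> K" "z \<in> M 0"
  shows "\<exists>g. k.polyF g \<and> z - poly g t \<in> M (real p * real N)"
proof (induction N)
  case 0
  thus ?case using assms by (intro exI[of _ 0]) auto
next
  case (Suc N)
  then obtain g where g: "k.polyF g" "z - poly g t \<in> M (real p * real N)" by blast
  have V: "V (t ^ N) = real p * real N" "t ^ N \<noteq> 0" "t ^ N \<in> K"
    using t by (auto simp: prime_K_def V_power K.power_mem)
  have mem: "(z - poly g t) / t ^ N \<in> K" using assms g t V
    by (intro K.divide_mem K.diff_mem poly_k_mem_K) (auto simp: prime_K_def)
  moreover have "(z - poly g t) / t ^ N \<in> M 0" using g(2) V by (simp add: M_divide_iff)
  ultimately obtain a where a: "a \<in> k" "(z - poly g t) / t ^ N - a \<in> Ms 0" using residue_K by blast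
  have "(z - poly g t) / t ^ N - a \<in> M (real p)"
    using a mem k_K by (intro K_pos_M K.diff_mem) auto
  hence "t ^ N * ((z - poly g t) / t ^ N - a) \<in> M (real p * real N + real p)"
    using M_mult[OF M_self[of "t ^ N"]] V by simp
  moreover have "t ^ N * ((z - poly g t) / t ^ N - a) = z - poly (g + Polynomial.monom a N) t"
    using t by (simp add: prime_K_def poly_monom field_simps)
  moreover have "real p * real N + real p = real p * real (Suc N)" by (simp add: algebra_simps)
  ultimately have "z - poly (g + Polynomial.monom a N) t \<in> M (real p * real (Suc N))" by metis
  thus ?case using g a by (intro exI[of _ "g + Polynomial.monom a N"]) (auto intro: k.polyF_add k.polyF_monom)
qed

lemma ratpairs_dense:
  assumes "z \<in> K" shows "\<exists>q q'. (q, q') \<in> ratpairs t t' \<and> z - q \<in> M (real N)"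
proof -
  obtain J :: nat where J: "z * t ^ J \<in> M 0"
  proof (cases "z = 0")
    case False
    obtain J :: nat where J: "- V z \<le> real J" using real_arch_simple by blast
    have "real J * 1 \<le> real J * real p" using p_ge_2 by (intro mult_left_mono) auto
    hence "z * t ^ J \<in> M 0" using J False t by (simp add: M_def prime_K_def V_mult V_power)
    thus ?thesis using that by blast
  qed auto
  have V: "V (t ^ J) = real p * real J" "t ^ J \<noteq> 0" "t ^ J \<in> K"
    using t by (auto simp: prime_K_def V_power K.power_mem)
  obtain g where g: "k.polyF g" "z * t ^ J - poly g t \<in> M (real p * real (N + J))"
    using k_poly_approx[of "z * t ^ J" "N + J"] assms J V K.mult_mem by blast
  have "(z * t ^ J - poly g t) / t ^ J \<in> M (real N)"
  proof -
    have "real N * 1 \<le> real N * real p" using p_ge_2 by (intro mult_left_mono) auto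
    hence "z * t ^ J - poly g t \<in> M (real N + V (t ^ J))"
      using M_mono[OF g(2)] V by (auto simp: algebra_simps)
    thus ?thesis using V by (simp add: M_divide_iff)
  qed
  moreover have "(z * t ^ J - poly g t) / t ^ J = z - poly g t / poly (Polynomial.monom 1 J) t"
    using t by (simp add: prime_K_def poly_monom diff_divide_distrib)
  moreover have "(poly g t / poly (Polynomial.monom 1 J) t, poly g t' / poly (Polynomial.monom 1 J) t') \<in> ratpairs t t'"
    unfolding ratpairs_def using g(1) k.polyF_monom[of 1 J]
    by (intro CollectI exI[of _ g] exI[of _ "Polynomial.monom 1 J"]) (auto simp: monom_eq_0_iff)
  ultimately show ?thesis by metis
qed

abbreviation Rel :: "'s \<Rightarrow> 's \<Rightarrow> bool" where
  "Rel \<equiv> ratlim t t'"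

lemma RelE: "Rel z w \<Longrightarrow> \<exists>q q'. (q, q') \<in> ratpairs t t' \<and> z - q \<in> M (real N) \<and> w - q' \<in> M (real N)"
  by (simp add: ratlim_def)

lemma Rel_ratpairs: "(q, q') \<in> ratpairs t t' \<Longrightarrow> Rel q q'"
  using ratpairs_K unfolding ratlim_def by (metis diff_self zero_M)

lemma M_cong: "x - y \<in> M r \<Longrightarrow> x \<in> M r \<longleftrightarrow> y \<in> M r"
  using M_diff[of x r "x - y"] M_add[of "x - y" r y] by auto

text \<open>Isometry survives the closure: approximate both members more finely than
  \<open>r\<close>. Uniqueness in both arguments follows by comparing a difference with 0.\<close>

lemma Rel_M: assumes "Rel z w" shows "z \<in> M r \<longleftrightarrow> w \<in> M r"
proof -
  obtain N :: nat where N: "r \<le> real N" using real_arch_simple by blast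
  obtain q q' where q: "(q, q') \<in> ratpairs t t'" "z - q \<in> M (real N)" "w - q' \<in> M (real N)"
    using RelE[OF assms] by blast
  have "z - q \<in> M r" "w - q' \<in> M r" using q N by (auto intro: M_mono)
  thus ?thesis using M_cong[of z q r] M_cong[of w q' r] ratpairs_M[OF q(1), of r] by simp
qed

lemma Rel_add: assumes "Rel z w" "Rel z' w'" shows "Rel (z + z') (w + w')"
  unfolding ratlim_def
proof (intro conjI allI)
  fix N
  obtain q q' where q: "(q, q') \<in> ratpairs t t'" "z - q \<in> M (real N)" "w - q' \<in> M (real N)"
    using RelE[OF assms(1)] by blast
  obtain s s' where s: "(s, s') \<in> ratpairs t t'" "z' - s \<in> M (real N)" "w' - s' \<in> M (real N)"
    using RelE[OF assms(2)] by blast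
  show "\<exists>q q'. (q, q') \<in> ratpairs t t' \<and> z + z' - q \<in> M (real N) \<and> w + w' - q' \<in> M (real N)"
    using ratpairs_add[OF q(1) s(1)] M_add[OF q(2) s(2)] M_add[OF q(3) s(3)]
    by (intro exI[of _ "q + s"] exI[of _ "q' + s'"]) (simp add: algebra_simps)
qed (use assms in \<open>auto simp: ratlim_def intro: K.add_mem\<close>)

lemma M_bound: "\<exists>B::nat. x \<in> M (- real B)"
proof -
  obtain B :: nat where "- V x \<le> real B" using real_arch_simple by blast
  thus ?thesis by (intro exI[of _ B]) (auto simp: M_def)
qed

lemma M_mult_diff:
  assumes "z - q \<in> M (real (N + B))" "z' - s \<in> M (real (N + B))" "z \<in> M (- real B)" "z' \<in> M (- real B)"
  shows "z * z' - q * s \<in> M (real N)"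
proof -
  have "z' - (z' - s) \<in> M (- real B)" by (rule M_diff) (use assms M_mono in auto)
  hence "s * (z - q) \<in> M (- real B + real (N + B))" using assms by (intro M_mult) auto
  moreover have "z * (z' - s) \<in> M (- real B + real (N + B))" using assms by (intro M_mult) auto
  ultimately have "z * (z' - s) + s * (z - q) \<in> M (real N)" by (intro M_add) auto
  thus ?thesis by (simp add: algebra_simps)
qed

lemma Rel_mult: assumes "Rel z w" "Rel z' w'" shows "Rel (z * z') (w * w')"
  unfolding ratlim_def
proof (intro conjI allI)
  fix N
  \<comment> \<open>A factor of value at least \<open>-B\<close> costs \<open>B\<close> units of
    precision in a product, so the approximations are taken to order \<open>N + B\<close>.\<close>
  obtain B1 B2 B3 B4 :: nat where "z \<in> M (- real B1)" "z' \<in> M (- real B2)" "w \<in> M (- real B3)" "w' \<in> M (- real B4)"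
    using M_bound by metis
  hence B: "z \<in> M (- real (B1 + B2 + B3 + B4))" "z' \<in> M (- real (B1 + B2 + B3 + B4))"
    "w \<in> M (- real (B1 + B2 + B3 + B4))" "w' \<in> M (- real (B1 + B2 + B3 + B4))"
    by (auto elim!: M_mono)
  define B where "B = B1 + B2 + B3 + B4"
  note B = B[folded B_def]
  obtain q q' where q: "(q, q') \<in> ratpairs t t'" "z - q \<in> M (real (N + B))" "w - q' \<in> M (real (N + B))"
    using RelE[OF assms(1)] by blast
  obtain s s' where s: "(s, s') \<in> ratpairs t t'" "z' - s \<in> M (real (N + B))" "w' - s' \<in> M (real (N + B))"
    using RelE[OF assms(2)] by blast
  show "\<exists>q q'. (q, q') \<in> ratpairs t t' \<and> z * z' - q \<in> M (real N) \<and> w * w' - q' \<in> M (real N)"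
    using ratpairs_mult[OF q(1) s(1)] M_mult_diff[OF q(2) s(2) B(1,2)] M_mult_diff[OF q(3) s(3) B(3,4)]
    by blast
qed (use assms in \<open>auto simp: ratlim_def intro: K.mult_mem\<close>)

lemma Rel_diff: assumes "Rel z w" "Rel z' w'" shows "Rel (z - z') (w - w')"
  using Rel_add[OF assms(1) Rel_mult[OF Rel_ratpairs[OF ratpairs_const[of "-1"]] assms(2)]]
  by (simp add: k.uminus_mem)

lemma Rel_unique: assumes "Rel z w" "Rel z w'" shows "w = w'"
proof -
  have "Rel 0 (w - w')" using Rel_diff[OF assms] by simp
  hence "w - w' \<in> M (real i)" for i using Rel_M[of 0 "w - w'"] by simp
  hence "w - w' = 0" by (rule M_all_zero)
  thus ?thesis by simp
qed

lemma Rel_unique': assumes "Rel z w" "Rel z' w" shows "z = z'"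
proof -
  have "Rel (z - z') 0" using Rel_diff[OF assms] by simp
  hence "z - z' \<in> M (real i)" for i using Rel_M[of "z - z'" 0] by simp
  hence "z - z' = 0" by (rule M_all_zero)
  thus ?thesis by simp
qed

text \<open>By isometry, approximations of \<open>z\<close> that form a Cauchy sequence have Cauchy
  images, which converge in the complete field \<open>K\<close>.\<close>

lemma Rel_exists: assumes "z \<in> K" shows "\<exists>w. Rel z w"
proof -
  obtain Q where "\<forall>N. \<exists>q'. (Q N, q') \<in> ratpairs t t' \<and> z - Q N \<in> M (real N)"
    using ratpairs_dense[OF assms] by metis
  then obtain Q' where Q: "\<And>N. (Q N, Q' N) \<in> ratpairs t t'" "\<And>N. z - Q N \<in> M (real N)"
    by metis
  have "Q' (Suc N) - Q' N \<in> M (real N)" for N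
  proof -
    have "z - Q (Suc N) \<in> M (real N)" using Q(2)[of "Suc N"] by (rule M_mono) simp
    with Q(2)[of N] have "(z - Q N) - (z - Q (Suc N)) \<in> M (real N)" by (rule M_diff)
    hence "Q (Suc N) - Q N \<in> M (real N)" by simp
    thus ?thesis using ratpairs_M[OF ratpairs_diff[OF Q(1)[of "Suc N"] Q(1)[of N]], of "real N"] by simp
  qed
  then obtain w where w: "w \<in> K" "\<forall>N. Q' N - w \<in> M (real N)"
    using complete_K[of Q'] ratpairs_K[OF Q(1)] by blast
  have "Rel z w" unfolding ratlim_def using assms w Q M_diff_commute by metis
  thus ?thesis by blast
qed

end

lemma ratpairs_sym: "(q, q') \<in> ratpairs t t' \<longleftrightarrow> (q', q) \<in> ratpairs t' t"
  unfolding ratpairs_def by blast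

lemma Rel_sym: "ratlim t t' z w \<longleftrightarrow> ratlim t' t w z"
  unfolding ratlim_def using ratpairs_sym by blast

lemma K_automorphism:
  assumes t: "prime_K t" and t': "prime_K t'"
  obtains \<tau> where "hom_on K \<tau>" "\<tau> ` K = K" "\<forall>c\<in>K. c \<noteq> 0 \<longrightarrow> V (\<tau> c) = V c"
    "\<forall>a\<in>k. \<tau> a = a" "\<tau> t = t'"
proof -
  define \<tau> where "\<tau> z = (THE w. ratlim t t' z w)" for z
  have eq: "\<tau> z = w" if "ratlim t t' z w" for z w
    unfolding \<tau>_def using that Rel_unique[OF t t'] by blast
  have rel: "ratlim t t' z (\<tau> z)" if "z \<in> K" for z
    using Rel_exists[OF t t' that] eq by auto
  have K: "\<tau> z \<in> K" if "z \<in> K" for z using rel[OF that] by (simp add: ratlim_def)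
  have k: "\<tau> a = a" if "a \<in> k" for a using eq Rel_ratpairs[OF t t' ratpairs_const[OF t t' that]] by blast
  have "hom_on K \<tau>" unfolding hom_on_def
    using k[OF k.one_mem] eq[OF Rel_add[OF t t' rel rel]] eq[OF Rel_mult[OF t t' rel rel]] by auto
  moreover have "\<tau> ` K = K"
  proof
    show "K \<subseteq> \<tau> ` K"
    proof
      fix w assume "w \<in> K"
      \<comment> \<open>Surjectivity is existence with \<open>t\<close> and \<open>t'\<close>
        exchanged.\<close>
      then obtain z where z: "ratlim t t' z w" using Rel_exists[OF t' t, of w] Rel_sym by blast
      moreover have "z \<in> K" using z by (simp add: ratlim_def)
      ultimately show "w \<in> \<tau> ` K" using eq by blast
    qed
  qed (use K in auto)
  moreover have "V (\<tau> c) = V c" if c: "c \<in> K" "c \<noteq> 0" for c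
  proof -
    have "\<tau> c \<noteq> 0"
    proof
      assume "\<tau> c = 0"
      hence "ratlim t t' c 0" using rel[OF c(1)] by simp
      moreover have "ratlim t t' 0 0" using Rel_ratpairs[OF t t' ratpairs_const[OF t t' k.zero_mem]] .
      ultimately show False using Rel_unique'[OF t t'] c by blast
    qed
    thus ?thesis
      using Rel_M[OF t t' rel[OF c(1)], of "V c"] Rel_M[OF t t' rel[OF c(1)], of "V (\<tau> c)"] c by (simp add: M_def)
  qed
  moreover have "\<tau> t = t'" using eq Rel_ratpairs[OF t t' ratpairs_uniformizer[OF t t']] by blast
  ultimately show ?thesis using that k by blast
qed

end

section \<open>Amano polynomials\<close>

text \<open>
  In the notation of the theorem, \<open>n = (p - 1) b\<close>, written without subtraction as \<open>n + p = m p + l\<close>.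
  This is the \<open>V\<close>-value of the middle term \<open>\<omega> t\<^sup>m x\<^sup>l\<close>, and it is prime to \<open>p\<close>.
\<close>

locale amano = equichar_local_field V p K k for V :: "'s::field \<Rightarrow> real" and p K k +
  fixes n m l :: nat
  assumes n_eq: "n + p = m * p + l" and l_pos: "1 \<le> l" and l_less: "l < p" and m_pos: "1 \<le> m"
begin

definition amano_root :: "'s \<Rightarrow> 's \<Rightarrow> 's \<Rightarrow> bool" where
  "amano_root t \<omega> x \<longleftrightarrow> x ^ p = t + \<omega> * t ^ m * x ^ l"

definition acoef :: "'s \<Rightarrow> 's \<Rightarrow> nat \<Rightarrow> 's" where
  "acoef t \<omega> i = (if i = 0 then t else if i = l then \<omega> * t ^ m else 0)"

lemma n_eq_real: "real n + real p = real m * real p + real l"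
  using n_eq by (metis of_nat_add of_nat_mult)

lemma n_pos: "n > 0"
proof -
  have "p \<le> m * p" using m_pos by simp
  thus ?thesis using n_eq l_pos by linarith
qed

lemma l_nz: "(of_nat l :: 's) \<noteq> 0" and V_l: "V (of_nat l) = 0"
  using of_nat_nz[of l] V_of_nat[of l] l_pos l_less by auto

lemma acoef_sum: "(\<Sum>i<p. acoef t \<omega> i * x ^ i) = t + \<omega> * t ^ m * x ^ l"
proof -
  have "(\<Sum>i<p. acoef t \<omega> i * x ^ i) = (\<Sum>i\<in>{0,l}. acoef t \<omega> i * x ^ i)"
    by (rule sum.mono_neutral_right) (use l_less p_pos in \<open>auto simp: acoef_def\<close>)
  thus ?thesis using l_pos by (simp add: acoef_def)
qed

lemma acoef_eisenstein:
  assumes "prime_K t" "\<omega> \<in> k" shows "eisenstein (acoef t \<omega>)"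
proof -
  have "\<omega> * t ^ m \<in> M (0 + real m * real p)"
    using assms M_self[of t] by (intro M_mult M_power k_M0) (auto simp: prime_K_def)
  hence "\<omega> * t ^ m \<in> M (real p)"
    by (rule M_mono) (use m_pos mult_right_mono[of 1 "real m" "real p"] in auto)
  thus ?thesis using assms M_self[of t] k_K
    by (auto simp: eisenstein_def acoef_def prime_K_def intro!: K.mult_mem K.power_mem)
qed

lemma amano_root_acoef: "amano_root t \<omega> x \<longleftrightarrow> x ^ p = (\<Sum>i<p. acoef t \<omega> i * x ^ i)"
  by (simp add: amano_root_def acoef_sum)

lemma amano_root_props:
  assumes "prime_K t" "\<omega> \<in> k" "amano_root t \<omega> x" shows "x \<noteq> 0" "V x = 1" "tot_ram (field_adjoin K x)"
  using eisenstein_root[OF acoef_eisenstein[OF assms(1,2)]] tot_adjoin[OF acoef_eisenstein[OF assms(1,2)]]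
    assms(3) by (auto simp: amano_root_acoef)

lemma power_t: "prime_K t \<Longrightarrow> t ^ i \<noteq> 0 \<and> V (t ^ i) = real i * real p \<and> t ^ i \<in> K"
  by (auto simp: prime_K_def V_power K.power_mem)

text \<open>Subtracting the two equations cancels \<open>t\<close> and, by additivity of Frobenius,
  leaves \<open>(y - x)^p\<close> on the left; one factor \<open>y - x\<close> divides out.\<close>

lemma amano_root_conjugate_eq:
  assumes "prime_K t" "\<omega> \<in> k" "\<omega> \<noteq> 0" "amano_root t \<omega> x" "amano_root t \<omega> y" "x \<noteq> y"
  shows "(y - x) ^ (p - 1) = \<omega> * t ^ m * geo y x l"
proof -
  have "(y - x) ^ p = \<omega> * t ^ m * (y ^ l - x ^ l)"
    using assms(4,5) by (simp add: frob_diff amano_root_def right_diff_distrib)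
  hence "(y - x) ^ p = (y - x) * (\<omega> * t ^ m * geo y x l)"
    unfolding power_diff_geo by (simp only: ac_simps)
  moreover have "(y - x) ^ p = (y - x) * (y - x) ^ (p - 1)"
    using p_pos by (cases p) auto
  ultimately show ?thesis using assms(6) by simp
qed

text \<open>A bootstrap: the crude bound on \<open>geo y x l\<close> gives
  \<open>V (y - x) > 1\<close>, so \<open>y\<close> and \<open>x\<close> have the same leading term.
  Then \<open>geo_eqv\<close> gives the exact value of the right side of the conjugate
  equation.\<close>

lemma amano_root_conjugate_V:
  assumes "prime_K t" "\<omega> \<in> k" "\<omega> \<noteq> 0" "amano_root t \<omega> x" "amano_root t \<omega> y" "x \<noteq> y"
  shows "V (y - x) = 1 + real n / (real p - 1)" "y \<approx> x"
proof -
  note x = amano_root_props[OF assms(1,2,4)] and y = amano_root_props[OF assms(1,2,5)]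
  note eq = amano_root_conjugate_eq[OF assms]
  have z: "y - x \<noteq> 0" using assms by simp
  have p1: "real (p - 1) = real p - 1" "real p - 1 > 0" using p_ge_2 by (auto simp: of_nat_diff)
  have geo: "geo y x l \<in> M (real (l - 1))"
    using geo_M[of x 1 y l] x y by (simp add: M_def)
  have "\<omega> * t ^ m * geo y x l \<in> M (0 + real m * real p + real (l - 1))"
    using geo power_t[OF assms(1), of m] M_self[of "t ^ m"] by (intro M_mult k_M0 assms) auto
  hence "real m * real p + real (l - 1) \<le> V ((y - x) ^ (p - 1))"
    unfolding eq[symmetric] using z by (simp add: M_def)
  also have "V ((y - x) ^ (p - 1)) = (real p - 1) * V (y - x)" using z p1 by (simp add: V_power)
  finally have "real n + (real p - 1) \<le> (real p - 1) * V (y - x)"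
    using n_eq_real l_pos by (simp add: of_nat_diff)
  moreover have "(real p - 1) * 1 < real n + (real p - 1)" using n_pos by simp
  ultimately have "(real p - 1) * 1 < (real p - 1) * V (y - x)" by (rule less_le_trans[rotated])
  hence "1 < V (y - x)" using p1 by (simp only: mult_less_cancel_left_pos)
  thus *: "y \<approx> x" using x by (intro eqvI) (auto simp: Ms_def)
  have "geo y x l \<approx> of_nat l * x ^ (l - 1)" by (rule geo_eqv[OF * l_nz V_l])
  hence "geo y x l \<noteq> 0" "V (geo y x l) = real (l - 1)"
    using eqv_nz eqv_V[of "geo y x l"] x l_nz V_l by (auto simp: V_mult V_power)
  hence "V ((y - x) ^ (p - 1)) = real m * real p + real (l - 1)"
    unfolding eq using power_t[OF assms(1), of m] assms V_k by (simp add: V_mult)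
  hence "(real p - 1) * V (y - x) = real n + (real p - 1)"
    using z p1 n_eq_real l_pos by (simp add: V_power of_nat_diff)
  thus "V (y - x) = 1 + real n / (real p - 1)"
    using p1 by (simp add: field_simps)
qed

end

section \<open>Action of embeddings on prime elements, and completeness of the extension\<close>

context equichar_local_field
begin

lemma hom_fixes_eq:
  assumes "tot_ram L" "x \<in> L" "V x = 1" "x \<noteq> 0" "hom_on L \<sigma>" "\<And>c. c \<in> K \<Longrightarrow> \<sigma> c = c" "\<sigma> x = x" "z \<in> L"
  shows "\<sigma> z = z"
proof -
  interpret L: subfield_set L using assms tot_subfield by auto
  obtain c where c: "\<forall>i<p. c i \<in> K" "z = (\<Sum>i<p. c i * x ^ i)"
    using tot_span[OF assms(1-4)] assms(8) by (auto simp: span_pow_def)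
  show ?thesis unfolding c(2)
    using L.hom_lincomb[OF assms(5), of p c x] c assms(2,6,7) tot_K[OF assms(1)] by auto
qed

lemma hom_diff_expand:
  assumes "tot_ram L" "x \<in> L" "hom_on L \<sigma>" "\<And>c. c \<in> K \<Longrightarrow> \<sigma> c = c" "\<forall>i<p. c i \<in> K"
  shows "\<sigma> (\<Sum>i<p. c i * x ^ i) - (\<Sum>i<p. c i * x ^ i) = (\<sigma> x - x) * (\<Sum>i<p. c i * geo (\<sigma> x) x i)"
proof -
  interpret L: subfield_set L using assms tot_subfield by auto
  have "\<sigma> (\<Sum>i<p. c i * x ^ i) = (\<Sum>i<p. \<sigma> (c i) * \<sigma> x ^ i)"
    by (rule L.hom_lincomb[OF assms(3)]) (use assms tot_K in auto)
  also have "\<dots> = (\<Sum>i<p. c i * \<sigma> x ^ i)" using assms by (intro sum.cong) auto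
  finally have "\<sigma> (\<Sum>i<p. c i * x ^ i) - (\<Sum>i<p. c i * x ^ i) = (\<Sum>i<p. c i * (\<sigma> x ^ i - x ^ i))"
    by (simp add: sum_subtractf right_diff_distrib)
  also have "\<dots> = (\<sigma> x - x) * (\<Sum>i<p. c i * geo (\<sigma> x) x i)"
    by (simp add: power_diff_geo sum_distrib_left algebra_simps)
  finally show ?thesis .
qed

text \<open>Expand the prime element \<open>u\<close> in powers of \<open>x\<close>. Its value 1
  forces \<open>c_1\<close> to be a unit and all other terms to have larger value, so in
  \<open>\<sigma> u - u = (\<sigma> x - x) S\<close> the factor \<open>S\<close> has leading term
  \<open>c_1\<close>. This is the independence of the ramification number from the prime
  element.\<close>

lemma conjugate_V_indep:
  assumes L: "tot_ram L" "x \<in> L" "V x = 1" "x \<noteq> 0" "hom_on L \<sigma>" "\<And>c. c \<in> K \<Longrightarrow> \<sigma> c = c"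
    and eqv: "\<sigma> x \<approx> x" "\<sigma> x \<noteq> x" and u: "u \<in> L" "V u = 1" "u \<noteq> 0"
  shows "\<sigma> u \<noteq> u" "V (\<sigma> u - u) = V (\<sigma> x - x)"
proof -
  obtain c where c: "\<forall>i<p. c i \<in> K" "u = (\<Sum>i<p. c i * x ^ i)"
    using tot_span[OF L(1-4)] u by (auto simp: span_pow_def)
  have cM: "c i * x ^ i \<in> M 1" if "i < p" for i
    by (rule coeff_M[of x c]) (use c that u L M_self[of u] in auto)
  have other: "V (c i) + real i > 1" if i: "i < p" "i \<noteq> 1" "c i \<noteq> 0" for i
  proof -
    have "V (c i) + real i \<noteq> V 1 + real 1" using V_term_neq[of x "c i" 1 i 1] L c i p_ge_2 by auto
    moreover have "1 \<le> V (c i) + real i" using cM[OF i(1)] i L by (simp add: M_def V_mult V_power)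
    ultimately show ?thesis by simp
  qed
  have split: "(\<Sum>i<p. g i) = g 1 + (\<Sum>i\<in>{..<p} - {1}. g i)" for g :: "nat \<Rightarrow> 's"
    by (rule sum.remove) (use p_ge_2 in auto)
  have c1: "c 1 \<noteq> 0 \<and> V (c 1) = 0"
  proof (rule ccontr)
    assume *: "\<not> ?thesis"
    have "c i * x ^ i \<in> Ms 1" if "i < p" for i
    proof (cases "i = 1")
      case True
      show ?thesis unfolding True using * cM[of 1] L(3,4) p_ge_2
        by (cases "c 1 = 0") (auto simp: M_def Ms_def V_mult)
    next
      case False
      show ?thesis using other[OF that False] L by (cases "c i = 0") (auto simp: Ms_def V_mult V_power)
    qed
    hence "u \<in> Ms 1" unfolding c(2) by (intro Ms_sum) auto
    thus False using u by (simp add: Ms_def)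
  qed
  define S where "S = (\<Sum>i<p. c i * geo (\<sigma> x) x i)"
  have "S \<approx> c 1"
  proof -
    have "S = c 1 + (\<Sum>i\<in>{..<p} - {1}. c i * geo (\<sigma> x) x i)"
      unfolding S_def by (subst split) (simp add: geo_def)
    moreover have "(\<Sum>i\<in>{..<p} - {1}. c i * geo (\<sigma> x) x i) \<in> Ms (V (c 1))"
    proof (rule Ms_sum)
      fix i assume i: "i \<in> {..<p} - {1}"
      show "c i * geo (\<sigma> x) x i \<in> Ms (V (c 1))"
      proof (cases "c i = 0 \<or> i = 0")
        case True
        thus ?thesis by (auto simp: geo_def)
      next
        case False
        have "geo (\<sigma> x) x i \<in> M (real (i - 1) * 1)"
          by (rule geo_M) (use L eqv_V[OF eqv(1)] in \<open>auto simp: M_def\<close>)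
        hence "c i * geo (\<sigma> x) x i \<in> M (V (c i) + real (i - 1))" by (intro M_mult M_self) auto
        thus ?thesis by (rule M_Ms) (use other[of i] i False c1 in \<open>auto simp: of_nat_diff\<close>)
      qed
    qed
    ultimately show ?thesis using eqv_add[OF eqv_refl[of "c 1"]] c1 by auto
  qed
  hence S: "S \<noteq> 0" "V S = 0" using eqv_nz eqv_V[of S "c 1"] c1 by auto
  have "\<sigma> u - u = (\<sigma> x - x) * S"
    unfolding c(2) S_def by (rule hom_diff_expand) (use L c in auto)
  thus "\<sigma> u \<noteq> u" "V (\<sigma> u - u) = V (\<sigma> x - x)" using S eqv(2) by (auto simp: V_mult)
qed

text \<open>The divided differences have values \<open>i - 1\<close> for \<open>0 < i < p\<close>,
  so the terms \<open>c_i geo\<close> again have distinct values modulo \<open>p\<close>, and their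
  vanishing sum kills every \<open>c_i\<close> with \<open>i > 0\<close>. A single automorphism of
  this kind thus already has fixed field \<open>K\<close>.\<close>

lemma fixed_in_K:
  assumes L: "tot_ram L" "x \<in> L" "V x = 1" "x \<noteq> 0" "hom_on L \<sigma>" "\<And>c. c \<in> K \<Longrightarrow> \<sigma> c = c"
    and eqv: "\<sigma> x \<approx> x" "\<sigma> x \<noteq> x" and u: "u \<in> L" "\<sigma> u = u"
  shows "u \<in> K"
proof -
  obtain c where c: "\<forall>i<p. c i \<in> K" "u = (\<Sum>i<p. c i * x ^ i)"
    using tot_span[OF L(1-4)] u by (auto simp: span_pow_def)
  have "(\<sigma> x - x) * (\<Sum>i<p. c i * geo (\<sigma> x) x i) = 0"
    using hom_diff_expand[of L x \<sigma> c] L c u by auto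
  hence sum0: "(\<Sum>i<p. c i * geo (\<sigma> x) x i) = 0" using eqv by simp
  have geoV: "geo (\<sigma> x) x i \<noteq> 0 \<and> V (geo (\<sigma> x) x i) = real i - 1" if "0 < i" "i < p" for i
  proof -
    have "geo (\<sigma> x) x i \<approx> of_nat i * x ^ (i - 1)"
      by (rule geo_eqv[OF eqv(1)]) (use that of_nat_nz V_of_nat in auto)
    thus ?thesis using eqv_nz(1) eqv_V[of "geo (\<sigma> x) x i"] L of_nat_nz[OF that] V_of_nat[OF that] that
      by (auto simp: V_mult V_power of_nat_diff)
  qed
  have ci: "c i = 0" if i: "0 < i" "i < p" for i
  proof -
    have "c i * geo (\<sigma> x) x i = 0"
    proof (rule sum_distinct_V_zero[of "{..<p}" "\<lambda>i. c i * geo (\<sigma> x) x i"])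
      fix i j assume ij: "i \<in> {..<p}" "j \<in> {..<p}" "i \<noteq> j"
        "c i * geo (\<sigma> x) x i \<noteq> 0" "c j * geo (\<sigma> x) x j \<noteq> 0"
      have "0 < i" "0 < j" using ij by (auto simp: geo_def intro!: Nat.gr0I)
      thus "V (c i * geo (\<sigma> x) x i) \<noteq> V (c j * geo (\<sigma> x) x j)"
        using V_term_neq[of x "c i" "c j" i j] ij geoV[of i] geoV[of j] L c by (auto simp: V_mult)
    qed (use i sum0 in auto)
    thus ?thesis using geoV[OF i] by simp
  qed
  have "u = (\<Sum>i\<in>{0}. c i * x ^ i)"
    unfolding c(2) by (rule sum.mono_neutral_right) (use p_pos ci in auto)
  thus ?thesis using c p_pos by simp
qed

text \<open>The coordinates with respect to the powers of a prime element converge separately in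
  \<open>K\<close>.\<close>

lemma tot_complete:
  assumes L: "tot_ram L" and f: "\<And>i. f i \<in> L" "\<And>i. f (Suc i) - f i \<in> M (real i)"
  shows "\<exists>x\<in>L. \<forall>i. f i - x \<in> M (real i)"
proof -
  obtain u where u: "u \<in> L" "V u = 1" "u \<noteq> 0" using tot_prime_exists[OF L] .
  have "\<exists>c. (\<forall>j<p. c j \<in> K) \<and> f i = (\<Sum>j<p. c j * u ^ j)" for i
    using f(1)[of i] tot_span[OF L u] unfolding span_pow_def by blast
  then obtain c where c: "\<And>i j. j < p \<Longrightarrow> c i j \<in> K" "\<And>i. f i = (\<Sum>j<p. c i j * u ^ j)" by metis
  \<comment> \<open>Passing from \<open>c u^j\<close> to \<open>c\<close> loses \<open>j < p\<close>
    units of precision; starting the sequence at index \<open>p\<close> makes up for it.\<close>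
  have "\<exists>d\<in>K. \<forall>i. c (i + p) j - d \<in> M (real i)" if j: "j < p" for j
  proof (rule complete_K)
    fix i
    show "c (i + p) j \<in> K" using c j by auto
    have "(\<Sum>j<p. (c (Suc i + p) j - c (i + p) j) * u ^ j) \<in> M (real (i + p))"
      using f(2)[of "i + p"] by (simp add: c(2) left_diff_distrib sum_subtractf)
    hence "(c (Suc i + p) j - c (i + p) j) * u ^ j \<in> M (real (i + p))"
      by (intro coeff_M[of u "\<lambda>j. c (Suc i + p) j - c (i + p) j"]) (use u c j in \<open>auto intro: K.diff_mem\<close>)
    hence "c (Suc i + p) j - c (i + p) j \<in> M (real (i + p) - real j)"
      using u by (subst (asm) mult.commute, subst (asm) M_mult_iff) (auto simp: V_power)
    thus "c (Suc i + p) j - c (i + p) j \<in> M (real i)" by (rule M_mono) (use j in auto)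
  qed
  then obtain d where d: "\<And>j. j < p \<Longrightarrow> d j \<in> K" "\<And>j i. j < p \<Longrightarrow> c (i + p) j - d j \<in> M (real i)" by metis
  define x where "x = (\<Sum>j<p. d j * u ^ j)"
  have "f i - x \<in> M (real i)" for i
  proof -
    have "f (i + p) - x = (\<Sum>j<p. (c (i + p) j - d j) * u ^ j)"
      by (simp add: c(2) x_def left_diff_distrib sum_subtractf)
    also have "\<dots> \<in> M (real i)"
    proof (rule M_sum)
      fix j assume "j \<in> {..<p}"
      hence "(c (i + p) j - d j) * u ^ j \<in> M (real i + real j * 1)"
        using u by (intro M_mult d M_power) (auto simp: M_def)
      thus "(c (i + p) j - d j) * u ^ j \<in> M (real i)" by (rule M_mono) auto
    qed
    finally have "f (i + p) - x \<in> M (real i)" .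
    from M_trans[OF _ this, of "f i"] show ?thesis
      using M_telescope[OF f(2), of i p] by (simp add: M_diff_commute)
  qed
  moreover have "x \<in> L" unfolding tot_span[OF L u] x_def span_pow_def using d by auto
  ultimately show ?thesis by blast
qed

end

context equichar_local_field
begin

lemma tot_conjugate_hom:
  assumes "tot_ram L" "x \<in> L" "eisenstein a" "x ^ p = (\<Sum>i<p. a i * x ^ i)" "y ^ p = (\<Sum>i<p. a i * y ^ i)"
  obtains \<sigma> where "hom_on L \<sigma>" "\<forall>c\<in>K. \<sigma> c = c" "\<sigma> x = y" "\<sigma> ` L = field_adjoin K y"
proof -
  have L: "field_adjoin K x = L" using tot_adjoin_eq assms eisenstein_root by blast
  have "hom_on K (\<lambda>c. c)" by (simp add: hom_on_def)
  from hom_extend[OF this _ _ assms(3,4), of y] assms(5) obtain \<sigma> where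
    "hom_on (field_adjoin K x) \<sigma>" "\<forall>c\<in>K. \<sigma> c = c" "\<sigma> x = y" "\<sigma> ` field_adjoin K x = field_adjoin K y"
    by auto
  thus ?thesis using that unfolding L by blast
qed

end

section \<open>From the break to an exact Amano equation\<close>

context amano
begin

text \<open>
  The break gives the valuation of \<open>f'(x)\<close>, a product of differences of conjugates. The terms of
  \<open>f'(x) = - (\<Sum>i<p. i a\<^sub>i x\<^bsup>i-1\<^esup>)\<close> have distinct valuations, so this value forces \<open>V (a\<^sub>l x\<^sup>l) = n + p\<close> and
  \<open>V (a\<^sub>i x\<^sup>i) > n + p\<close> for the other \<open>i > 0\<close>.
\<close>

lemma break_approx:
  assumes L: "tot_ram L" "x \<in> L" "V x = 1" "x \<noteq> 0"
    and br: "\<forall>\<sigma>. hom_on L \<sigma> \<and> (\<forall>c\<in>K. \<sigma> c = c) \<and> \<sigma> x \<noteq> x \<longrightarrow>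
      V (\<sigma> x - x) = 1 + real n / (real p - 1)"
  obtains t \<omega> where "prime_K t" "\<omega> \<in> k" "\<omega> \<noteq> 0" "x ^ p - t - \<omega> * t ^ m * x ^ l \<in> M (real (n + p) + 1)"
proof -
  interpret L: subfield_set L using L tot_subfield by auto
  obtain a where eis: "eisenstein a" and xp: "x ^ p = (\<Sum>i<p. a i * x ^ i)"
    using tot_min_poly[OF L] .
  have aK: "a i \<in> K" if "i < p" for i using eis that by (simp add: eisenstein_def)
  have root: "poly (minp a) x = 0" using xp by (simp add: poly_minp)
  obtain Y where Y: "finite Y" "card Y = p - 1" "x \<notin> Y" "\<forall>y\<in>Y. poly (minp a) y = 0"
    "poly (pderiv (minp a)) x = (\<Prod>y\<in>Y. x - y)" using minp_conjugates[OF eis root] .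
  have Vy: "V (x - y) = 1 + real n / (real p - 1)" if y: "y \<in> Y" for y
  proof -
    have "y ^ p = (\<Sum>i<p. a i * y ^ i)" using Y(4) y by (simp add: poly_minp)
    from tot_conjugate_hom[OF L(1,2) eis xp this] obtain \<sigma> where
      "hom_on L \<sigma>" "\<forall>c\<in>K. \<sigma> c = c" "\<sigma> x = y" .
    moreover have "y \<noteq> x" using y Y(3) by blast
    ultimately show ?thesis using br V_minus_commute[of x y] by metis
  qed
  have p1: "real (p - 1) = real p - 1" "real p - 1 > 0" using p_ge_2 by (auto simp: of_nat_diff)
  have nz: "poly (pderiv (minp a)) x \<noteq> 0" using Y by auto
  have "V (poly (pderiv (minp a)) x) = (\<Sum>y\<in>Y. V (x - y))"
    unfolding Y(5) by (rule V_prod) (use Y(3) in auto)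
  also have "\<dots> = (real p - 1) * (1 + real n / (real p - 1))" using Vy Y(2) p1 by simp
  also have "\<dots> = real p - 1 + real n" using p1 by (simp add: field_simps)
  finally have Vd: "V (poly (pderiv (minp a)) x) = real p - 1 + real n" .
  \<comment> \<open>The factor \<open>x\<close> turns the derivative into a combination of the
    powers \<open>x^i\<close> themselves, so that \<open>coeff_M\<close> applies, and raises its
    value to \<open>n + p\<close>.\<close>
  define S where "S = (\<Sum>i<p. (of_nat i * a i) * x ^ i)"
  have "x * (\<Sum>i<p. of_nat i * a i * x ^ (i - 1)) = S"
    unfolding S_def sum_distrib_left
  proof (rule sum.cong[OF refl])
    fix i show "x * (of_nat i * a i * x ^ (i - 1)) = of_nat i * a i * x ^ i" by (cases i) auto
  qed
  hence "S = - (x * poly (pderiv (minp a)) x)" by (simp add: poly_pderiv_minp)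
  hence S: "S \<noteq> 0" "V S = real (n + p)" using nz Vd L by (auto simp: V_mult)
  have SM: "of_nat i * a i * x ^ i \<in> M (real (n + p))" if "i < p" for i
    by (rule coeff_M[of x "\<lambda>i. of_nat i * a i"])
       (use L aK that S M_self[of S] in \<open>auto simp: S_def intro: K.mult_mem K.of_nat_mem\<close>)
  have aM: "a i * x ^ i \<in> M (real (n + p))" if "0 < i" "i < p" for i
    using SM[OF that(2)] of_nat_nz[OF that] V_of_nat[OF that] M_mult_iff[of "of_nat i" "a i * x ^ i"]
    by (simp add: mult.assoc)
  have axL: "a i * x ^ i \<in> L" if "i < p" for i
    using aK[OF that] L tot_K[OF L(1)] by (intro L.mult_mem L.power_mem) auto
  \<comment> \<open>\<open>n + p\<close> is congruent to \<open>l\<close> modulo \<open>p\<close>,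
    whereas \<open>V c + i\<close> is congruent to \<open>i\<close>.\<close>
  have npl: "V c + real i \<noteq> real (n + p)" if c: "c \<in> K" "c \<noteq> 0" "i < p" "i \<noteq> l" for c i
  proof
    assume eq: "V c + real i = real (n + p)"
    obtain j :: int where "V c = real p * of_int j" using V_K c by blast
    hence "real_of_int (int p * j + int i) = real_of_int (int m * int p + int l)" using eq n_eq_real by simp
    hence *: "int p * j + int i = int m * int p + int l" by (simp only: of_int_eq_iff)
    have "int i = (int p * j + int i) mod int p" using that by simp
    also have "\<dots> = int l" unfolding * using l_less by simp
    finally show False using that by simp
  qed
  have aM': "a i * x ^ i \<in> M (real (n + p) + 1)" if "0 < i" "i < p" "i \<noteq> l" for i
  proof -
    have "a i * x ^ i \<in> Ms (of_int (int (n + p)))"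
      using aM[OF that(1,2)] npl[OF aK[OF that(2)] _ that(2,3)] L
      by (cases "a i = 0") (auto simp: M_def Ms_def V_mult V_power)
    from tot_Ms_M[OF L(1) axL[OF that(2)] this] show ?thesis by simp
  qed
  \<comment> \<open>Otherwise every term of \<open>S\<close>, hence \<open>S\<close>, would have
    value above \<open>n + p\<close>.\<close>
  have al: "a l \<noteq> 0 \<and> V (a l) = real m * real p"
  proof (rule ccontr)
    assume *: "\<not> ?thesis"
    have "of_nat i * a i * x ^ i \<in> Ms (real (n + p))" if i: "i < p" for i
    proof (cases "i = 0 \<or> of_nat i * a i = 0")
      case False
      have "of_nat i * (a i * x ^ i) \<in> Ms (0 + real (n + p))"
      proof (rule M_Ms_mult)
        show "a i * x ^ i \<in> Ms (real (n + p))"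
        proof (cases "i = l")
          case True
          show ?thesis using aM[of l] l_pos l_less * L n_eq_real unfolding True
            by (cases "a l = 0") (auto simp: M_def Ms_def V_mult V_power)
        next
          case F: False
          show ?thesis by (rule M_Ms[OF aM']) (use i False F in auto)
        qed
      qed (use False V_of_nat[of i] i in \<open>auto simp: M_def\<close>)
      thus ?thesis by (simp add: mult.assoc)
    qed auto
    hence "S \<in> Ms (real (n + p))" unfolding S_def by (intro Ms_sum) auto
    thus False using S by (simp add: Ms_def)
  qed
  have t: "prime_K (a 0)" using eis p_pos by (simp add: prime_K_def eisenstein_def)
  define t where "t = a 0"
  have t: "prime_K t" using t by (simp add: t_def)
  note tm = power_t[OF t, of m]
  have alK: "a l / t ^ m \<in> K" using aK[of l] l_less tm by (auto intro: K.divide_mem)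
  have V0: "a l / t ^ m \<noteq> 0" "V (a l / t ^ m) = 0" using al tm by (auto simp: V_divide)
  then obtain \<omega> where \<omega>: "\<omega> \<in> k" "a l / t ^ m - \<omega> \<in> Ms 0" using residue_K[OF alK] by (auto simp: M_def)
  have "\<omega> \<noteq> 0" using \<omega> V0 by (auto simp: Ms_def)
  have d: "a l / t ^ m - \<omega> \<in> M (real p)" by (rule K_pos_M) (use \<omega> alK k_K in \<open>auto intro: K.diff_mem\<close>)
  have "a l * x ^ l - \<omega> * t ^ m * x ^ l = (a l / t ^ m - \<omega>) * t ^ m * x ^ l"
    using tm by (simp add: left_diff_distrib)
  also have "\<dots> \<in> M (real p + real m * real p + real l * 1)"
    using d t L by (intro M_mult M_power) (auto simp: M_def prime_K_def)
  finally have d2: "a l * x ^ l - \<omega> * t ^ m * x ^ l \<in> M (real (n + p) + 1)"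
    by (rule M_mono) (use n_eq_real p_ge_2 in simp)
  have "x ^ p = t + (\<Sum>i\<in>{1..<p}. a i * x ^ i)"
    unfolding xp t_def using p_pos by (simp add: lessThan_atLeast0 sum.atLeast_Suc_lessThan)
  also have "(\<Sum>i\<in>{1..<p}. a i * x ^ i) = a l * x ^ l + (\<Sum>i\<in>{1..<p} - {l}. a i * x ^ i)"
    by (rule sum.remove) (use l_pos l_less in auto)
  finally have "x ^ p - t - \<omega> * t ^ m * x ^ l = (a l * x ^ l - \<omega> * t ^ m * x ^ l) + (\<Sum>i\<in>{1..<p} - {l}. a i * x ^ i)"
    by simp
  also have "\<dots> \<in> M (real (n + p) + 1)" by (intro M_add d2 M_sum aM') auto
  finally show ?thesis using that t \<omega> \<open>\<omega> \<noteq> 0\<close> by blast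
qed

definition err :: "'s \<Rightarrow> 's \<Rightarrow> 's \<Rightarrow> 's" where
  "err \<omega> t x = x ^ p - t - \<omega> * t ^ m * x ^ l"

lemma amano_root_err: "amano_root t \<omega> x \<longleftrightarrow> err \<omega> t x = 0"
  by (auto simp: amano_root_def err_def algebra_simps)

text \<open>Continuity of the error, for passing to the limit in
  \<open>approx_exact\<close>.\<close>

lemma err_cong:
  assumes "\<omega> \<in> k" "t \<in> M 0" "t' \<in> M 0" "x \<in> M 0" "x' \<in> M 0" "t - t' \<in> M r" "x - x' \<in> M r"
  shows "err \<omega> t x - err \<omega> t' x' \<in> M r"
proof -
  have "t' ^ m \<in> M (real m * 0)" "x ^ l \<in> M (real l * 0)" using assms by (intro M_power; simp)+
  hence "t ^ m * x ^ l - t' ^ m * x' ^ l \<in> M r"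
    using assms by (intro mult_diff_M power_diff_M) auto
  hence "\<omega> * (t ^ m * x ^ l - t' ^ m * x' ^ l) \<in> M (0 + r)" using assms by (intro M_mult k_M0)
  hence "(x ^ p - x' ^ p) - (t - t') - \<omega> * (t ^ m * x ^ l - t' ^ m * x' ^ l) \<in> M r"
    using M_diff[OF M_diff[OF power_diff_M[of x' x r p] assms(6)]] assms by simp
  thus ?thesis by (simp add: err_def algebra_simps)
qed

lemma power_diff_t:
  assumes "t \<in> M (real p)" "u \<in> M (real p)" "u - t \<in> M r"
  shows "u ^ i - t ^ i \<in> M (r + real (i - 1) * real p)"
  unfolding power_diff_geo using assms by (intro M_mult geo_M)

text \<open>
  Replacing \<open>(t, x)\<close> by \<open>(t + \<epsilon>\<^sup>p t\<^bsup>j+1\<^esup>, x + \<epsilon> x\<^bsup>j+1\<^esup>)\<close> leaves \<open>x\<^sup>p - t\<close> unchanged up to high order, while the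
  middle term changes by \<open>l \<omega> \<epsilon> x\<^bsup>n+p+j\<^esup>\<close> to first order; since \<open>l\<close> is a unit, \<open>\<epsilon>\<close> can be chosen to
  cancel the leading term of the error.
\<close>

lemma approx_step:
  assumes L: "tot_ram L" "x \<in> L" "V x = 1" "x \<noteq> 0" and t: "prime_K t" and \<omega>: "\<omega> \<in> k" "\<omega> \<noteq> 0"
    and e: "err \<omega> t x \<in> M (real (n + p + j))" and j: "j \<ge> 1"
  shows "\<exists>t' x'. prime_K t' \<and> x' \<in> L \<and> V x' = 1 \<and> x' \<noteq> 0 \<and> t' - t \<in> M (real (j + 1)) \<and>
    x' - x \<in> M (real (j + 1)) \<and> err \<omega> t' x' \<in> M (real (n + p + j) + 1)"
proof -
  interpret L: subfield_set L using L tot_subfield by auto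
  have KL: "c \<in> K \<Longrightarrow> c \<in> L" for c using tot_K[OF L(1)] by auto
  have kL: "c \<in> k \<Longrightarrow> c \<in> L" for c using KL k_K by auto
  have tK: "t \<in> K" "t \<in> L" using t KL by (auto simp: prime_K_def)
  have errL: "err \<omega> t x \<in> L" unfolding err_def using L tK kL \<omega> by (intro L.diff_mem L.mult_mem L.power_mem)
  define N where "N = n + p + j"
  obtain a where a: "a \<in> k" "err \<omega> t x - a * x ^ N \<in> M (real N + 1)"
    using tot_lead_nat[OF L(1) errL _ L(2-4)] e unfolding N_def by blast
  show ?thesis
  proof (cases "a = 0")
    case True
    thus ?thesis using a L t by (intro exI[of _ t] exI[of _ x]) (simp add: N_def)
  next
    case False
    \<comment> \<open>Chosen so that the first-order change \<open>l \<omega> \<epsilon> x^N\<close>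
      of the middle term equals the leading term \<open>a x^N\<close> of the error.\<close>
    define \<epsilon> where "\<epsilon> = a / (\<omega> * of_nat l)"
    have \<epsilon>: "\<epsilon> \<in> k" "\<epsilon> \<noteq> 0" "V \<epsilon> = 0"
      using a \<omega> False l_nz V_k[of \<epsilon>] of_nat_k by (auto simp: \<epsilon>_def intro!: k.divide_mem k.mult_mem)
    have a_eq: "a = \<omega> * \<epsilon> * of_nat l" using \<omega> l_nz by (simp add: \<epsilon>_def)
    define x' where "x' = x + \<epsilon> * x ^ (j + 1)"
    define t' where "t' = t + \<epsilon> ^ p * t ^ (j + 1)"
    have ep: "\<epsilon> ^ p \<in> k" "\<epsilon> ^ p \<noteq> 0" "V (\<epsilon> ^ p) = 0" using \<epsilon> by (auto simp: k.power_mem V_power)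
    \<comment> \<open>The errors \<open>A\<close> and \<open>B\<close> have order
      \<open>n + p + j p\<close> and must exceed \<open>N = n + p + j\<close>. This is where
      \<open>j >= 1\<close> enters.\<close>
    have jp: "real j + 1 \<le> real j * real p"
    proof -
      have "real j * 2 \<le> real j * real p" using p_ge_2 by (intro mult_left_mono) auto
      thus ?thesis using j by linarith
    qed
    have dx: "x' - x \<in> M (real (j + 1))" using L \<epsilon> by (simp add: x'_def M_def V_mult V_power)
    have dt: "t' - t \<in> M (real p * (real j + 1))" using t ep by (simp add: t'_def M_def V_mult V_power prime_K_def algebra_simps)
    have x'x: "x' \<approx> x" by (rule eqvI) (use L dx j in \<open>auto intro: M_Ms\<close>)
    have t't: "t' \<approx> t"
    proof (rule eqvI)
      have "real p * 1 < real p * (real j + 1)" using p_pos j by (intro mult_strict_left_mono) auto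
      thus "t' - t \<in> Ms (V t)" using dt t by (auto simp: prime_K_def intro: M_Ms)
    qed (use t in \<open>auto simp: prime_K_def\<close>)
    have x': "x' \<in> L" "V x' = 1" "x' \<noteq> 0"
      using L \<epsilon> kL eqv_V[OF x'x] eqv_nz[OF x'x] by (auto simp: x'_def intro!: L.add_mem L.mult_mem L.power_mem)
    have t'K: "t' \<in> K" unfolding t'_def using tK \<epsilon> k_K by (intro K.add_mem K.mult_mem K.power_mem) auto
    have t': "prime_K t'" using t'K eqv_V[OF t't] eqv_nz[OF t't] t by (auto simp: prime_K_def)
    have tMp: "t \<in> M (real p)" "t' \<in> M (real p)" using t t' by (auto simp: prime_K_def M_def)
    have xpMp: "x ^ p \<in> M (real p)" using L by (simp add: M_def V_power)
    have xpt: "x ^ p - t \<in> M (real (n + p))"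
    proof -
      have "\<omega> * t ^ m * x ^ l \<in> M (0 + real m * real p + real l * 1)"
        using k_M0[OF \<omega>(1)] tMp(1) L by (intro M_mult M_power) (auto simp: M_def)
      hence "err \<omega> t x + \<omega> * t ^ m * x ^ l \<in> M (real (n + p))"
        using e n_eq_real by (intro M_add) (auto elim!: M_mono)
      thus ?thesis by (simp add: err_def)
    qed
    have "x ^ p \<approx> t" by (rule eqvI) (use t xpt n_pos in \<open>auto simp: prime_K_def intro: M_Ms\<close>)
    hence t'xp: "t' \<approx> x ^ p" using t't eqv_sym eqv_trans by blast
    \<comment> \<open>\<open>A\<close> is the mismatch between the changes of \<open>x^p\<close> and
      of \<open>t\<close>; \<open>B\<close> and \<open>C\<close> are the changes of the middle term
      due to \<open>t\<close> and to \<open>x\<close>. Only \<open>C\<close> reaches order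
      \<open>N\<close>.\<close>
    define A where "A = \<epsilon> ^ p * ((x ^ p) ^ (j + 1) - t ^ (j + 1))"
    define B where "B = \<omega> * (t' ^ m - t ^ m) * x ^ l"
    define C where "C = \<omega> * t' ^ m * (x' ^ l - x ^ l)"
    have err': "err \<omega> t' x' = (err \<omega> t x - a * x ^ N) + A - B - (C - a * x ^ N)"
    proof -
      have "x' ^ p = x ^ p + \<epsilon> ^ p * (x ^ p) ^ (j + 1)"
        by (simp only: x'_def frob_add power_mult_distrib power_mult[symmetric] mult.commute)
      thus ?thesis by (simp add: err_def A_def B_def C_def t'_def algebra_simps)
    qed
    have A: "A \<in> M (real N + 1)"
    proof -
      have "(x ^ p) ^ (j + 1) - t ^ (j + 1) \<in> M (real (n + p) + real (j + 1 - 1) * real p)"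
        by (rule power_diff_t[OF tMp(1) xpMp xpt])
      hence "A \<in> M (0 + (real (n + p) + real (j + 1 - 1) * real p))"
        unfolding A_def using ep(1) by (intro M_mult k_M0)
      thus ?thesis by (rule M_mono) (use jp in \<open>simp add: N_def\<close>)
    qed
    have B: "B \<in> M (real N + 1)"
    proof -
      have "t' ^ m - t ^ m \<in> M (real p * (real j + 1) + real (m - 1) * real p)"
        by (rule power_diff_t[OF tMp dt])
      hence "B \<in> M (0 + (real p * (real j + 1) + real (m - 1) * real p) + real l * 1)"
        unfolding B_def using \<omega>(1) L by (intro M_mult k_M0 M_power) (auto simp: M_def)
      moreover have "real N + 1 \<le> 0 + (real p * (real j + 1) + real (m - 1) * real p) + real l * 1"
        using jp n_eq_real m_pos by (simp add: N_def of_nat_diff algebra_simps)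
      ultimately show ?thesis by (rule M_mono)
    qed
    have C: "C - a * x ^ N \<in> M (real N + 1)"
    proof -
      have "geo x' x l \<approx> of_nat l * x ^ (l - 1)" by (rule geo_eqv[OF x'x l_nz V_l])
      hence "\<omega> * t' ^ m * (\<epsilon> * x ^ (j + 1) * geo x' x l) \<approx> \<omega> * (x ^ p) ^ m * (\<epsilon> * x ^ (j + 1) * (of_nat l * x ^ (l - 1)))"
        using \<omega> \<epsilon> L t'xp by (intro eqv_mult eqv_power eqv_refl) auto
      also have "\<omega> * t' ^ m * (\<epsilon> * x ^ (j + 1) * geo x' x l) = C"
        unfolding C_def power_diff_geo by (simp add: x'_def)
      also have "\<omega> * (x ^ p) ^ m * (\<epsilon> * x ^ (j + 1) * (of_nat l * x ^ (l - 1))) =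
          a * (x ^ (p * m) * x ^ (j + 1) * x ^ (l - 1))"
        unfolding a_eq power_mult[of x p m] by (simp only: ac_simps)
      also have "x ^ (p * m) * x ^ (j + 1) * x ^ (l - 1) = x ^ N"
        unfolding power_add[symmetric] N_def
        by (rule arg_cong[of _ _ "\<lambda>i. x ^ i"]) (use n_eq l_pos in \<open>simp add: mult.commute\<close>)
      finally have "C - a * x ^ N \<in> Ms (V (a * x ^ N))" by (simp add: eqv_iff)
      hence "C - a * x ^ N \<in> Ms (of_int (int N))" using a False L V_k by (simp add: V_mult V_power)
      moreover have "C - a * x ^ N \<in> L" unfolding C_def
        using L x' kL \<omega> a KL[OF t'K] by (intro L.diff_mem L.mult_mem L.power_mem)
      ultimately show ?thesis using tot_Ms_M[OF L(1), of "C - a * x ^ N" "int N"] by simp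
    qed
    have "err \<omega> t' x' \<in> M (real N + 1)" unfolding err' by (rule M_diff[OF M_diff[OF M_add[OF a(2) A] B] C])
    moreover have "t' - t \<in> M (real (j + 1))"
    proof (rule M_mono[OF dt])
      have "1 * (real j + 1) \<le> real p * (real j + 1)" using p_ge_2 by (intro mult_right_mono) auto
      thus "real (j + 1) \<le> real p * (real j + 1)" by (simp only: of_nat_add of_nat_1 mult_1)
    qed
    ultimately show ?thesis using t' x' dx unfolding N_def by blast
  qed
qed

lemma approx_exact:
  assumes L: "tot_ram L" "x0 \<in> L" "V x0 = 1" "x0 \<noteq> 0" and t0: "prime_K t0" and \<omega>: "\<omega> \<in> k" "\<omega> \<noteq> 0"
    and e: "err \<omega> t0 x0 \<in> M (real (n + p) + 1)"
  obtains t x where "prime_K t" "x \<in> L" "V x = 1" "x \<noteq> 0" "amano_root t \<omega> x"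
proof -
  \<comment> \<open>The offset \<open>i + 1\<close> meets the condition \<open>j >= 1\<close> of
    \<open>approx_step\<close>; the initial approximation has exactly this order.\<close>
  define P where "P i s \<longleftrightarrow> prime_K (fst s) \<and> snd s \<in> L \<and> V (snd s) = 1 \<and> snd s \<noteq> 0 \<and>
    err \<omega> (fst s) (snd s) \<in> M (real (n + p + (i + 1)))" for i :: nat and s :: "'s \<times> 's"
  define Q where "Q i s s' \<longleftrightarrow> fst s' - fst s \<in> M (real (i + 2)) \<and> snd s' - snd s \<in> M (real (i + 2))"
    for i :: nat and s s' :: "'s \<times> 's"
  have "\<exists>f. \<forall>i. P i (f i) \<and> Q i (f i) (f (Suc i))"
  proof (rule dependent_nat_choice)
    show "\<exists>s. P 0 s" using L t0 e by (intro exI[of _ "(t0, x0)"]) (simp add: P_def add_ac)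
  next
    fix s i assume "P i s"
    then obtain t' x' where "prime_K t' \<and> x' \<in> L \<and> V x' = 1 \<and> x' \<noteq> 0 \<and> t' - fst s \<in> M (real ((i + 1) + 1)) \<and>
      x' - snd s \<in> M (real ((i + 1) + 1)) \<and> err \<omega> t' x' \<in> M (real (n + p + (i + 1)) + 1)"
      using approx_step[OF L(1), of "snd s" "fst s" \<omega> "i + 1"] \<omega> unfolding P_def by auto
    thus "\<exists>s'. P (Suc i) s' \<and> Q i s s'"
      by (intro exI[of _ "(t', x')"]) (simp add: P_def Q_def add_ac)
  qed
  then obtain f where f: "\<And>i. P i (f i)" "\<And>i. Q i (f i) (f (Suc i))" by blast
  have ft: "fst (f (Suc i)) - fst (f i) \<in> M (real i)" "snd (f (Suc i)) - snd (f i) \<in> M (real i)" for i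
    using f(2)[of i] unfolding Q_def by (auto elim!: M_mono)
  obtain t where t: "t \<in> K" "\<forall>i. fst (f i) - t \<in> M (real i)"
    using complete_K[of "\<lambda>i. fst (f i)"] f(1) ft(1) unfolding P_def prime_K_def by blast
  obtain x where x: "x \<in> L" "\<forall>i. snd (f i) - x \<in> M (real i)"
    using tot_complete[OF L(1), of "\<lambda>i. snd (f i)"] f(1) ft(2) unfolding P_def by blast
  \<comment> \<open>Agreement to order \<open>p + 1\<close>, beyond the value \<open>p\<close> of a
    prime element of \<open>K\<close>, keeps the limit prime. For \<open>x\<close>, of value 1,
    index 2 is far enough.\<close>
  have "t \<approx> fst (f (p + 1))"
    by (rule eqvI) (use t(2)[rule_format, of "p + 1"] f(1)[of "p + 1"] in
      \<open>auto simp: P_def prime_K_def M_diff_commute intro: M_Ms\<close>)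
  hence tp: "prime_K t" using eqv_nz eqv_V f(1)[of "p + 1"] t(1) unfolding P_def prime_K_def by metis
  have "x \<approx> snd (f 2)"
    by (rule eqvI) (use x(2)[rule_format, of 2] f(1)[of 2] in
      \<open>auto simp: P_def M_diff_commute intro: M_Ms\<close>)
  hence xp: "V x = 1" "x \<noteq> 0" using eqv_nz eqv_V f(1)[of 2] unfolding P_def by metis+
  have "err \<omega> t x \<in> M (real i)" for i
  proof -
    have "err \<omega> (fst (f i)) (snd (f i)) - err \<omega> t x \<in> M (real i)"
      by (rule err_cong) (use \<omega> t x tp xp f(1)[of i] in \<open>auto simp: P_def prime_K_def M_def\<close>)
    moreover have "err \<omega> (fst (f i)) (snd (f i)) \<in> M (real i)"
      using f(1)[of i] unfolding P_def by (auto elim!: M_mono)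
    ultimately have "err \<omega> (fst (f i)) (snd (f i)) - (err \<omega> (fst (f i)) (snd (f i)) - err \<omega> t x) \<in> M (real i)"
      by (rule M_diff[rotated])
    thus ?thesis by simp
  qed
  hence "err \<omega> t x = 0" by (rule M_all_zero)
  thus ?thesis using that tp x xp amano_root_err by blast
qed

end

section \<open>Invariance of the coefficient, and conjugates inside the extension\<close>

context amano
begin

lemma amano_root_approx_t:
  assumes "prime_K t" "\<omega> \<in> k" "amano_root t \<omega> x" "V x = 1" "x \<noteq> 0"
  shows "x ^ p - t \<in> M (real (n + p))" "x ^ p \<approx> t"
proof -
  have "\<omega> * t ^ m * x ^ l \<in> M (0 + real m * real p + real l * 1)"
    using k_M0[OF assms(2)] assms by (intro M_mult M_power) (auto simp: M_def prime_K_def)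
  thus *: "x ^ p - t \<in> M (real (n + p))"
    using assms(3) n_eq_real by (simp add: amano_root_def)
  show "x ^ p \<approx> t" by (rule eqvI) (use assms * n_pos in \<open>auto simp: prime_K_def intro: M_Ms\<close>)
qed

text \<open>
  With \<open>y = c x + r\<close>, the power \<open>r\<^sup>p\<close> lies in \<open>K\<close> up to \<open>M (n + p + 1)\<close>. So the difference \<open>D\<close> of the two
  middle terms is congruent to an element of \<open>K\<close>, whose value is a multiple of \<open>p\<close> and hence not
  \<open>n + p\<close>. Comparing leading coefficients gives \<open>\<omega>2 = \<omega>1 c\<^sup>n\<close>.
\<close>

lemma invariant:
  assumes L: "tot_ram L" and x: "x \<in> L" "V x = 1" "x \<noteq> 0" and y: "y \<in> L" "V y = 1" "y \<noteq> 0"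
    and t: "prime_K t" and s: "prime_K s" and \<omega>: "\<omega>1 \<in> k" "\<omega>1 \<noteq> 0" "\<omega>2 \<in> k"
    and E2: "amano_root t \<omega>2 x" and E1: "amano_root s \<omega>1 y"
  shows "\<exists>c\<in>k. c \<noteq> 0 \<and> \<omega>2 = \<omega>1 * c ^ n"
proof -
  interpret L: subfield_set L using L tot_subfield by auto
  have KL: "c \<in> K \<Longrightarrow> c \<in> L" for c using tot_K[OF L(1)] by auto
  have kL: "c \<in> k \<Longrightarrow> c \<in> L" for c using KL k_K by auto
  obtain c where c: "c \<in> k" "y - c * x ^ 1 \<in> M (real 1 + 1)"
    using tot_lead_nat[OF L y(1), of 1 x] x y by (auto simp: M_def)
  define r where "r = y - c * x"
  have r: "r \<in> M 2" "r \<in> L" using c y x kL by (auto simp: r_def intro!: L.diff_mem L.mult_mem)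
  have c0: "c \<noteq> 0" using r(1) y by (auto simp: r_def M_def)
  have Vc: "V c = 0" using V_k c c0 by auto
  have tMp: "t \<in> M (real p)" and xpMp: "x ^ p \<in> M (real p)"
    using t x by (auto simp: prime_K_def M_def V_power)
  note xpt = amano_root_approx_t[OF t \<omega>(3) E2 x(2,3)]
  obtain d where d: "\<forall>i<p. d i \<in> K" "r = (\<Sum>i<p. d i * x ^ i)"
    using tot_span[OF L x] r by (auto simp: span_pow_def)
  \<comment> \<open>Frobenius gives \<open>r^p = \<Sum> d_i^p (x^p)^i\<close>; replacing
    \<open>x^p\<close> by its approximation \<open>t\<close> produces an element of
    \<open>K\<close>.\<close>
  define \<kappa> where "\<kappa> = (\<Sum>i<p. d i ^ p * t ^ i)"
  have \<kappa>: "\<kappa> \<in> K" unfolding \<kappa>_def using d t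
    by (intro K.sum_mem K.mult_mem K.power_mem) (auto simp: prime_K_def)
  have rk: "r ^ p - \<kappa> \<in> M (real (n + p) + 1)"
  proof -
    have "r ^ p = (\<Sum>i<p. d i ^ p * (x ^ p) ^ i)"
      unfolding d(2) frob_sum by (simp add: power_mult_distrib power_mult[symmetric] mult.commute)
    hence "r ^ p - \<kappa> = (\<Sum>i<p. d i ^ p * ((x ^ p) ^ i - t ^ i))"
      by (simp add: \<kappa>_def right_diff_distrib sum_subtractf)
    also have "\<dots> \<in> M (real (n + p) + 1)"
    proof (rule M_sum)
      fix i assume i: "i \<in> {..<p}"
      show "d i ^ p * ((x ^ p) ^ i - t ^ i) \<in> M (real (n + p) + 1)"
      proof (cases "i = 0")
        case False
        \<comment> \<open>\<open>V (d_i)\<close> is bounded below only by \<open>2 - i\<close>,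
          possibly negative. The difference of \<open>i\<close>-th powers contributes
          \<open>(i - 1) p\<close> beyond \<open>n + p\<close>, which compensates this and leaves a
          surplus of \<open>p\<close>.\<close>
        have "d i * x ^ i \<in> M 2" by (rule coeff_M[of x d]) (use x d r i in auto)
        hence "d i \<in> M (2 - real i)"
          using x by (subst (asm) mult.commute, subst (asm) M_mult_iff) (auto simp: V_power)
        moreover have "(x ^ p) ^ i - t ^ i \<in> M (real (n + p) + real (i - 1) * real p)"
          by (rule power_diff_t[OF tMp xpMp xpt(1)])
        ultimately have "d i ^ p * ((x ^ p) ^ i - t ^ i) \<in>
            M (real p * (2 - real i) + (real (n + p) + real (i - 1) * real p))"
          by (intro M_mult M_power)
        moreover have "real p * (2 - real i) + (real (n + p) + real (i - 1) * real p) = real (n + p) + real p"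
          using False by (simp add: of_nat_diff algebra_simps)
        ultimately show ?thesis using p_pos by (auto elim: M_mono)
      qed auto
    qed
    finally show ?thesis .
  qed
  \<comment> \<open>Since \<open>y^p - c^p x^p = r^p\<close>, subtracting \<open>c^p\<close> times
    the equation of \<open>x\<close> from that of \<open>y\<close> isolates the middle terms:
    \<open>D = s - c^p t - r^p\<close>.\<close>
  define D where "D = c ^ p * \<omega>2 * t ^ m * x ^ l - \<omega>1 * s ^ m * y ^ l"
  have yp: "y ^ p = c ^ p * x ^ p + r ^ p"
    using frob_add[of "c * x" r] by (simp add: r_def power_mult_distrib)
  have D_eq: "D = s - c ^ p * t - r ^ p"
    using E2 E1 yp by (simp add: D_def amano_root_def algebra_simps)
  have cp: "c ^ p \<in> k" "c ^ p \<in> K" using c k_K by (auto intro: k.power_mem)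
  have DM: "D \<in> M (real (n + p))"
  proof -
    have "c ^ p * (x ^ p - t) \<in> M (0 + real (n + p))" by (intro M_mult k_M0 cp xpt)
    moreover have "y ^ p - s \<in> M (real (n + p))" by (rule amano_root_approx_t(1)[OF s \<omega>(1) E1 y(2,3)])
    ultimately have "c ^ p * (x ^ p - t) - (y ^ p - s) \<in> M (real (n + p))" using M_diff by auto
    thus ?thesis unfolding D_eq yp by (simp add: algebra_simps)
  qed
  have DM1: "D \<in> M (real (n + p) + 1)"
  proof -
    define h where "h = s - c ^ p * t - \<kappa>"
    have hD: "h = D + (r ^ p - \<kappa>)" by (simp add: h_def D_eq)
    have hK: "h \<in> K" unfolding h_def using s t \<kappa> cp
      by (intro K.diff_mem K.mult_mem) (auto simp: prime_K_def)
    have hM: "h \<in> M (real (n + p))" unfolding hD using DM rk by (intro M_add) (auto elim: M_mono)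
    have "h \<in> M (real (n + p) + 1)"
    proof (cases "h = 0")
      case False
      obtain i :: int where i: "V h = real p * of_int i" using V_K[OF hK False] by blast
      have "V h \<noteq> real (n + p)"
      proof
        assume "V h = real (n + p)"
        hence "real_of_int (int p * i) = real_of_int (int m * int p + int l)" using i n_eq_real by simp
        hence "int p * i = int m * int p + int l" by (simp only: of_int_eq_iff)
        hence "int l = int p * (i - int m)" by (simp add: algebra_simps)
        hence "int p dvd int l" by simp
        thus False using l_pos l_less by (auto dest: nat_dvd_not_less[rotated])
      qed
      hence "h \<in> Ms (of_int (int (n + p)))" using hM False by (simp add: M_def Ms_def)
      from tot_Ms_M[OF L KL[OF hK] this] show ?thesis by simp
    qed auto
    hence "h - (r ^ p - \<kappa>) \<in> M (real (n + p) + 1)" by (rule M_diff[OF _ rk])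
    thus ?thesis by (simp add: hD)
  qed
  have sct: "s \<approx> c ^ p * t"
  proof (rule eqvI)
    have "r ^ p \<in> M (real p * 2)" by (rule M_power[OF r(1)])
    hence "D + r ^ p \<in> Ms (real p)" using DM n_pos p_pos by (intro Ms_add) (auto elim!: M_Ms)
    thus "s - c ^ p * t \<in> Ms (V (c ^ p * t))" using t c0 Vc by (simp add: D_eq V_mult V_power prime_K_def)
  qed (use c0 t in \<open>auto simp: prime_K_def\<close>)
  have ycx: "y \<approx> c * x"
    by (rule eqvI) (use c0 x Vc r in \<open>auto simp: V_mult r_def intro: M_Ms\<close>)
  define W where "W = t ^ m * x ^ l"
  have W: "W \<noteq> 0" "V W = real (n + p)" using t x n_eq_real
    by (auto simp: W_def prime_K_def V_mult V_power)
  \<comment> \<open>With \<open>s\<close> replaced by \<open>c^p t\<close> and \<open>y\<close> by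
    \<open>c x\<close>, the second middle term has leading coefficient
    \<open>\<omega>1 c^(n+p)\<close>; the first one has \<open>c^p \<omega>2\<close>. As
    \<open>D\<close> has value above \<open>n + p\<close>, the two agree.\<close>
  have "\<omega>1 * s ^ m * y ^ l \<approx> \<omega>1 * (c ^ p * t) ^ m * (c * x) ^ l"
    using \<omega> by (intro eqv_mult eqv_power sct ycx eqv_refl)
  also have "\<omega>1 * (c ^ p * t) ^ m * (c * x) ^ l = \<omega>1 * c ^ (m * p + l) * W"
    unfolding W_def power_mult_distrib power_add power_mult[of c m p, symmetric] power_mult[of c p m, symmetric]
      mult.commute[of m p] by (simp only: ac_simps)
  finally have e: "\<omega>1 * s ^ m * y ^ l \<approx> \<omega>1 * c ^ (n + p) * W" unfolding n_eq .
  hence "\<omega>1 * s ^ m * y ^ l - \<omega>1 * c ^ (n + p) * W \<in> Ms (V W)"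
    using c0 \<omega> W V_k[OF \<omega>(1,2)] Vc by (simp add: eqv_iff V_mult V_power)
  moreover have "D \<in> Ms (V W)" using DM1 W by (auto intro: M_Ms)
  ultimately have "D + (\<omega>1 * s ^ m * y ^ l - \<omega>1 * c ^ (n + p) * W) \<in> Ms (V W)" by (intro Ms_add)
  hence "(c ^ p * \<omega>2 - \<omega>1 * c ^ (n + p)) * W \<in> Ms (V W)"
    by (simp add: D_def W_def algebra_simps)
  hence "c ^ p * \<omega>2 - \<omega>1 * c ^ (n + p) \<in> Ms 0"
    using W by (cases "c ^ p * \<omega>2 - \<omega>1 * c ^ (n + p) = 0") (auto simp: Ms_def V_mult)
  hence "c ^ p * \<omega>2 - \<omega>1 * c ^ (n + p) = 0"
    by (intro k_Ms0) (use c \<omega> in \<open>auto intro!: k.diff_mem k.mult_mem k.power_mem\<close>)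
  hence "c ^ p * \<omega>2 = c ^ p * (\<omega>1 * c ^ n)" by (simp add: power_add algebra_simps)
  hence "\<omega>2 = \<omega>1 * c ^ n" using c0 by simp
  thus ?thesis using c c0 by blast
qed

text \<open>If \<open>y\<close> lies in \<open>L\<close>, then \<open>V (y - x)\<close> is an
  integer, which makes \<open>n/(p-1)\<close> an integer \<open>j\<close>, and \<open>y - x\<close>
  has a leading coefficient \<open>c\<close> in \<open>k\<close>. Leading terms in
  \<open>amano_root_conjugate_eq\<close> give \<open>c^(p-1) = l \<omega>\<close>, an exact equation
  because both sides lie in \<open>k\<close>.\<close>

lemma conjugate_in_imp:
  assumes L: "tot_ram L" "x \<in> L" and t: "prime_K t" and \<omega>: "\<omega> \<in> k" "\<omega> \<noteq> 0"
    and E: "amano_root t \<omega> x" "amano_root t \<omega> y" and y: "y \<in> L" "y \<noteq> x"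
  shows "\<exists>j c. j > 0 \<and> (p - 1) * j = n \<and> c \<in> k \<and> c \<noteq> 0 \<and> of_nat l * \<omega> = c ^ (p - 1)"
proof -
  interpret L: subfield_set L using L tot_subfield by auto
  note x = amano_root_props[OF t \<omega>(1) E(1)]
  have ne: "x \<noteq> y" using y by simp
  note Vz = amano_root_conjugate_V[OF t \<omega> E ne] and eq = amano_root_conjugate_eq[OF t \<omega> E ne]
  have p1: "real (p - 1) = real p - 1" "real p - 1 > 0" using p_ge_2 by (auto simp: of_nat_diff)
  have zL: "y - x \<in> L" "y - x \<noteq> 0" using y L by (auto intro: L.diff_mem)
  obtain J :: int where J: "V (y - x) = of_int J" using tot_V_int[OF L(1) zL] by blast
  have "real n / (real p - 1) > 0" using p1 n_pos by simp
  hence "real_of_int J > 1" using J Vz(1) by simp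
  define j where "j = nat (J - 1)"
  have jJ: "J = int (Suc j)" "j > 0" using \<open>real_of_int J > 1\<close> by (auto simp: j_def)
  have "real j = real n / (real p - 1)" using J Vz(1) jJ by simp
  hence "(real p - 1) * real j = real n" using p1 by simp
  hence "real ((p - 1) * j) = real n" using p1(1) by simp
  hence jn: "(p - 1) * j = n" by (simp only: of_nat_eq_iff)
  obtain c where c: "c \<in> k" "c \<noteq> 0" "y - x \<approx> c * x ^ Suc j"
    using tot_lead[OF L(1) zL L(2) x(2,1) J] unfolding jJ power_int_of_nat by blast
  \<comment> \<open>Replacing \<open>t\<close> by \<open>x^p\<close> turns the leading term into a
    monomial in \<open>x\<close>, comparable with \<open>(c x^(j+1))^(p-1)\<close>.\<close>
  have "\<omega> * t ^ m * geo y x l \<approx> \<omega> * (x ^ p) ^ m * (of_nat l * x ^ (l - 1))"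
    using \<omega> eqv_sym[OF amano_root_approx_t(2)[OF t \<omega>(1) E(1) x(2,1)]]
    by (intro eqv_mult eqv_refl eqv_power geo_eqv Vz l_nz V_l)
  also have "\<omega> * (x ^ p) ^ m * (of_nat l * x ^ (l - 1)) = of_nat l * \<omega> * (x ^ (p * m) * x ^ (l - 1))"
    unfolding power_mult[of x p m] by (simp only: ac_simps)
  also have "x ^ (p * m) * x ^ (l - 1) = x ^ (Suc j * (p - 1))"
  proof -
    have "Suc j * (p - 1) = (p - 1) + n" using jn by (simp add: mult.commute)
    also have "\<dots> = p * m + (l - 1)" using n_eq l_pos p_pos by (simp add: mult.commute)
    finally show ?thesis by (simp add: power_add)
  qed
  finally have "(y - x) ^ (p - 1) \<approx> of_nat l * \<omega> * x ^ (Suc j * (p - 1))" unfolding eq .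
  moreover have "(y - x) ^ (p - 1) \<approx> (c * x ^ Suc j) ^ (p - 1)" by (rule eqv_power[OF c(3)])
  moreover have "(c * x ^ Suc j) ^ (p - 1) = c ^ (p - 1) * x ^ (Suc j * (p - 1))"
    by (simp only: power_mult_distrib power_mult)
  ultimately have "c ^ (p - 1) * x ^ (Suc j * (p - 1)) \<approx> of_nat l * \<omega> * x ^ (Suc j * (p - 1))"
    using eqv_sym eqv_trans by metis
  hence "c ^ (p - 1) * x ^ (Suc j * (p - 1)) / x ^ (Suc j * (p - 1)) \<approx>
      of_nat l * \<omega> * x ^ (Suc j * (p - 1)) / x ^ (Suc j * (p - 1))"
    using x by (intro eqv_divide eqv_refl) auto
  moreover have nz: "x ^ (Suc j * (p - 1)) \<noteq> 0" using x by simp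
  ultimately have "c ^ (p - 1) \<approx> of_nat l * \<omega>" by (simp only: nonzero_mult_div_cancel_right[OF nz])
  moreover have lk: "of_nat l * \<omega> \<in> k" using \<omega> of_nat_k by (auto intro: k.mult_mem)
  ultimately have "c ^ (p - 1) - of_nat l * \<omega> \<in> Ms 0"
    using V_k[OF lk] by (simp add: eqv_iff)
  hence "c ^ (p - 1) - of_nat l * \<omega> = 0"
    by (rule k_Ms0[rotated]) (use c lk in \<open>auto intro: k.diff_mem k.power_mem\<close>)
  thus ?thesis using c jn jJ(2) by (intro exI[of _ j] exI[of _ c]) auto
qed

text \<open>
  Write \<open>y = x + z\<close>. The equation for \<open>z\<close> is solved by Newton's iteration \<open>T\<close> with constant slope \<open>D\<close>, the
  linear coefficient; it is a contraction near \<open>c x\<^bsup>j+1\<^esup>\<close>.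
\<close>

lemma conjugate_in_exists:
  assumes L: "tot_ram L" "x \<in> L" and t: "prime_K t" and \<omega>: "\<omega> \<in> k" "\<omega> \<noteq> 0"
    and E: "amano_root t \<omega> x" and j: "(p - 1) * j = n" and c: "c \<in> k" "c \<noteq> 0" "of_nat l * \<omega> = c ^ (p - 1)"
  shows "\<exists>y\<in>L. y \<noteq> x \<and> amano_root t \<omega> y"
proof -
  interpret L: subfield_set L using L tot_subfield by auto
  have KL: "c \<in> K \<Longrightarrow> c \<in> L" for c using tot_K[OF L(1)] by auto
  have kL: "c \<in> k \<Longrightarrow> c \<in> L" for c using KL k_K by auto
  note x = amano_root_props[OF t \<omega>(1) E(1)]
  have p1: "real (p - 1) = real p - 1" "real p - 1 > 0" using p_ge_2 by (auto simp: of_nat_diff)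
  have jpos: "j \<ge> 1" using j n_pos by (cases j) auto
  have jr: "(real p - 1) * real j = real n" using j p1 by (metis of_nat_mult)
  define D where "D = of_nat l * \<omega> * t ^ m * x ^ (l - 1)"
  have tL: "t \<in> L" using t KL by (simp add: prime_K_def)
  have D: "D \<noteq> 0" "V D = (real p - 1) * (real j + 1)" "D \<in> L"
  proof -
    show "D \<noteq> 0" using l_nz \<omega> t x by (simp add: D_def prime_K_def)
    have "V D = real m * real p + real (l - 1)"
      using l_nz V_l \<omega> V_k[OF \<omega>] t x by (simp add: D_def prime_K_def V_mult V_power)
    thus "V D = (real p - 1) * (real j + 1)"
      using n_eq_real l_pos jr by (simp add: of_nat_diff distrib_left)
    show "D \<in> L" unfolding D_def using L tL kL \<omega>
      by (intro L.mult_mem L.power_mem L.of_nat_mem) auto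
  qed
  define T where "T z = z + (z ^ p - \<omega> * t ^ m * ((x + z) ^ l - x ^ l)) / D" for z
  \<comment> \<open>The expected leading term of \<open>z\<close>: matching \<open>z^(p-1)\<close>
    with \<open>D\<close> to leading order means \<open>c^(p-1) = l \<omega>\<close> and
    \<open>(j + 1)(p - 1) = p m + l - 1\<close>.\<close>
  define z0 where "z0 = c * x ^ Suc j"
  have TL: "T z \<in> L" if "z \<in> L" for z unfolding T_def
    using that L tL kL \<omega> D by (intro L.add_mem L.divide_mem L.diff_mem L.mult_mem L.power_mem) auto
  have z0: "z0 \<in> L" "z0 \<noteq> 0" "V z0 = real j + 1"
    using c x L kL V_k[OF c(1,2)] by (auto simp: z0_def V_mult V_power intro!: L.mult_mem L.power_mem)
  define B where "B = {z \<in> L. z - z0 \<in> M (real j + 2)}"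
  have BM: "z \<in> Ms 1 \<and> x + z \<approx> x" if "z \<in> B" for z
  proof -
    have "z - z0 \<in> Ms 1" using that unfolding B_def by (auto elim!: M_Ms)
    moreover have "z0 \<in> Ms 1" using z0 jpos by (simp add: Ms_def)
    ultimately have "z \<in> Ms 1" using Ms_add[of "z - z0" 1 z0] by simp
    thus ?thesis using eqv_add[OF eqv_refl[of x]] x by auto
  qed
  \<comment> \<open>Near \<open>x\<close> the divided difference of the middle term has leading term
    \<open>D\<close>, so \<open>T\<close> uses the right slope up to a relative error of value at
    least 1.\<close>
  have geoD: "1 - \<omega> * t ^ m * geo u w l / D \<in> M 1"
    if uw: "u \<approx> w" "w \<approx> x" "u \<in> L" "w \<in> L" for u w
  proof -
    have "geo u w l \<approx> of_nat l * w ^ (l - 1)" by (rule geo_eqv[OF uw(1) l_nz V_l])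
    moreover have "of_nat l * w ^ (l - 1) \<approx> of_nat l * x ^ (l - 1)"
      using l_nz uw by (intro eqv_mult eqv_power eqv_refl)
    ultimately have "geo u w l \<approx> of_nat l * x ^ (l - 1)" using eqv_trans by blast
    hence "\<omega> * t ^ m * geo u w l \<approx> \<omega> * t ^ m * (of_nat l * x ^ (l - 1))"
      using \<omega> t by (intro eqv_mult eqv_refl) (auto simp: prime_K_def)
    hence "\<omega> * t ^ m * geo u w l \<approx> D" by (simp add: D_def ac_simps)
    hence "\<omega> * t ^ m * geo u w l / D - 1 \<in> Ms (of_int 0)" by (simp add: eqv_def)
    moreover have "\<omega> * t ^ m * geo u w l / D - 1 \<in> L"
      unfolding geo_def using uw \<omega> kL tL D
      by (intro L.diff_mem L.divide_mem L.mult_mem L.power_mem L.sum_mem L.one_mem) auto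
    ultimately have "\<omega> * t ^ m * geo u w l / D - 1 \<in> M (of_int 0 + 1)" using tot_Ms_M[OF L(1)] by blast
    thus ?thesis using M_diff_commute[of 1 "\<omega> * t ^ m * geo u w l / D" 1] by simp
  qed
  have contr: "T z - T z' \<in> M (r + 1)" if z: "z \<in> B" "z' \<in> B" "z - z' \<in> M r" "r \<ge> real j + 2" for z z' r
  proof -
    have "x + z \<approx> x + z'" using BM[OF z(1)] BM[OF z(2)] eqv_sym eqv_trans by blast
    hence g: "1 - \<omega> * t ^ m * geo (x + z) (x + z') l / D \<in> M 1"
      by (rule geoD) (use BM[OF z(2)] z L in \<open>auto simp: B_def intro: L.add_mem\<close>)
    have "(x + z) ^ l - (x + z') ^ l = (z - z') * geo (x + z) (x + z') l"
      unfolding power_diff_geo by simp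
    moreover have "T z - T z' = (z - z') + ((z ^ p - z' ^ p) - \<omega> * t ^ m * ((x + z) ^ l - (x + z') ^ l)) / D"
      by (simp add: T_def diff_divide_distrib add_divide_distrib right_diff_distrib)
    ultimately have "T z - T z' = (z - z') + ((z - z') ^ p - \<omega> * t ^ m * ((z - z') * geo (x + z) (x + z') l)) / D"
      by (simp add: frob_diff)
    also have "\<dots> = (z - z') * (1 - \<omega> * t ^ m * geo (x + z) (x + z') l / D) + (z - z') ^ p / D"
      by (simp add: diff_divide_distrib right_diff_distrib ac_simps)
    also have "\<dots> \<in> M (r + 1)"
    proof (rule M_add)
      show "(z - z') * (1 - \<omega> * t ^ m * geo (x + z) (x + z') l / D) \<in> M (r + 1)"
        by (rule M_mult[OF z(3) g])
      \<comment> \<open>The Frobenius term gains too: \<open>p r - V D >= r + 1\<close> reduces to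
        \<open>(p - 1)(r - (j + 1)) >= 1\<close>, which holds because the ball around
        \<open>z0\<close> has order \<open>j + 2\<close>.\<close>
      have "(real p - 1) * 1 \<le> (real p - 1) * (r - (real j + 1))" using z p1 by (intro mult_left_mono) auto
      hence "r + 1 + V D \<le> real p * r" using p_ge_2 unfolding D(2) by (simp add: algebra_simps)
      thus "(z - z') ^ p / D \<in> M (r + 1)" using M_mono[OF M_power[OF z(3)]] D by (simp add: M_divide_iff)
    qed
    finally show ?thesis .
  qed
  have start: "T z0 - z0 \<in> M (real j + 2)"
  proof -
    have z0B: "z0 \<in> B" using z0 by (simp add: B_def)
    have g: "1 - \<omega> * t ^ m * geo (x + z0) x l / D \<in> M 1"
      by (rule geoD) (use BM[OF z0B] z0 L x in \<open>auto intro: L.add_mem eqv_refl\<close>)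
    have "z0 ^ (p - 1) = c ^ (p - 1) * x ^ (Suc j * (p - 1))"
      by (simp only: z0_def power_mult_distrib power_mult)
    also have "Suc j * (p - 1) = p * m + (l - 1)"
      using j n_eq l_pos p_pos by (simp add: mult.commute)
    also have "c ^ (p - 1) * x ^ (p * m + (l - 1)) = of_nat l * \<omega> * (x ^ p) ^ m * x ^ (l - 1)"
      unfolding power_add power_mult[of x p m] c(3)[symmetric] by (simp only: ac_simps)
    also have "\<dots> \<approx> D" unfolding D_def
      using l_nz \<omega> x amano_root_approx_t(2)[OF t \<omega>(1) E x(2,1)] by (intro eqv_mult eqv_power eqv_refl) auto
    finally have "z0 ^ (p - 1) / D - 1 \<in> Ms (of_int 0)" by (simp add: eqv_def)
    hence "z0 ^ (p - 1) / D - 1 \<in> M (of_int 0 + 1)"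
      by (rule tot_Ms_M[OF L(1), rotated]) (use z0 D in \<open>auto intro!: L.diff_mem L.divide_mem L.power_mem\<close>)
    hence "(z0 ^ (p - 1) / D - 1) + (1 - \<omega> * t ^ m * geo (x + z0) x l / D) \<in> M 1"
      using g by (intro M_add) auto
    hence "z0 * ((z0 ^ (p - 1) / D - 1) + (1 - \<omega> * t ^ m * geo (x + z0) x l / D)) \<in> M (real j + 1 + 1)"
      using z0 by (intro M_mult) (auto simp: M_def)
    also have "z0 * ((z0 ^ (p - 1) / D - 1) + (1 - \<omega> * t ^ m * geo (x + z0) x l / D)) =
        (z0 * z0 ^ (p - 1) - \<omega> * t ^ m * (z0 * geo (x + z0) x l)) / D"
      by (simp add: diff_divide_distrib right_diff_distrib ac_simps)
    also have "z0 * z0 ^ (p - 1) = z0 ^ p" using p_pos by (cases p) auto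
    also have "z0 * geo (x + z0) x l = (x + z0) ^ l - x ^ l" unfolding power_diff_geo by simp
    also have "(z0 ^ p - \<omega> * t ^ m * ((x + z0) ^ l - x ^ l)) / D = T z0 - z0" by (simp add: T_def)
    finally show ?thesis by (simp add: add.assoc)
  qed
  define Z where "Z i = (T ^^ i) z0" for i
  have Z: "Z i \<in> B \<and> Z (Suc i) - Z i \<in> M (real j + 2 + real i)" for i
  proof (induction i)
    case 0
    show ?case using start z0 by (simp add: Z_def B_def)
  next
    case (Suc i)
    have "Z (Suc i) - Z i \<in> M (real j + 2)" using Suc by (auto elim!: M_mono)
    hence "Z (Suc i) - z0 \<in> M (real j + 2)" using Suc by (auto simp: B_def elim: M_trans)
    hence B: "Z (Suc i) \<in> B" using Suc TL[of "Z i"] by (simp add: B_def Z_def)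
    have "T (Z (Suc i)) - T (Z i) \<in> M ((real j + 2 + real i) + 1)"
      by (rule contr) (use B Suc in auto)
    thus ?case using B by (simp add: Z_def algebra_simps)
  qed
  have "Z i \<in> L" "Z (Suc i) - Z i \<in> M (real i)" for i
    using Z[of i] by (auto simp: B_def elim!: M_mono)
  from tot_complete[OF L(1), of Z, OF this] obtain z where z: "z \<in> L" "\<forall>i. Z i - z \<in> M (real i)" by blast
  have zB: "z \<in> B"
  proof -
    have "z - Z (j + 2) \<in> M (real j + 2)" using z(2)[rule_format, of "j + 2"] by (simp add: M_diff_commute add.commute)
    moreover have "Z (j + 2) - z0 \<in> M (real j + 2)" using Z[of "j + 2"] by (simp add: B_def add.commute)
    ultimately show ?thesis using z(1) M_trans by (auto simp: B_def)
  qed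
  have "T z - z \<in> M (real i)" for i
  proof -
    define q where "q = i + j + 2"
    have "z - Z q \<in> M (real q)" "real q \<ge> real j + 2"
      using z(2) M_diff_commute by (blast, simp add: q_def)
    hence "T z - T (Z q) \<in> M (real q + 1)" using contr zB Z by blast
    hence 1: "T z - T (Z q) \<in> M (real i)" by (rule M_mono) (simp add: q_def)
    have "T (Z q) = Z (Suc q)" by (simp add: Z_def)
    hence "T (Z q) - z \<in> M (real (Suc q))" using z(2)[rule_format, of "Suc q"] by simp
    hence 2: "T (Z q) - z \<in> M (real i)" by (rule M_mono) (simp add: q_def)
    show ?thesis by (rule M_trans[OF 1 2])
  qed
  hence "T z - z = 0" by (rule M_all_zero)
  hence zp: "z ^ p = \<omega> * t ^ m * ((x + z) ^ l - x ^ l)" using D by (simp add: T_def)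
  have "amano_root t \<omega> (x + z)" using E zp by (simp add: amano_root_def frob_add algebra_simps)
  \<comment> \<open>\<open>T\<close> also fixes 0, the solution \<open>y = x\<close>; it is excluded
    because \<open>V z0 = j + 1\<close> keeps 0 out of the ball \<open>B\<close>.\<close>
  moreover have "z \<noteq> 0" using zB z0 by (auto simp: B_def M_def)
  ultimately show ?thesis using L z(1) by (intro bexI[of _ "x + z"]) (auto intro: L.add_mem)
qed

end

section \<open>The correspondence\<close>

lemma int_subgroup_cyclic:
  fixes H :: "int set"
  assumes "\<And>x y. x \<in> H \<Longrightarrow> y \<in> H \<Longrightarrow> x - y \<in> H" "a \<in> H" "a > 0"
  obtains d where "d > 0" "H = range (\<lambda>i. d * i)"
proof -
  have zero: "0 \<in> H" using assms(1)[OF assms(2,2)] by simp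
  have neg: "- x \<in> H" if "x \<in> H" for x using assms(1)[OF zero that] by simp
  have add: "x + y \<in> H" if "x \<in> H" "y \<in> H" for x y using assms(1)[OF that(1) neg[OF that(2)]] by simp
  have nmul: "int q * x \<in> H" if "x \<in> H" for x q
    by (induction q) (auto simp: zero algebra_simps that intro: add)
  have mul: "x * q \<in> H" if "x \<in> H" for x q
    using nmul[OF that, of "nat q"] neg[OF nmul[OF that, of "nat (- q)"]]
    by (cases "q \<ge> 0") (auto simp: mult.commute)
  define d where "d = int (LEAST e. e > 0 \<and> int e \<in> H)"
  have d: "d > 0 \<and> d \<in> H"
    unfolding d_def using LeastI[of "\<lambda>e. e > 0 \<and> int e \<in> H" "nat a"] assms(2,3) by auto
  have "h \<in> range (\<lambda>i. d * i)" if h: "h \<in> H" for h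
  proof -
    have "h mod d \<in> H" using assms(1)[OF h mul[of d "h div d"]] d by (simp add: minus_mult_div_eq_mod)
    moreover have r: "0 \<le> h mod d" "h mod d < d" using d by auto
    ultimately have "h mod d = 0"
      using not_less_Least[of "nat (h mod d)" "\<lambda>e. e > 0 \<and> int e \<in> H"] unfolding d_def by auto
    thus ?thesis by (auto simp: mod_eq_0_iff_dvd dvd_def)
  qed
  hence "H = range (\<lambda>i. d * i)" using mul d by auto
  thus ?thesis using that d by blast
qed

text \<open>\<open>real_of_ereal\<close> sends the infinite value at 0 to 0, a junk value that
  \<open>M\<close> and \<open>Ms\<close> bypass by admitting 0 explicitly.\<close>

definition scaled_val :: "nat \<Rightarrow> ('s::field \<Rightarrow> ereal) \<Rightarrow> 's \<Rightarrow> real" where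
  "scaled_val p v x = real p * real_of_ereal (v x)"

lemma ring_hom_Ks_iff: "\<sigma> \<in> ring_hom (\<F> L) (Ks :: 's::field ring) \<longleftrightarrow> hom_on L \<sigma>"
  by (auto simp: ring_hom_def hom_on_def)

lemma ring_iso_Ks_iff: "\<sigma> \<in> ring_iso (\<F> L) (\<F> L' :: 's::field ring) \<longleftrightarrow> hom_on L \<sigma> \<and> bij_betw \<sigma> L L'"
  by (auto simp: ring_iso_def ring_hom_def hom_on_def bij_betw_def)

section \<open>Translation between the extended-real valuation and \<open>V\<close>\<close>

locale amano_valued = amano "scaled_val p v" p K k n m l
  for v :: "'s::field \<Rightarrow> ereal" and p K k n m l +
  assumes fv: "field_valuation v" and vK: "v ` (K - {0}) = range (\<lambda>i::int. ereal (of_int i))"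
begin

abbreviation "V \<equiv> scaled_val p v"

lemma v_V: "x \<noteq> 0 \<Longrightarrow> v x = ereal (V x / real p)"
  using fv p_pos unfolding field_valuation_def scaled_val_def
  by (cases "v x") auto

lemma scaled_v: "x \<noteq> 0 \<Longrightarrow> ereal e * v x = ereal (e * (V x / real p))"
  using v_V[of x] by simp

lemma prime_K_exists: "\<exists>t. prime_K t"
proof -
  have "real p * of_int 1 \<in> V ` (K - {0})" unfolding V_image_K by blast
  then obtain t where "t \<in> K - {0}" "real p * of_int 1 = V t" by blast
  thus ?thesis by (intro exI[of _ t]) (simp add: prime_K_def)
qed

lemma v_0: "v 0 = \<infinity>" using fv unfolding field_valuation_def by simp

lemma v_M0: "0 \<le> v x \<longleftrightarrow> x \<in> M 0"
  using p_pos by (cases "x = 0") (auto simp: v_V v_0 M_def zero_le_divide_iff)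

lemma v_Ms0: "0 < v x \<longleftrightarrow> x \<in> Ms 0"
  using p_pos by (cases "x = 0") (auto simp: v_V v_0 Ms_def zero_less_divide_iff)

text \<open>Of two admissible factors each is an integer multiple of the other, as seen at an
  element where one of the scaled valuations is 1; both being positive, they coincide.\<close>

lemma normalized_val_eq:
  assumes e: "e > 0" "(\<lambda>x. ereal e * v x) ` (L - {0}) = range (\<lambda>i::int. ereal (of_int i))"
  shows "normalized_val v L = (\<lambda>x. ereal e * v x)"
  unfolding normalized_val_def
proof (rule the_equality)
  show "(\<exists>c>0. (\<lambda>x. ereal e * v x) = (\<lambda>x. ereal c * v x)) \<and>
      (\<lambda>x. ereal e * v x) ` (L - {0}) = range (\<lambda>i::int. ereal (real_of_int i))"
    using e by blast
next
  fix w assume "(\<exists>c>0. w = (\<lambda>x. ereal c * v x)) \<and> w ` (L - {0}) = range (\<lambda>i::int. ereal (real_of_int i))"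
  then obtain c where c: "c > 0" "w = (\<lambda>x. ereal c * v x)"
    "(\<lambda>x. ereal c * v x) ` (L - {0}) = range (\<lambda>i::int. ereal (of_int i))" by blast
  have quot: "\<exists>i::int. e' = c' * of_int i"
    if "c' > 0" "(\<lambda>x. ereal c' * v x) ` (L - {0}) = range (\<lambda>i::int. ereal (of_int i))"
      "(\<lambda>x. ereal e' * v x) ` (L - {0}) = range (\<lambda>i::int. ereal (of_int i))" for c' e' :: real
  proof -
    have "ereal (of_int 1) \<in> (\<lambda>x. ereal c' * v x) ` (L - {0})" unfolding that(2) by blast
    then obtain x where x: "x \<in> L - {0}" "ereal (of_int 1) = ereal c' * v x" by blast
    hence "ereal (of_int 1) = ereal (c' * (V x / real p))"
      using scaled_v[of x c'] by (simp del: times_divide_eq_right)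
    hence vx: "c' * (V x / real p) = 1" by (simp only: ereal.inject of_int_1)
    have "ereal e' * v x \<in> range (\<lambda>i::int. ereal (of_int i))" using that(3) x(1) by blast
    then obtain i :: int where "e' * (V x / real p) = of_int i"
      using x(1) scaled_v[of x e'] by (auto simp del: times_divide_eq_right)
    hence "c' * (e' * (V x / real p)) = c' * of_int i" by (simp only:)
    moreover have "c' * (e' * (V x / real p)) = e' * (c' * (V x / real p))" by (simp only: ac_simps)
    ultimately have "e' = c' * of_int i" unfolding vx by simp
    thus ?thesis by blast
  qed
  obtain i j :: int where ij: "e = c * of_int i" "c = e * of_int j"
    using quot[OF c(1,3) e(2)] quot[OF e(1,2) c(3)] by blast
  have "i > 0" "j > 0" using ij e c by (metis mult_pos_neg mult_zero_right not_less_iff_gr_or_eq of_int_0 of_int_0_less_iff of_int_less_0_iff zero_less_mult_pos)+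
  moreover have "of_int i * of_int j = (1 :: real)" using ij e c by (simp add: field_simps)
  hence "i * j = 1" by (metis of_int_eq_1_iff of_int_mult)
  ultimately have "i = 1" by (simp add: pos_zmult_eq_1_iff)
  hence "e = c" using ij(1) by simp
  thus "w = (\<lambda>x. ereal e * v x)" using c(2) by simp
qed

lemma normalized_val_K: "normalized_val v K = v"
  using normalized_val_eq[of 1 K] vK by (simp add: one_ereal_def[symmetric])

lemma prime_element_K: "prime_element v K t \<longleftrightarrow> prime_K t"
proof (cases "t = 0")
  case False
  thus ?thesis using p_pos
    by (auto simp: prime_element_def normalized_val_K prime_K_def v_V one_ereal_def)
qed (auto simp: prime_element_def normalized_val_K prime_K_def v_0)

lemma image_scaled:
  "(\<lambda>x. ereal e * v x) ` (L - {0}) = (\<lambda>x. ereal (e * (V x / real p))) ` (L - {0})"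
  by (rule image_cong) (auto simp: scaled_v simp del: times_divide_eq_right)

lemma normalized_val_tot:
  assumes "tot_ram L" shows "normalized_val v L = (\<lambda>x. ereal (real p) * v x)"
proof (rule normalized_val_eq)
  have "(\<lambda>x. ereal (real p * (V x / real p))) ` (L - {0}) = ereal ` (V ` (L - {0}))"
    using p_pos by (simp add: image_image)
  also have "V ` (L - {0}) = range of_int" using assms by (simp add: tot_ram_def)
  finally show "(\<lambda>x. ereal (real p) * v x) ` (L - {0}) = range (\<lambda>i::int. ereal (of_int i))"
    unfolding image_scaled by (simp add: image_image)
qed (use p_pos in simp)

lemma normalized_val_tot_nz:
  "tot_ram L \<Longrightarrow> x \<noteq> 0 \<Longrightarrow> normalized_val v L x = ereal (V x)"
  using p_pos by (simp add: normalized_val_tot v_V)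

lemma prime_element_tot: "tot_ram L \<Longrightarrow> prime_element v L x \<longleftrightarrow> x \<in> L \<and> V x = 1 \<and> x \<noteq> 0"
  using p_pos normalized_val_tot_nz[of L x]
  by (cases "x = 0") (auto simp: prime_element_def normalized_val_tot v_0 one_ereal_def)

lemma tot_imp_totally_ramified: assumes "tot_ram L" shows "totally_ramified_of_degree v K L p"
proof -
  have "normalized_val v L ` (K - {0}) = (\<lambda>x. ereal (V x)) ` (K - {0})"
    by (rule image_cong) (auto simp: normalized_val_tot_nz assms)
  also have "\<dots> = ereal ` (V ` (K - {0}))" by (simp add: image_image)
  also have "\<dots> = range (\<lambda>i::int. ereal (real p * of_int i))" unfolding V_image_K by (simp add: image_image)
  finally show ?thesis using assms p_pos
    unfolding totally_ramified_of_degree_def has_ramification_index_def tot_ram_def subfield_Ks_iff by simp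
qed

text \<open>
  \<open>normalized_val v L\<close> is a definite description, hence meaningless unless \<open>v\<close> has a discrete value
  group on \<open>L\<close>; this is derived from the finite dimension before the ramification index can be used.
\<close>

lemma algebraic_V:
  assumes L: "subfield_set L" "K \<subseteq> L" "ring.dimension Ks p K L" and y: "y \<in> L" "y \<noteq> 0"
  shows "\<exists>i::int. fact p * V y = real p * of_int i"
proof -
  interpret L: subfield_set L by fact
  have "\<not> lin_indep K (Suc p) (\<lambda>i. y ^ i)"
    by (rule dimension_not_lin_indep[OF K_subfield L(3)]) (use y in \<open>auto intro: L.power_mem\<close>)
  then obtain c i0 where c: "\<forall>i<Suc p. c i \<in> K" "(\<Sum>i<Suc p. c i * y ^ i) = 0" "i0 < Suc p" "c i0 \<noteq> 0"
    unfolding lin_indep_def by blast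
  have "\<exists>i j. i < Suc p \<and> j < Suc p \<and> i \<noteq> j \<and> c i * y ^ i \<noteq> 0 \<and> c j * y ^ j \<noteq> 0 \<and> V (c i * y ^ i) = V (c j * y ^ j)"
  proof (rule ccontr)
    assume neg: "\<not> ?thesis"
    have "c i0 * y ^ i0 = 0"
      by (rule sum_distinct_V_zero[of "{..<Suc p}" "\<lambda>i. c i * y ^ i"]) (use neg c in auto)
    thus False using c y by simp
  qed
  then obtain i j where ij: "i < Suc p" "j < Suc p" "i < j" "c i \<noteq> 0" "c j \<noteq> 0" "V (c i * y ^ i) = V (c j * y ^ j)"
    by (metis linorder_neq_iff mult_zero_left)
  obtain a b :: int where ab: "V (c i) = real p * of_int a" "V (c j) = real p * of_int b"
    using V_K c ij by metis
  \<comment> \<open>Exponents differ by at most \<open>p\<close>, so the difference divides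
    \<open>p!\<close>; this gives one denominator for all \<open>y\<close>.\<close>
  define e where "e = j - i"
  have "real e * V y = real p * of_int (a - b)"
    using ij y ab by (simp add: V_mult V_power e_def of_nat_diff algebra_simps)
  moreover have "e dvd fact p" using ij by (intro dvd_fact) (auto simp: e_def)
  then obtain q where "fact p = e * q" by (auto elim: dvdE)
  hence "(fact p :: real) = real e * real q" by (metis of_nat_fact of_nat_mult)
  ultimately have "fact p * V y = real p * of_int ((a - b) * int q)" by simp
  thus ?thesis by blast
qed

text \<open>Clearing the common denominator \<open>p!\<close> from \<open>algebraic_V\<close> turns
  the value group of \<open>L\<close> into a nonzero subgroup \<open>H\<close> of the integers,
  hence a cyclic one. So \<open>normalized_val v L\<close> is a genuine multiple \<open>e v\<close>,
  and the ramification index forces \<open>e = p\<close>.\<close>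

lemma totally_ramified_imp_tot: assumes "totally_ramified_of_degree v K L p" shows "tot_ram L"
proof -
  have L: "subfield_set L" "K \<subseteq> L" "ring.dimension Ks p K L"
    and ram: "normalized_val v L ` (K - {0}) = range (\<lambda>i::int. ereal (real p * of_int i))"
    using assms unfolding totally_ramified_of_degree_def has_ramification_index_def subfield_Ks_iff by auto
  interpret L: subfield_set L by fact
  define H where "H = {h::int. \<exists>y\<in>L. y \<noteq> 0 \<and> fact p * V y = real p * of_int h}"
  have H_diff: "x - y \<in> H" if xy: "x \<in> H" "y \<in> H" for x y
  proof -
    obtain a b where ab: "a \<in> L" "a \<noteq> 0" "fact p * V a = real p * of_int x" "b \<in> L" "b \<noteq> 0" "fact p * V b = real p * of_int y"
      using xy unfolding H_def by blast
    have "fact p * V (a / b) = real p * of_int (x - y)" using ab by (simp add: V_divide right_diff_distrib)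
    moreover have "a / b \<in> L" "a / b \<noteq> 0" using ab by (auto intro: L.divide_mem)
    ultimately show ?thesis unfolding H_def by blast
  qed
  obtain t where t: "t \<in> K" "t \<noteq> 0" "V t = real p"
    using prime_K_exists by (auto simp: prime_K_def)
  have "fact p * V t = real p * of_int (fact p)" using t by simp
  hence "fact p \<in> H" unfolding H_def using t L(2) by blast
  from int_subgroup_cyclic[OF H_diff this] obtain d where d: "d > 0" "H = range (\<lambda>i. d * i)" by auto
  have VL: "V ` (L - {0}) = range (\<lambda>i::int. real p * of_int (d * i) / fact p)"
  proof (intro equalityI subsetI)
    fix r assume "r \<in> V ` (L - {0})"
    then obtain y where y: "y \<in> L" "y \<noteq> 0" "r = V y" by auto
    obtain h :: int where h: "fact p * V y = real p * of_int h" using algebraic_V[OF L y(1,2)] by blast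
    hence "h \<in> H" unfolding H_def using y by blast
    then obtain i where i: "h = d * i" using d by blast
    have "r = real p * of_int (d * i) / fact p" using h y(3) i by (simp add: field_simps)
    thus "r \<in> range (\<lambda>i::int. real p * of_int (d * i) / fact p)" by blast
  next
    fix r assume "r \<in> range (\<lambda>i::int. real p * of_int (d * i) / fact p)"
    then obtain i :: int where i: "r = real p * of_int (d * i) / fact p" by blast
    have "d * i \<in> H" using d by blast
    then obtain y where y: "y \<in> L" "y \<noteq> 0" "fact p * V y = real p * of_int (d * i)" unfolding H_def by blast
    have "r = V y" unfolding i y(3)[symmetric] by simp
    thus "r \<in> V ` (L - {0})" using y by blast
  qed
  \<comment> \<open>\<open>v\<close> maps the nonzero elements of \<open>L\<close> onto the
    multiples of \<open>d / p!\<close>.\<close>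
  define e :: real where "e = fact p / of_int d"
  have e: "e > 0" using d by (simp add: e_def)
  have "normalized_val v L = (\<lambda>x. ereal e * v x)"
  proof (rule normalized_val_eq[OF e])
    have "(\<lambda>x. ereal e * v x) ` (L - {0}) = (\<lambda>r. ereal (e * (r / real p))) ` (V ` (L - {0}))"
      unfolding image_scaled by (simp add: image_image)
    also have "\<dots> = range (\<lambda>i::int. ereal (of_int i))"
      unfolding VL image_image using d p_pos by (intro image_cong) (auto simp: e_def)
    finally show "(\<lambda>x. ereal e * v x) ` (L - {0}) = range (\<lambda>i::int. ereal (of_int i))" .
  qed
  moreover have "(\<lambda>x. ereal e * v x) ` (K - {0}) = (\<lambda>r. ereal e * r) ` (v ` (K - {0}))" by (simp add: image_image)
  ultimately have "range (\<lambda>i::int. ereal (e * of_int i)) = range (\<lambda>i::int. ereal (real p * of_int i))"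
    using ram vK by (simp add: image_image)
  hence "ereal (e * of_int 1) \<in> range (\<lambda>i::int. ereal (real p * of_int i))"
    "ereal (real p * of_int 1) \<in> range (\<lambda>i::int. ereal (e * of_int i))" by blast+
  then obtain i j :: int where "ereal (e * of_int 1) = ereal (real p * of_int i)"
    "ereal (real p * of_int 1) = ereal (e * of_int j)" by blast
  hence ij: "e = real p * of_int i" "real p = e * of_int j" by (simp_all only: ereal.inject of_int_1 mult_1_right)
  have pr: "real p > 0" using p_pos by simp
  have "of_int i * of_int j = (1 :: real)" using ij e pr by (simp add: field_simps)
  hence "i * j = 1" by (metis of_int_eq_1_iff of_int_mult)
  moreover have "i > 0" using ij(1) e pr by (simp add: zero_less_mult_iff)
  ultimately have "i = 1" by (simp add: pos_zmult_eq_1_iff)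
  hence "fact p = real p * of_int d" using ij(1) d by (simp add: e_def field_simps)
  hence "V ` (L - {0}) = range of_int" unfolding VL using pr d by (auto simp: field_simps)
  thus ?thesis using L by (simp add: tot_ram_def)
qed

lemma ramified_exts_iff:
  "L \<in> \<E> v K p b \<longleftrightarrow> tot_ram L \<and> has_ramification_break v K L b"
  using tot_imp_totally_ramified totally_ramified_imp_tot by (auto simp: ramified_exts_def)

lemma ramification_numbers_tot:
  assumes "tot_ram L"
  shows "ramification_numbers v K L = {ereal (V (\<sigma> u - u) - 1) | \<sigma> u.
    hom_on L \<sigma> \<and> (\<forall>c\<in>K. \<sigma> c = c) \<and> (\<exists>x\<in>L. \<sigma> x \<noteq> x) \<and> u \<in> L \<and> V u = 1 \<and> u \<noteq> 0}"
proof -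
  \<comment> \<open>A prime element generates \<open>L\<close>, so a nontrivial embedding moves it;
    the junk value \<open>V 0\<close> never enters.\<close>
  have ne: "\<sigma> u \<noteq> u" if "hom_on L \<sigma>" "\<forall>c\<in>K. \<sigma> c = c" "\<exists>x\<in>L. \<sigma> x \<noteq> x" "u \<in> L" "V u = 1" "u \<noteq> 0" for \<sigma> u
    using hom_fixes_eq[OF assms that(4-6,1)] that by blast
  have eq: "normalized_val v L (\<sigma> u - u) - 1 = ereal (V (\<sigma> u - u) - 1)"
    if "hom_on L \<sigma>" "\<forall>c\<in>K. \<sigma> c = c" "\<exists>x\<in>L. \<sigma> x \<noteq> x" "u \<in> L" "V u = 1" "u \<noteq> 0" for \<sigma> u
    using ne[OF that] by (simp add: normalized_val_tot_nz[OF assms] one_ereal_def)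
  have "ramification_numbers v K L = {normalized_val v L (\<sigma> u - u) - 1 | \<sigma> u.
    hom_on L \<sigma> \<and> (\<forall>c\<in>K. \<sigma> c = c) \<and> (\<exists>x\<in>L. \<sigma> x \<noteq> x) \<and> u \<in> L \<and> V u = 1 \<and> u \<noteq> 0}"
    unfolding ramification_numbers_def embeddings_def ring_hom_Ks_iff prime_element_tot[OF assms] by blast
  also have "\<dots> = {ereal (V (\<sigma> u - u) - 1) | \<sigma> u.
    hom_on L \<sigma> \<and> (\<forall>c\<in>K. \<sigma> c = c) \<and> (\<exists>x\<in>L. \<sigma> x \<noteq> x) \<and> u \<in> L \<and> V u = 1 \<and> u \<noteq> 0}"
    by (intro Collect_cong iff_exI, rule rev_conj_cong[OF refl], elim conjE, subst eq) (assumption | rule refl)+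
  finally show ?thesis .
qed

lemma break_V:
  assumes "tot_ram L" "has_ramification_break v K L (real n / (real p - 1))" "hom_on L \<sigma>"
    "\<And>c. c \<in> K \<Longrightarrow> \<sigma> c = c" "x \<in> L" "V x = 1" "x \<noteq> 0" "\<sigma> x \<noteq> x"
  shows "V (\<sigma> x - x) = 1 + real n / (real p - 1)"
proof -
  have "ereal (V (\<sigma> x - x) - 1) \<in> ramification_numbers v K L"
    unfolding ramification_numbers_tot[OF assms(1)] using assms by blast
  thus ?thesis using assms(2) by (simp add: has_ramification_break_def)
qed

lemma amano_root_hom:
  assumes "tot_ram L" "x \<in> L" "hom_on L \<sigma>" "\<forall>c\<in>K. \<sigma> c \<in> K" "\<sigma> \<omega> = \<omega>" "t \<in> K" "\<omega> \<in> k" "amano_root t \<omega> x"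
  shows "amano_root (\<sigma> t) \<omega> (\<sigma> x)"
proof -
  interpret L: subfield_set L using assms tot_subfield by auto
  have mem: "t \<in> L" "\<omega> \<in> L" using assms tot_K k_K by blast+
  have "\<sigma> (x ^ p) = \<sigma> (t + \<omega> * t ^ m * x ^ l)" using assms(8) by (simp add: amano_root_def)
  moreover have "\<sigma> (x ^ p) = \<sigma> x ^ p" by (rule L.hom_power[OF assms(3,2)])
  moreover have "\<sigma> (t + \<omega> * t ^ m * x ^ l) = \<sigma> t + \<sigma> \<omega> * \<sigma> t ^ m * \<sigma> x ^ l"
    using mem assms(2) L.hom_add[OF assms(3)] L.hom_mult[OF assms(3)] L.hom_power[OF assms(3)]
    by (simp add: L.mult_mem L.power_mem)
  ultimately show ?thesis using assms(5) by (simp add: amano_root_def)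
qed

lemma amano_root_ramified:
  assumes t: "prime_K t" and \<omega>: "\<omega> \<in> k" "\<omega> \<noteq> 0" and E: "amano_root t \<omega> x"
  shows "field_adjoin K x \<in> \<E> v K p (real n / (real p - 1))"
proof -
  note x = amano_root_props[OF t \<omega>(1) E]
  define L where "L = field_adjoin K x"
  have xL: "x \<in> L" by (simp add: L_def field_adjoin_incl)
  have L: "tot_ram L" using x by (simp add: L_def)
  have tK: "t \<in> K" using t by (simp add: prime_K_def)
  have val: "V (\<sigma> u - u) - 1 = real n / (real p - 1)"
    if \<sigma>: "hom_on L \<sigma>" "\<forall>c\<in>K. \<sigma> c = c" "\<exists>x\<in>L. \<sigma> x \<noteq> x" and u: "u \<in> L" "V u = 1" "u \<noteq> 0" for \<sigma> u
  proof -
    have ne: "x \<noteq> \<sigma> x" using hom_fixes_eq[OF L xL x(2,1) \<sigma>(1)] \<sigma>(2,3) by metis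
    have "amano_root (\<sigma> t) \<omega> (\<sigma> x)" by (rule amano_root_hom[OF L xL \<sigma>(1)]) (use \<sigma> \<omega> k_K tK E in auto)
    hence "amano_root t \<omega> (\<sigma> x)" using \<sigma>(2) tK by simp
    note c = amano_root_conjugate_V[OF t \<omega> E this ne]
    have "V (\<sigma> u - u) = V (\<sigma> x - x)"
      by (rule conjugate_V_indep(2)[OF L xL x(2,1) \<sigma>(1) _ c(2)]) (use \<sigma> ne u in auto)
    thus ?thesis using c(1) by simp
  qed
  \<comment> \<open>A second root supplies a nontrivial embedding. Without one the set of
    ramification numbers would be empty instead of the singleton that a break requires.\<close>
  have eis: "eisenstein (acoef t \<omega>)" by (rule acoef_eisenstein[OF t \<omega>(1)])
  have xp: "x ^ p = (\<Sum>i<p. acoef t \<omega> i * x ^ i)" using E by (simp add: amano_root_acoef)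
  have "poly (minp (acoef t \<omega>)) x = 0" using xp by (simp add: poly_minp)
  from minp_conjugates[OF eis this] obtain Y where Y: "finite Y" "card Y = p - 1" "x \<notin> Y"
    "\<forall>y\<in>Y. poly (minp (acoef t \<omega>)) y = 0" by metis
  have "card Y > 0" using Y p_ge_2 by simp
  then obtain y where y: "y \<in> Y" by (metis card_gt_0_iff ex_in_conv)
  hence "y ^ p = (\<Sum>i<p. acoef t \<omega> i * y ^ i)" using Y(4) by (simp add: poly_minp)
  from tot_conjugate_hom[OF L xL eis xp this] obtain \<sigma> where
    \<sigma>: "hom_on L \<sigma>" "\<forall>c\<in>K. \<sigma> c = c" "\<sigma> x = y" by metis
  have "\<sigma> x \<noteq> x" using \<sigma>(3) y Y(3) by auto
  hence "\<exists>x\<in>L. \<sigma> x \<noteq> x" using xL by blast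
  hence "ereal (V (\<sigma> x - x) - 1) \<in> ramification_numbers v K L"
    unfolding ramification_numbers_tot[OF L] using \<sigma>(1,2) xL x(1,2) by blast
  moreover have "r = ereal (real n / (real p - 1))" if "r \<in> ramification_numbers v K L" for r
    using that val unfolding ramification_numbers_tot[OF L] by force
  ultimately have "is_singleton (ramification_numbers v K L)"
    "ereal (real n / (real p - 1)) \<in> ramification_numbers v K L"
    by (metis empty_iff is_singletonI', metis)
  hence "ramification_numbers v K L = {ereal (real n / (real p - 1))}"
    by (auto simp: is_singleton_def)
  thus ?thesis using L unfolding ramified_exts_iff has_ramification_break_def L_def by blast
qed

section \<open>Isomorphisms that respect \<open>K\<close> and the residue field\<close>

definition kiso :: "'s set \<Rightarrow> 's set \<Rightarrow> ('s \<Rightarrow> 's) \<Rightarrow> bool" where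
  "kiso L1 L2 \<sigma> \<longleftrightarrow> hom_on L1 \<sigma> \<and> bij_betw \<sigma> L1 L2 \<and> \<sigma> ` K = K \<and> (\<forall>x\<in>K. x \<in> M 0 \<longrightarrow> \<sigma> x - x \<in> Ms 0)"

lemma k_isomorphic_iff: "k_isomorphic v K L1 L2 \<longleftrightarrow> (\<exists>\<sigma>. kiso L1 L2 \<sigma>)"
  unfolding k_isomorphic_def kiso_def Bex_def ring_iso_Ks_iff v_M0 v_Ms0 by blast

text \<open>Continuity of \<sigma> is derived from the residue condition. That condition preserves
  units, so on \<open>K\<close> the map \<open>V \<circ> \<sigma>\<close> is determined by
  \<open>V (\<sigma> t)\<close>, a positive multiple of \<open>p\<close>; surjectivity of \<sigma>
  on \<open>K\<close> leaves only \<open>p\<close> itself.\<close>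

lemma kiso_V_K:
  assumes L: "tot_ram L1" and \<sigma>: "kiso L1 L2 \<sigma>" and c: "c \<in> K" "c \<noteq> 0"
  shows "V (\<sigma> c) = V c"
proof -
  interpret L: subfield_set L1 using L tot_subfield by auto
  have hom: "hom_on L1 \<sigma>" and sK: "\<sigma> ` K = K" and res: "\<And>x. x \<in> K \<Longrightarrow> x \<in> M 0 \<Longrightarrow> \<sigma> x - x \<in> Ms 0"
    using \<sigma> by (auto simp: kiso_def)
  have KL: "x \<in> K \<Longrightarrow> x \<in> L1" for x using tot_K[OF L] by auto
  obtain t where t: "t \<in> K" "t \<noteq> 0" "V t = real p"
    using prime_K_exists by (auto simp: prime_K_def)
  have unit: "V (\<sigma> u) = 0" if u: "u \<in> K" "u \<noteq> 0" "V u = 0" for u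
  proof -
    have "eqv (\<sigma> u) u" by (rule eqvI) (use u res[OF u(1)] in \<open>auto simp: M_def\<close>)
    thus ?thesis using eqv_V[of "\<sigma> u" u] u by simp
  qed
  have form: "\<exists>i::int. V c = of_int i * real p \<and> V (\<sigma> c) = of_int i * V (\<sigma> t)" if c: "c \<in> K" "c \<noteq> 0" for c
  proof -
    obtain i :: int where i: "V c = real p * of_int i" using V_K c by blast
    define u where "u = c / t powi i"
    have u: "u \<in> K" "u \<noteq> 0" "V u = 0" using c t i
      by (auto simp: u_def V_divide V_power_int intro: K.divide_mem K.power_int_mem)
    have hp: "\<sigma> (t powi i) = \<sigma> t powi i"
      using L.hom_power[OF hom, of t] L.hom_power[OF hom, of "inverse t"] L.hom_inverse[OF hom, of t] KL t L.inverse_mem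
      by (auto simp: power_int_def)
    have "c = u * t powi i" using t by (simp add: u_def)
    hence "\<sigma> c = \<sigma> u * \<sigma> t powi i"
      using L.hom_mult[OF hom, of u "t powi i"] KL u t hp L.power_int_mem by auto
    moreover have "\<sigma> u \<noteq> 0" "\<sigma> t \<noteq> 0" using L.hom_nz[OF hom] u t KL by auto
    ultimately have "V (\<sigma> c) = V (\<sigma> u) + of_int i * V (\<sigma> t)" by (simp add: V_mult V_power_int)
    thus ?thesis using unit[OF u] i by (auto simp: mult.commute)
  qed
  have st: "\<sigma> t \<in> K" "\<sigma> t \<noteq> 0" using sK t L.hom_nz[OF hom] KL by auto
  have "\<sigma> t - t \<in> Ms 0" using res t by (simp add: M_def)
  moreover have "t \<in> Ms 0" using t p_pos by (simp add: Ms_def)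
  ultimately have "\<sigma> t - t + t \<in> Ms 0" by (rule Ms_add)
  hence pos: "V (\<sigma> t) > 0" using st by (simp add: Ms_def)
  obtain e :: int where e: "V (\<sigma> t) = real p * of_int e" using V_K st by blast
  \<comment> \<open>A preimage of \<open>t\<close> makes \<open>p\<close> an integer multiple of
    \<open>V (\<sigma> t)\<close>.\<close>
  obtain c0 where c0: "c0 \<in> K" "\<sigma> c0 = t" using sK t by (metis imageE)
  have "c0 \<noteq> 0" using c0 t L.hom_zero[OF hom] by auto
  then obtain i :: int where i: "V (\<sigma> c0) = of_int i * V (\<sigma> t)" using form c0 by blast
  hence "real p = of_int i * (real p * of_int e)" using c0 t e by simp
  hence "of_int i * of_int e = (1 :: real)" using p_pos by (simp add: field_simps)
  hence "i * e = 1" by (metis of_int_eq_1_iff of_int_mult)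
  moreover have "e > 0" using pos e p_pos by (simp add: zero_less_mult_iff)
  ultimately have "e = 1" by (metis mult.commute pos_zmult_eq_1_iff)
  thus ?thesis using form[OF c] e by auto
qed

text \<open>
  Every \<open>a \<in> k\<close> is a \<open>p\<^sup>N\<close>-th power, which makes \<open>\<sigma> a - a\<close> a \<open>p\<^sup>N\<close>-th power of an element of positive value.
\<close>

lemma kiso_k:
  assumes L: "tot_ram L1" and \<sigma>: "kiso L1 L2 \<sigma>" and a: "a \<in> k"
  shows "\<sigma> a = a"
proof -
  interpret L: subfield_set L1 using L tot_subfield by auto
  have hom: "hom_on L1 \<sigma>" and sK: "\<sigma> ` K = K" and res: "\<And>x. x \<in> K \<Longrightarrow> x \<in> M 0 \<Longrightarrow> \<sigma> x - x \<in> Ms 0"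
    using \<sigma> by (auto simp: kiso_def)
  have kL: "x \<in> k \<Longrightarrow> x \<in> L1" for x using tot_K[OF L] k_K by auto
  have "\<forall>a\<in>k. \<sigma> a - a \<in> M (real N)" for N
  proof (induction N)
    case 0
    show ?case
    proof
      fix a assume "a \<in> k"
      hence "\<sigma> a - a \<in> Ms 0" using res k_K k_M0 by blast
      thus "\<sigma> a - a \<in> M (real 0)" by (rule Ms_M) simp
    qed
  next
    case (Suc N)
    show ?case
    proof
      fix a assume "a \<in> k"
      then obtain c where c: "c \<in> k" "a = c ^ p" using perfect_k by metis
      have "\<sigma> c - c \<in> K" using c k_K sK by (intro K.diff_mem) auto
      hence "\<sigma> c - c \<in> M (real p)" using res[of c] c k_K k_M0 by (intro K_pos_M) auto
      \<comment> \<open>The bound \<open>p\<close> from the gap in the values of \<open>K\<close>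
        starts the growth; multiplying the inductive bound \<open>N = 0\<close> by \<open>p\<close>
        would gain nothing.\<close>
      hence "\<sigma> c - c \<in> M (max (real p) (real N))" using Suc c by (auto simp: max_def)
      moreover have "\<sigma> a - a = (\<sigma> c - c) ^ p"
        using c L.hom_power[OF hom, of c p] kL by (simp add: frob_diff)
      ultimately have "\<sigma> a - a \<in> M (real p * max (real p) (real N))" by (simp add: M_power)
      moreover have "real (Suc N) \<le> real p * max (real p) (real N)"
      proof -
        define A where "A = max (real p) (real N)"
        have "A \<ge> 2" "A \<ge> real N" using p_ge_2 by (auto simp: A_def)
        moreover have "2 * A \<le> real p * A"
          using p_ge_2 \<open>A \<ge> 2\<close> by (intro mult_right_mono) auto
        ultimately show ?thesis unfolding A_def[symmetric] by (simp only: of_nat_Suc)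
      qed
      ultimately show "\<sigma> a - a \<in> M (real (Suc N))" by (rule M_mono)
    qed
  qed
  hence "\<sigma> a - a \<in> M (real N)" for N using a by blast
  hence "\<sigma> a - a = 0" by (rule M_all_zero)
  thus ?thesis by simp
qed

lemma kiso_refl: "tot_ram L \<Longrightarrow> kiso L L (\<lambda>x. x)"
  by (auto simp: kiso_def hom_on_def bij_betw_def)

lemma kiso_sym:
  assumes L: "tot_ram L1" "tot_ram L2" and \<sigma>: "kiso L1 L2 \<sigma>"
  shows "kiso L2 L1 (inv_into L1 \<sigma>)"
proof -
  interpret L: subfield_set L1 using L tot_subfield by auto
  have hom: "hom_on L1 \<sigma>" and sK: "\<sigma> ` K = K" and bij: "bij_betw \<sigma> L1 L2"
    and res: "\<And>x. x \<in> K \<Longrightarrow> x \<in> M 0 \<Longrightarrow> \<sigma> x - x \<in> Ms 0"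
    using \<sigma> by (auto simp: kiso_def)
  define \<tau> where "\<tau> = inv_into L1 \<sigma>"
  have KL: "K \<subseteq> L1" using tot_K L by auto
  have ts: "\<tau> (\<sigma> x) = x" if "x \<in> L1" for x
    unfolding \<tau>_def using bij that by (simp add: bij_betw_inv_into_left)
  have surj: "\<exists>x\<in>L1. y = \<sigma> x" if "y \<in> L2" for y using bij that by (auto simp: bij_betw_def)
  have "hom_on L2 \<tau>" unfolding hom_on_def
  proof (intro conjI ballI)
    show "\<tau> 1 = 1" using ts[of 1] L.hom_one[OF hom] by simp
    fix x y assume "x \<in> L2" "y \<in> L2"
    then obtain a b where ab: "a \<in> L1" "x = \<sigma> a" "b \<in> L1" "y = \<sigma> b" using surj by metis
    show "\<tau> (x + y) = \<tau> x + \<tau> y" using ab ts L.hom_add[OF hom, of a b] by (metis L.add_mem)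
    show "\<tau> (x * y) = \<tau> x * \<tau> y" using ab ts L.hom_mult[OF hom, of a b] by (metis L.mult_mem)
  qed
  moreover have "bij_betw \<tau> L2 L1" unfolding \<tau>_def using bij by (rule bij_betw_inv_into)
  moreover have "\<tau> ` K = K"
  proof -
    have "\<tau> ` (\<sigma> ` K) = K" using ts KL by (force simp: image_image)
    thus ?thesis by (simp only: sK)
  qed
  moreover have "\<tau> x - x \<in> Ms 0" if x: "x \<in> K" "x \<in> M 0" for x
  proof -
    obtain c where c: "c \<in> K" "x = \<sigma> c" using sK x(1) by blast
    have "c \<in> M 0"
    proof (cases "c = 0")
      case False
      thus ?thesis using kiso_V_K[OF L(1) \<sigma> c(1) False] x(2) c L.hom_nz[OF hom, of c] KL by (auto simp: M_def)
    qed auto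
    hence "- (\<sigma> c - c) \<in> Ms 0" using res[OF c(1)] by (intro Ms_minus)
    thus ?thesis using c ts[of c] KL by auto
  qed
  ultimately show ?thesis unfolding kiso_def \<tau>_def by blast
qed

lemma kiso_trans:
  assumes L: "tot_ram L1" "tot_ram L2" and \<sigma>: "kiso L1 L2 \<sigma>" "kiso L2 L3 \<tau>"
  shows "kiso L1 L3 (\<tau> \<circ> \<sigma>)"
proof -
  interpret L: subfield_set L1 using L tot_subfield by auto
  have sL: "\<sigma> x \<in> L2" if "x \<in> L1" for x using \<sigma>(1) that by (auto simp: kiso_def bij_betw_def)
  have "hom_on L1 (\<tau> \<circ> \<sigma>)"
    using \<sigma> sL unfolding kiso_def hom_on_def by (metis comp_apply)
  moreover have "bij_betw (\<tau> \<circ> \<sigma>) L1 L3" using \<sigma> unfolding kiso_def by (blast intro: bij_betw_trans)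
  moreover have "(\<tau> \<circ> \<sigma>) ` K = K" using \<sigma> unfolding kiso_def by (metis image_comp)
  moreover have "(\<tau> \<circ> \<sigma>) x - x \<in> Ms 0" if x: "x \<in> K" "x \<in> M 0" for x
  proof -
    have 1: "\<sigma> x - x \<in> Ms 0" "\<sigma> x \<in> K" using \<sigma>(1) x by (auto simp: kiso_def)
    hence "\<sigma> x - x + x \<in> M 0" using x by (intro M_add) (auto intro: Ms_M)
    hence "\<tau> (\<sigma> x) - \<sigma> x \<in> Ms 0" using \<sigma>(2) 1(2) by (simp add: kiso_def)
    hence "(\<tau> (\<sigma> x) - \<sigma> x) + (\<sigma> x - x) \<in> Ms 0" using 1(1) by (rule Ms_add)
    thus ?thesis by simp
  qed
  ultimately show ?thesis unfolding kiso_def by blast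
qed

lemma k_iso_rel_iff:
  "(L1, L2) \<in> k_iso_rel v K p b \<longleftrightarrow> L1 \<in> \<E> v K p b \<and> L2 \<in> \<E> v K p b \<and> (\<exists>\<sigma>. kiso L1 L2 \<sigma>)"
  by (simp add: k_iso_rel_def k_isomorphic_iff)

lemma equiv_k_iso_rel: "equiv (\<E> v K p b) (k_iso_rel v K p b)"
proof (rule equivI)
  show "refl_on (\<E> v K p b) (k_iso_rel v K p b)"
    using kiso_refl ramified_exts_iff unfolding refl_on_def k_iso_rel_iff by blast
  show "sym (k_iso_rel v K p b)"
    using kiso_sym ramified_exts_iff unfolding sym_def k_iso_rel_iff by blast
  show "trans (k_iso_rel v K p b)"
    using kiso_trans ramified_exts_iff unfolding trans_def k_iso_rel_iff by blast
qed (auto simp: k_iso_rel_iff)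

text \<open>The isomorphism fixes \<open>k\<close>, so it carries \<open>x1\<close> to a root in the
  second field with the same coefficient \<open>\<omega>1\<close> and a new prime element of
  \<open>K\<close>. Both equations now live in one extension, where \<open>invariant\<close>
  applies.\<close>

lemma k_isomorphic_imp_coset:
  assumes t: "prime_K t" and \<omega>: "\<omega>1 \<in> k" "\<omega>1 \<noteq> 0" "\<omega>2 \<in> k" "\<omega>2 \<noteq> 0"
    and E: "amano_root t \<omega>1 x1" "amano_root t \<omega>2 x2" and iso: "k_isomorphic v K (field_adjoin K x1) (field_adjoin K x2)"
  shows "\<exists>c\<in>k. c \<noteq> 0 \<and> \<omega>2 = \<omega>1 * c ^ n"
proof -
  obtain \<sigma> where \<sigma>: "kiso (field_adjoin K x1) (field_adjoin K x2) \<sigma>" using iso k_isomorphic_iff by blast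
  note x1 = amano_root_props[OF t \<omega>(1) E(1)] and x2 = amano_root_props[OF t \<omega>(3) E(2)]
  interpret L: subfield_set "field_adjoin K x1" by (rule subfield_field_adjoin)
  have hom: "hom_on (field_adjoin K x1) \<sigma>" and sK: "\<And>c. c \<in> K \<Longrightarrow> \<sigma> c \<in> K"
    using \<sigma> by (auto simp: kiso_def)
  have x1L: "x1 \<in> field_adjoin K x1" and x2L: "x2 \<in> field_adjoin K x2" by (auto simp: field_adjoin_incl)
  have tK: "t \<in> K" "t \<noteq> 0" "V t = real p" using t by (auto simp: prime_K_def)
  have y: "\<sigma> x1 \<in> field_adjoin K x2" "\<sigma> x1 \<noteq> 0" "V (\<sigma> x1) = 1"
    using \<sigma> x1L L.hom_nz[OF hom x1L x1(1)] hom_V[OF x1(3) hom sK kiso_V_K[OF x1(3) \<sigma>] x1L x1(1)] x1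
    by (auto simp: kiso_def bij_betw_def)
  have s: "prime_K (\<sigma> t)"
    using sK tK kiso_V_K[OF x1(3) \<sigma> tK(1,2)] L.hom_nz[OF hom, of t] field_adjoin_incl(1)[of t K x1]
    by (auto simp: prime_K_def)
  have "amano_root (\<sigma> t) \<omega>1 (\<sigma> x1)"
    by (rule amano_root_hom[OF x1(3) x1L hom]) (use sK kiso_k[OF x1(3) \<sigma>] \<omega> tK E in auto)
  thus ?thesis
    using invariant[OF x2(3) x2L x2(2,1) y(1,3,2) t s \<omega>(1-3) E(2)] by blast
qed

text \<open>\<open>\<omega>0\<close> depends on \<open>L\<close> alone, while the conclusion covers
  its whole coset; the representative in \<open>R\<close> can thus be chosen afterwards.\<close>

lemma ramified_ext_k_isomorphic:
  assumes t: "prime_K t" and L: "L \<in> \<E> v K p (real n / (real p - 1))"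
  obtains \<omega>0 where "\<omega>0 \<in> k" "\<omega>0 \<noteq> 0" "\<forall>\<omega> c x. \<omega> \<in> k \<and> c \<in> k \<and> c \<noteq> 0 \<and> \<omega>0 = \<omega> * c ^ n \<and> amano_root t \<omega> x \<longrightarrow>
     k_isomorphic v K L (field_adjoin K x)"
proof -
  have tot_ram: "tot_ram L" and br: "has_ramification_break v K L (real n / (real p - 1))"
    using L by (auto simp: ramified_exts_iff)
  interpret L: subfield_set L using tot_ram tot_subfield by auto
  have kL: "c \<in> k \<Longrightarrow> c \<in> L" for c using tot_K[OF tot_ram] k_K by auto
  obtain u where u: "u \<in> L" "V u = 1" "u \<noteq> 0" using tot_prime_exists[OF tot_ram] .
  have "\<forall>\<sigma>. hom_on L \<sigma> \<and> (\<forall>c\<in>K. \<sigma> c = c) \<and> \<sigma> u \<noteq> u \<longrightarrow>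
      V (\<sigma> u - u) = 1 + real n / (real p - 1)"
    using break_V[OF tot_ram br] u by blast
  from break_approx[OF tot_ram u this] obtain s \<omega>0 where s: "prime_K s" "\<omega>0 \<in> k" "\<omega>0 \<noteq> 0"
    and e: "u ^ p - s - \<omega>0 * s ^ m * u ^ l \<in> M (real (n + p) + 1)" .
  have "k_isomorphic v K L (field_adjoin K x)"
    if \<omega>: "\<omega> \<in> k" and c: "c \<in> k" "c \<noteq> 0" "\<omega>0 = \<omega> * c ^ n" and E: "amano_root t \<omega> x" for \<omega> c x
  proof -
    have \<omega>0: "\<omega> \<noteq> 0" using c s by auto
    have Vc: "V c = 0" using V_k c by auto
    \<comment> \<open>Scaling \<open>u\<close> by \<open>c\<close> and \<open>s\<close> by
      \<open>c^p\<close> multiplies the relation by \<open>c^p\<close> and, as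
      \<open>c^p \<omega>0 = \<omega> c^(n+p)\<close>, changes its coefficient to \<omega>.\<close>
    define u' where "u' = c * u"
    define s' where "s' = c ^ p * s"
    have s': "prime_K s'" using s c Vc k_K
      by (auto simp: prime_K_def s'_def V_mult V_power intro!: K.mult_mem K.power_mem)
    have u': "u' \<in> L" "V u' = 1" "u' \<noteq> 0" using u c Vc kL by (auto simp: u'_def V_mult intro: L.mult_mem)
    have "err \<omega> s' u' = c ^ p * u ^ p - c ^ p * s - \<omega> * c ^ (m * p + l) * s ^ m * u ^ l"
      unfolding err_def u'_def s'_def power_mult_distrib power_add power_mult[of c p m, symmetric] mult.commute[of m p]
      by (simp only: ac_simps)
    also have "\<dots> = c ^ p * (u ^ p - s - \<omega>0 * s ^ m * u ^ l)"
      unfolding c(3) n_eq[symmetric] power_add by (simp add: algebra_simps)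
    also have "\<dots> \<in> M (0 + (real (n + p) + 1))"
      using c e by (intro M_mult k_M0 k.power_mem) auto
    finally have "err \<omega> s' u' \<in> M (real (n + p) + 1)" by simp
    from approx_exact[OF tot_ram u' s' \<omega> \<omega>0 this] obtain s1 x1 where
      x1: "prime_K s1" "x1 \<in> L" "V x1 = 1" "x1 \<noteq> 0" "amano_root s1 \<omega> x1" .
    obtain \<tau> where \<tau>: "hom_on K \<tau>" "\<tau> ` K = K" "\<forall>c\<in>K. c \<noteq> 0 \<longrightarrow> V (\<tau> c) = V c"
      "\<forall>a\<in>k. \<tau> a = a" "\<tau> s1 = t" using K_automorphism[OF x1(1) t] .
    have Leq: "field_adjoin K x1 = L" by (rule tot_adjoin_eq[OF tot_ram x1(2-4)])
    have s1K: "s1 \<in> K" using x1 by (simp add: prime_K_def)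
    have \<tau>a: "\<tau> (acoef s1 \<omega> i) = acoef t \<omega> i" for i
      using K.hom_zero[OF \<tau>(1)] K.hom_mult[OF \<tau>(1), of \<omega> "s1 ^ m"] K.hom_power[OF \<tau>(1) s1K, of m]
        \<tau>(4,5) \<omega> k_K K.power_mem[OF s1K] by (auto simp: acoef_def)
    have xp: "x ^ p = (\<Sum>i<p. \<tau> (acoef s1 \<omega> i) * x ^ i)" using E by (simp add: amano_root_acoef \<tau>a)
    obtain \<sigma> where \<sigma>: "hom_on (field_adjoin K x1) \<sigma>" "\<forall>c\<in>K. \<sigma> c = \<tau> c" "\<sigma> x1 = x"
      "\<sigma> ` field_adjoin K x1 = field_adjoin K x"
      using hom_extend[OF \<tau>(1,2) _ acoef_eisenstein[OF x1(1) \<omega>] _ xp] \<tau>(3) x1(5) by (auto simp: amano_root_acoef)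
    have "kiso L (field_adjoin K x) \<sigma>"
      unfolding kiso_def
    proof (intro conjI ballI impI)
      show "hom_on L \<sigma>" using \<sigma> Leq by simp
      thus "bij_betw \<sigma> L (field_adjoin K x)"
        using L.hom_inj \<sigma>(4) Leq by (auto simp: bij_betw_def)
      show "\<sigma> ` K = K" using \<sigma>(2) \<tau>(2) by (simp cong: image_cong)
      fix z assume z: "z \<in> K" "z \<in> M 0"
      \<comment> \<open>As \<tau> fixes \<open>k\<close> and preserves values, \<open>z\<close> and
        \<open>\<tau> z\<close> have the same residue \<open>a\<close>.\<close>
      then obtain a where a: "a \<in> k" "z - a \<in> Ms 0" using residue_K by blast
      have aK: "a \<in> K" using a k_K by auto
      have "\<tau> (z - a) \<in> Ms 0"
        using a z aK \<tau>(3) K.diff_mem[OF z(1) aK] K.hom_zero[OF \<tau>(1)]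
        by (cases "z - a = 0") (auto simp: Ms_def)
      hence "\<tau> z - a \<in> Ms 0" using K.hom_diff[OF \<tau>(1) z(1) aK] \<tau>(4) a by simp
      hence "(\<tau> z - a) - (z - a) \<in> Ms 0" using a(2) by (rule Ms_diff)
      thus "\<sigma> z - z \<in> Ms 0" using \<sigma>(2) z by simp
    qed
    thus ?thesis using k_isomorphic_iff by blast
  qed
  thus ?thesis using that s by blast
qed

text \<open>If the extension is Galois, some automorphism moves \<open>x\<close>, since
  \<open>V x = 1\<close> keeps \<open>x\<close> out of \<open>K\<close>; its image is a second root
  inside \<open>L\<close>. Conversely, a second root inside \<open>L\<close> gives an automorphism
  whose own fixed field is \<open>K\<close>.\<close>

lemma amano_root_galois_iff:
  assumes t: "prime_K t" and \<omega>: "\<omega> \<in> k" "\<omega> \<noteq> 0" and E: "amano_root t \<omega> x" and np: "\<not> p dvd n"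
  shows "galois_extension K (field_adjoin K x) \<longleftrightarrow>
    (\<exists>j::nat. j > 0 \<and> \<not> p dvd j \<and> real n / (real p - 1) = real j) \<and> of_nat l * \<omega> \<in> unit_powers k (p - 1)"
proof -
  note x = amano_root_props[OF t \<omega>(1) E]
  define L where "L = field_adjoin K x"
  have xL: "x \<in> L" by (simp add: L_def field_adjoin_incl)
  have L: "tot_ram L" using x by (simp add: L_def)
  interpret L: subfield_set L using L tot_subfield by auto
  have KL: "K \<subseteq> L" using tot_K[OF L] .
  have tK: "t \<in> K" using t by (simp add: prime_K_def)
  have p1: "real (p - 1) = real p - 1" "real p - 1 > 0" using p_ge_2 by (auto simp: of_nat_diff)
  have jn: "real n / (real p - 1) = real j \<longleftrightarrow> (p - 1) * j = n" for j
  proof -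
    have "real n / (real p - 1) = real j \<longleftrightarrow> real ((p - 1) * j) = real n"
      using p1 by (auto simp: field_simps)
    thus ?thesis by (simp only: of_nat_eq_iff)
  qed
  have gal: "galois_extension K L \<longleftrightarrow>
     {z \<in> L. \<forall>\<sigma>. hom_on L \<sigma> \<and> bij_betw \<sigma> L L \<longrightarrow> (\<forall>y\<in>K. \<sigma> y = y) \<longrightarrow> \<sigma> z = z} = K"
    unfolding galois_extension_def Ball_def[of "ring_iso (\<F> L) (\<F> L)"] ring_iso_Ks_iff subfield_Ks_iff
    using L by (auto simp: tot_ram_def)
  show ?thesis
    unfolding L_def[symmetric]
  proof
    assume "galois_extension K L"
    moreover have "x \<notin> K"
    proof
      assume "x \<in> K"
      then obtain i :: int where "V x = real p * of_int i" using V_K x by blast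
      hence "real_of_int (int p * i) = real_of_int 1" using x by simp
      hence "int p * i = 1" by (simp only: of_int_eq_iff)
      hence "int p dvd 1" by (metis dvd_triv_left)
      thus False using p_ge_2 by simp
    qed
    ultimately obtain \<sigma> where \<sigma>: "hom_on L \<sigma>" "bij_betw \<sigma> L L" "\<forall>y\<in>K. \<sigma> y = y" "\<sigma> x \<noteq> x"
      using xL unfolding gal by blast
    have "amano_root (\<sigma> t) \<omega> (\<sigma> x)" by (rule amano_root_hom[OF L xL \<sigma>(1)]) (use \<sigma> \<omega> k_K tK E in auto)
    hence "amano_root t \<omega> (\<sigma> x)" using \<sigma>(3) tK by simp
    moreover have "\<sigma> x \<in> L" using \<sigma>(2) xL by (auto simp: bij_betw_def)
    ultimately obtain j c where jc: "j > 0" "(p - 1) * j = n" "c \<in> k" "c \<noteq> 0" "of_nat l * \<omega> = c ^ (p - 1)"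
      using conjugate_in_imp[OF L xL t \<omega> E] \<sigma>(4) by blast
    have "\<not> p dvd j" using np jc(2) by auto
    thus "(\<exists>j::nat. j > 0 \<and> \<not> p dvd j \<and> real n / (real p - 1) = real j) \<and> of_nat l * \<omega> \<in> unit_powers k (p - 1)"
      using jc jn unfolding unit_powers_def by blast
  next
    assume "(\<exists>j::nat. j > 0 \<and> \<not> p dvd j \<and> real n / (real p - 1) = real j) \<and> of_nat l * \<omega> \<in> unit_powers k (p - 1)"
    then obtain j c where jc: "(p - 1) * j = n" "c \<in> k" "c \<noteq> 0" "of_nat l * \<omega> = c ^ (p - 1)"
      using jn unfolding unit_powers_def by blast
    obtain y where y: "y \<in> L" "y \<noteq> x" "amano_root t \<omega> y" using conjugate_in_exists[OF L xL t \<omega> E jc] by blast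
    note c = amano_root_conjugate_V[OF t \<omega> E y(3) y(2)[symmetric]]
    obtain \<sigma> where \<sigma>: "hom_on L \<sigma>" "\<forall>c\<in>K. \<sigma> c = c" "\<sigma> x = y" "\<sigma> ` L = field_adjoin K y"
      using tot_conjugate_hom[OF L xL acoef_eisenstein[OF t \<omega>(1)]] E y(3) unfolding amano_root_acoef by metis
    have "field_adjoin K y = L"
      using tot_adjoin_eq[OF L y(1)] amano_root_props[OF t \<omega>(1) y(3)] by blast
    hence bij: "bij_betw \<sigma> L L" using L.hom_inj[OF \<sigma>(1)] \<sigma>(4) by (simp add: bij_betw_def)
    have "z \<in> K" if "z \<in> L" "\<sigma> z = z" for z
      using fixed_in_K[OF L xL x(2,1) \<sigma>(1)] \<sigma> c(2) y(2) that by blast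
    thus "galois_extension K L" unfolding gal using \<sigma> bij KL by blast
  qed
qed

end

lemma nonarch_scaled_val:
  fixes v :: "'s::field \<Rightarrow> ereal"
  assumes fv: "field_valuation v"
  shows "x \<noteq> 0 \<Longrightarrow> v x = ereal (real_of_ereal (v x))"
    and "nonarch (scaled_val p v)"
proof -
  show fin: "v x = ereal (real_of_ereal (v x))" if "x \<noteq> 0" for x
    using fv that unfolding field_valuation_def by (cases "v x") auto
  show "nonarch (scaled_val p v)"
  proof
    fix x y :: 's assume xy: "x \<noteq> 0" "y \<noteq> 0"
    have "v (x * y) = v x + v y" using fv by (simp add: field_valuation_def)
    hence "ereal (real_of_ereal (v (x * y))) = ereal (real_of_ereal (v x) + real_of_ereal (v y))"
      using fin[of x] fin[of y] fin[of "x * y"] xy by (metis mult_eq_0_iff plus_ereal.simps(1))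
    thus "scaled_val p v (x * y) = scaled_val p v x + scaled_val p v y" by (simp add: scaled_val_def distrib_left)
    assume s: "x + y \<noteq> 0"
    have "min (v x) (v y) \<le> v (x + y)" using fv by (simp add: field_valuation_def)
    hence "min (ereal (real_of_ereal (v x))) (ereal (real_of_ereal (v y))) \<le> ereal (real_of_ereal (v (x + y)))"
      using fin[of x] fin[of y] fin[of "x + y"] xy s by simp
    hence "real_of_ereal (v x) \<le> real_of_ereal (v (x + y)) \<or> real_of_ereal (v y) \<le> real_of_ereal (v (x + y))"
      by (simp add: min_le_iff_disj)
    thus "min (scaled_val p v x) (scaled_val p v y) \<le> scaled_val p v (x + y)"
      unfolding scaled_val_def min_le_iff_disj by (auto intro: mult_left_mono)
  qed
qed

text \<open>Here \<open>n\<close> stands for \<open>(p - 1) b\<close>, so that the condition on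
  \<open>b\<close> becomes \<open>n > 0\<close> and \<open>\<not> p dvd n\<close>. The set
  \<open>R\<close> serves as its own index set, with \<open>\<pi> \<omega>\<close> the chosen root
  for \<omega>.\<close>

theorem theorem1p1:
  fixes K k R :: "'s::field set"
    and v :: "'s \<Rightarrow> ereal"
    and \<pi>\<^sub>K :: 's and \<pi> :: "'s \<Rightarrow> 's"
    and p n l :: nat and m :: int and b :: real
  assumes "prime p" and "CHAR('s) = p"
    and "local_field v K" and "is_separable_closure K"
    and "residue_subfield v K k" and "perfect_char p k"
    and "prime_element v K \<pi>\<^sub>K"
    and "b = real n / (real p - 1)" and "n > 0" and "\<not> p dvd n"
    and "b = ((of_int m - 1) * real p + real l) / (real p - 1)" and "1 \<le> l" and "l \<le> p - 1"
    and "coset_representatives (k - {0}) (unit_powers k n) R"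
    and "\<forall>\<omega>\<in>R. poly (amano_poly p m l \<pi>\<^sub>K \<omega>) (\<pi> \<omega>) = 0"
  shows "bij_betw (\<lambda>\<omega>. k_iso_rel v K p b `` {field_adjoin K (\<pi> \<omega>)}) R (\<S> v K p b)
    \<and> (\<forall>\<omega>\<in>R. galois_extension K (field_adjoin K (\<pi> \<omega>)) \<longleftrightarrow>
          (\<exists>j::nat. j > 0 \<and> \<not> p dvd j \<and> b = real j) \<and> of_nat l * \<omega> \<in> unit_powers k (p - 1))"
proof -
  have p2: "p \<ge> 2" using assms(1) by (rule prime_ge_2_nat)
  have fv: "field_valuation v" and Kf: "subfield_set K" and vK: "v ` (K - {0}) = range (\<lambda>i::int. ereal (of_int i))"
    and compl: "complete_wrt v K"
    using assms(3) by (auto simp: local_field_def subfield_Ks_iff)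
  have kf: "subfield_set k" and kK: "k \<subseteq> K" and k0: "\<And>a. a \<in> k \<Longrightarrow> 0 \<le> v a"
    and res: "\<And>x. x \<in> K \<Longrightarrow> 0 \<le> v x \<Longrightarrow> \<exists>a\<in>k. 0 < v (x - a)"
    using assms(5) by (auto simp: residue_subfield_def subfield_Ks_iff)
  note fin = nonarch_scaled_val(1)[OF fv]
  have v0: "v 0 = \<infinity>" using fv by (simp add: field_valuation_def)
  interpret N: nonarch "scaled_val p v" by (rule nonarch_scaled_val(2)[OF fv])
  interpret k: subfield_set k by (rule kf)
  define b' where "b' = real n / (real p - 1)"
  have p1: "real p - 1 > 0" using p2 by simp
  have "real n = (of_int m - 1) * real p + real l" using assms(8,11) p1 by (simp add: field_simps)
  hence "real_of_int (int n) = real_of_int ((m - 1) * int p + int l)" by simp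
  hence nm: "int n = (m - 1) * int p + int l" by (simp only: of_int_eq_iff)
  \<comment> \<open>For \<open>m <= 0\<close> the bound \<open>l < p\<close> would make
    \<open>n\<close> negative. Hence \<open>m\<close> can be treated as a natural number.\<close>
  have m1: "m \<ge> 1"
  proof (rule ccontr)
    assume "\<not> m \<ge> 1"
    hence "(m - 1) * int p \<le> (- 1) * int p" by (intro mult_right_mono) auto
    thus False using nm assms(9,13) p2 by linarith
  qed
  define m' where "m' = nat m"
  have m': "m = int m'" "m' \<ge> 1" using m1 by (auto simp: m'_def)
  have "int (n + p) = int (m' * p + l)" using nm m' by (simp add: algebra_simps)
  hence np: "n + p = m' * p + l" by (simp only: of_nat_eq_iff)
  have M_iff_v: "x \<in> N.M (real p * r) \<longleftrightarrow> ereal r \<le> v x" for x r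
  proof (cases "x = 0")
    case True
    thus ?thesis using v0 by simp
  next
    case False
    thus ?thesis using p2 fin[of x]
      by (simp add: N.M_iff scaled_val_def) (metis ereal_less_eq(3))
  qed
  have V_Ms: "x \<in> N.Ms 0 \<longleftrightarrow> 0 < v x" for x
  proof (cases "x = 0")
    case True
    thus ?thesis using v0 by simp
  next
    case False
    thus ?thesis using p2 fin[of x]
      by (simp add: N.Ms_iff scaled_val_def zero_less_mult_iff) (metis ereal_less(2))
  qed
  have V_M0: "x \<in> N.M 0 \<longleftrightarrow> 0 \<le> v x" for x using M_iff_v[of x 0] by (simp add: zero_ereal_def)
  interpret amano_valued v p K k n m' l
  proof
    show "prime p" by fact
    show "CHAR('s) = p" by fact
    show "scaled_val p v ` (K - {0}) = range (\<lambda>i::int. real p * of_int i)"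
    proof -
      have "scaled_val p v ` (K - {0}) = (\<lambda>r. real p * real_of_ereal r) ` (v ` (K - {0}))"
        by (simp add: image_image scaled_val_def)
      thus ?thesis unfolding vK by (simp add: image_image)
    qed
    show "\<exists>x\<in>K. \<forall>i. f i - x \<in> N.M (real i)"
      if f: "\<And>i. f i \<in> K" "\<And>i. f (Suc i) - f i \<in> N.M (real i)" for f
    proof -
      have tele: "f i - f j \<in> N.M (real q)" if "i \<ge> q" "j \<ge> q" for i j q
      proof -
        have "f i - f q \<in> N.M (real q)" "f j - f q \<in> N.M (real q)"
          using N.M_telescope[of f q "i - q", OF f(2)] N.M_telescope[of f q "j - q", OF f(2)] that by simp_all
        from N.M_diff[OF this] show ?thesis by simp
      qed
      have "\<exists>N. \<forall>i\<ge>N. \<forall>j\<ge>N. ereal C < v (f i - f j)" for C :: real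
      proof -
        obtain q :: nat where q: "real p * (C + 1) \<le> real q" using real_arch_simple by blast
        have "ereal C < v (f i - f j)" if "i \<ge> q" "j \<ge> q" for i j
        proof -
          have "f i - f j \<in> N.M (real p * (C + 1))" using tele[OF that] q by (rule N.M_mono)
          hence "ereal (C + 1) \<le> v (f i - f j)" by (simp only: M_iff_v)
          moreover have "ereal C < ereal (C + 1)" by simp
          ultimately show ?thesis by (rule less_le_trans[rotated])
        qed
        thus ?thesis by blast
      qed
      then obtain x where x: "x \<in> K" "\<And>C::real. \<exists>N. \<forall>i\<ge>N. ereal C < v (f i - x)"
        using compl f(1) unfolding complete_wrt_def by blast
      have "f i - x \<in> N.M (real i)" for i
      proof -
        obtain N where N: "\<forall>j\<ge>N. ereal (real i) < v (f j - x)" using x(2)[of "real i"] by blast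
        \<comment> \<open>Completeness of \<open>K\<close> provides no rate of convergence. A late
          member close to the limit, combined with telescoping back to \<open>i\<close>, restores
          the rate.\<close>
        define j where "j = max N i"
        have "ereal (real i) \<le> v (f j - x)" using N by (simp add: j_def less_imp_le)
        hence "f j - x \<in> N.M (real p * real i)" by (simp only: M_iff_v)
        moreover have "1 * real i \<le> real p * real i" using p2 by (intro mult_right_mono) auto
        ultimately have "f j - x \<in> N.M (real i)" by (auto elim: N.M_mono)
        moreover have "f i - f j \<in> N.M (real i)" by (rule tele) (auto simp: j_def)
        ultimately show ?thesis using N.M_trans by blast
      qed
      thus ?thesis using x(1) by blast
    qed
    show "k \<subseteq> K" by (rule kK)
    show "scaled_val p v a = 0" if "a \<in> k" "a \<noteq> 0" for a
    proof -
      \<comment> \<open>Since \<open>k\<close> is a field, the nonnegativity of values applies to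
        \<open>a\<close> and to its inverse.\<close>
      have "a \<in> N.M 0" "inverse a \<in> N.M 0" using k0 that k.inverse_mem V_M0 by auto
      thus ?thesis using that by (simp add: N.M_iff N.V_inverse)
    qed
    show "\<exists>a\<in>k. x - a \<in> N.Ms 0" if "x \<in> K" "x \<in> N.M 0" for x
      using res that by (simp add: V_M0 V_Ms)
    show "\<exists>c\<in>k. c ^ p = a" if "a \<in> k" for a
      using assms(6) that by (simp add: perfect_char_def)
    show "separable_over K x" for x using assms(4) by (simp add: is_separable_closure_def)
    show "\<exists>x. poly g x = 0" if "separable_poly g" "Polynomial.degree g > 0" for g :: "'s poly"
      using assms(4) that by (simp add: is_separable_closure_def)
    show "l < p" using assms(12,13) by linarith
  qed (use Kf kf np m' assms fv vK in \<open>auto simp: subfield_set_def\<close>)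
  have b: "b = real n / (real p - 1)" by fact
  have t: "prime_K \<pi>\<^sub>K" using assms(7) prime_element_K by blast
  have R: "R \<subseteq> k - {0}" and reps: "\<And>x. x \<in> k - {0} \<Longrightarrow> \<exists>!r. r \<in> R \<and> (\<exists>h\<in>unit_powers k n. x = r * h)"
    using assms(14) by (auto simp: coset_representatives_def)
  have E: "amano_root \<pi>\<^sub>K \<omega> (\<pi> \<omega>)" if "\<omega> \<in> R" for \<omega>
  proof -
    have "poly (amano_poly p m l \<pi>\<^sub>K \<omega>) (\<pi> \<omega>) = 0" using assms(15) that by blast
    thus ?thesis unfolding amano_poly_def m'(1) by (simp add: poly_monom amano_root_def algebra_simps)
  qed
  have inE: "field_adjoin K (\<pi> \<omega>) \<in> \<E> v K p b" if "\<omega> \<in> R" for \<omega>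
    unfolding b using R E that by (intro amano_root_ramified[OF t]) auto
  have "inj_on (\<lambda>\<omega>. k_iso_rel v K p b `` {field_adjoin K (\<pi> \<omega>)}) R"
  proof (rule inj_onI)
    fix \<omega>1 \<omega>2 assume \<omega>: "\<omega>1 \<in> R" "\<omega>2 \<in> R"
      and eq: "k_iso_rel v K p b `` {field_adjoin K (\<pi> \<omega>1)} = k_iso_rel v K p b `` {field_adjoin K (\<pi> \<omega>2)}"
    have "(field_adjoin K (\<pi> \<omega>1), field_adjoin K (\<pi> \<omega>2)) \<in> k_iso_rel v K p b"
      using eq_equiv_class[OF eq equiv_k_iso_rel inE[OF \<omega>(2)]] .
    hence "k_isomorphic v K (field_adjoin K (\<pi> \<omega>1)) (field_adjoin K (\<pi> \<omega>2))"
      by (simp add: k_iso_rel_def)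
    then obtain c where c: "c \<in> k" "c \<noteq> 0" "\<omega>2 = \<omega>1 * c ^ n"
      using k_isomorphic_imp_coset[OF t _ _ _ _ E[OF \<omega>(1)] E[OF \<omega>(2)]] R \<omega> by blast
    have "\<exists>h\<in>unit_powers k n. \<omega>2 = \<omega>1 * h" using c by (auto simp: unit_powers_def)
    moreover have "\<exists>h\<in>unit_powers k n. \<omega>2 = \<omega>2 * h"
      by (intro bexI[of _ 1]) (auto simp: unit_powers_def intro!: image_eqI[of _ _ 1])
    ultimately show "\<omega>1 = \<omega>2" using reps[of \<omega>2] R \<omega> by blast
  qed
  moreover have "(\<lambda>\<omega>. k_iso_rel v K p b `` {field_adjoin K (\<pi> \<omega>)}) ` R = \<S> v K p b"
  proof (intro equalityI subsetI)
    fix C assume "C \<in> (\<lambda>\<omega>. k_iso_rel v K p b `` {field_adjoin K (\<pi> \<omega>)}) ` R"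
    thus "C \<in> \<S> v K p b" unfolding k_iso_classes_def using inE by (auto intro: quotientI)
  next
    fix C assume "C \<in> \<S> v K p b"
    then obtain L where L: "L \<in> \<E> v K p b" "C = k_iso_rel v K p b `` {L}"
      unfolding k_iso_classes_def by (auto elim: quotientE)
    from ramified_ext_k_isomorphic[OF t L(1)[unfolded b]] obtain \<omega>0 where
      \<omega>0: "\<omega>0 \<in> k" "\<omega>0 \<noteq> 0" and iso: "\<forall>\<omega> c x. \<omega> \<in> k \<and> c \<in> k \<and> c \<noteq> 0 \<and> \<omega>0 = \<omega> * c ^ n \<and> amano_root \<pi>\<^sub>K \<omega> x \<longrightarrow>
        k_isomorphic v K L (field_adjoin K x)" .
    obtain \<omega> h where \<omega>: "\<omega> \<in> R" "h \<in> unit_powers k n" "\<omega>0 = \<omega> * h" using reps[of \<omega>0] \<omega>0 by blast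
    then obtain c where "c \<in> k" "c \<noteq> 0" "\<omega>0 = \<omega> * c ^ n" by (auto simp: unit_powers_def)
    hence "k_isomorphic v K L (field_adjoin K (\<pi> \<omega>))" using iso E[OF \<omega>(1)] R \<omega>(1) by blast
    hence "(L, field_adjoin K (\<pi> \<omega>)) \<in> k_iso_rel v K p b" using L(1) inE[OF \<omega>(1)] by (simp add: k_iso_rel_def)
    hence "C = k_iso_rel v K p b `` {field_adjoin K (\<pi> \<omega>)}"
      unfolding L(2) by (rule equiv_class_eq[OF equiv_k_iso_rel])
    thus "C \<in> (\<lambda>\<omega>. k_iso_rel v K p b `` {field_adjoin K (\<pi> \<omega>)}) ` R" using \<omega>(1) by blast
  qed
  moreover have "galois_extension K (field_adjoin K (\<pi> \<omega>)) \<longleftrightarrow>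
      (\<exists>j::nat. j > 0 \<and> \<not> p dvd j \<and> b = real j) \<and> of_nat l * \<omega> \<in> unit_powers k (p - 1)"
    if "\<omega> \<in> R" for \<omega>
    unfolding b by (rule amano_root_galois_iff[OF t _ _ E[OF that] assms(10)]) (use R that in auto)
  ultimately show ?thesis unfolding bij_betw_def by blast
qed

end
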